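(* Let $L$ be a nontrivial finite or countable group. Let $d\ge3$. Let $\mu$ be a probability measure of finite entropy on $L\wr\mathbb Z^d$ whose support generates $L\wr\mathbb Z^d$. Suppose that $\mu$ is concentrated on $$\{(\delta^{s},o): s\in L\}\cup\{(\mathbf{ID},x): x\in\mathbb Z^d\}.$$ If the projection of $\mu$ on $\mathbb Z^d$ is finitely supported and has mean $\mathbf 0$, then the Poisson boundary of $(L\wr\mathbb Z^d,\mu)$ is $L^{\mathbb Z^d}$ endowed with the law of the limiting lamp configuration $\Phi_\infty$.
   Context: Restricted wreath product. For groups $L$ (identity $\mathrm{id}$) and $\Lambda$ (identity $o$), $L\wr\Lambda$ is the set of pairs $(\Phi,x)$ with $x\in\Lambda$ and $\Phi:\Lambda\to L$ with $\Phi(z)=\mathrm{id}$ for all but finitely many $z$, with product $(\Phi,x)(\Psi,y)=(\Phi\cdot(x\Psi),xy)$, where $(x\Psi)(z):=\Psi(x^{-1}z)$ and $\cdot$ is the pointwise product. Here $\Lambda=\mathbb Z^d$ (so $o=\mathbf 0$). $\mathbf{ID}$ is the function identically equal to $\mathrm{id}$; for $s\in L$, $\delta^s$ is the function equal to $s$ at $o$ and to $\mathrm{id}$ elsewhere. The projection of $\mu$ on $\Lambda$ is its push-forward under $(\Phi,x)\mapsto x$. Entropy of $\mu$: $H(\mu)=-\sum_g\mu(g)\log\mu(g)$. "The support generates" means generates as a group. Random walk. For a probability measure $\mu$ on a countable group $\Gamma$, the $\mu$-walk is the Markov chain with transition probabilities $p(x,y)=\mu(x^{-1}y)$; $\mathbf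 P$ denotes the law on $\Gamma^{\mathbb N}$ ($\mathbb N\ni 0$) of the trajectory started at the identity. $\mathcal I$ is the $\sigma$-field of shift-invariant measurable subsets of $\Gamma^{\mathbb N}$; $\Gamma$ acts on $\Gamma^{\mathbb N}$ by diagonal left multiplication. Two $\sigma$-fields are equal mod $\mathbf P$ if their $\mathbf P$-completions are equal. Poisson boundary. A Poisson boundary of $(\Gamma,\mu)$ is a quadruple $(\Theta,\mathcal F,\nu,b)$ where $(\Theta,\mathcal F,\nu)$ is a probability space on which $\Gamma$ acts measurably, $\mathcal F$ is countably generated and separates points, and $b:(\Gamma^{\mathbb N},\mathcal I)\to(\Theta,\mathcal F)$ is a measurable map that is $\Gamma$-equivariant (for each $\gamma\in\Gamma$, $b(\gamma\omega)=\gamma b(\omega)$ for $\mathbf P$-a.e. $\omega$), pushes $\mathbf P$ forward to $\nu$, and satisfies $b^{-1}\mathcal F=\mathcal I$ mod $\mathbf P$. It is unique up to isomorphism. Meaning of the conclusion. Write the $\mu$-walk on $L\wr\Lambda$ started at the identity as $(\Phi_n,X_n)$, $n\ge0$. Let $\Phi_\infty:=\lim_n\Phi_n\in L^\Lambda$ be the pointwise limit (each coordinate eventually constant), which exists almost surely under the present hypotheses. "The Poisson boundary is $L^\Lambda$ endowed with the law of $\Phi_\infty$" means that $(L^\Lambda,\mathcal F,\nu,b)$ is a Poisson boundary of $(L\wr\Lambda,\mu)$, where $\mathcal F$ is the product $\sigma$-field, $\nu$ is the law of $\Phi_\infty$, $L\wr\Lambda$ acts on $L^\Lambda$ by $(\Phi,x)\cdot\phi=\Phi\cdot(x\phi)$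 with $(x\phi)(z)=\phi(x^{-1}z)$, and $b$ sends a trajectory to its limiting lamp configuration if it exists and to $\mathbf{ID}$ otherwise. *)

theory Defs
  imports "HOL-Algebra.Generated_Groups" "HOL-Algebra.Group_Action" "HOL-Probability.Probability"
begin

section \<open>Restricted wreath products\<close>

text \<open>Lamp configurations are extensional functions on the carrier of the base group.\<close>

definition lamp_configs ::
    "('l, 'm) monoid_scheme \<Rightarrow> ('x, 'n) monoid_scheme \<Rightarrow> ('x \<Rightarrow> 'l) set" where
  "lamp_configs L \<Lambda> = carrier \<Lambda> \<rightarrow>\<^sub>E carrier L"

definition translate_config :: "('x, 'n) monoid_scheme \<Rightarrow> 'x \<Rightarrow> ('x \<Rightarrow> 'l) \<Rightarrow> 'x \<Rightarrow> 'l" where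
  "translate_config \<Lambda> x \<phi> = (\<lambda>z\<in>carrier \<Lambda>. \<phi> (inv\<^bsub>\<Lambda>\<^esub> x \<otimes>\<^bsub>\<Lambda>\<^esub> z))"

definition mult_config ::
    "('l, 'm) monoid_scheme \<Rightarrow> ('x, 'n) monoid_scheme \<Rightarrow> ('x \<Rightarrow> 'l) \<Rightarrow> ('x \<Rightarrow> 'l) \<Rightarrow> 'x \<Rightarrow> 'l" where
  "mult_config L \<Lambda> \<phi> \<psi> = (\<lambda>z\<in>carrier \<Lambda>. \<phi> z \<otimes>\<^bsub>L\<^esub> \<psi> z)"

definition id_config :: "('l, 'm) monoid_scheme \<Rightarrow> ('x, 'n) monoid_scheme \<Rightarrow> 'x \<Rightarrow> 'l" where
  "id_config L \<Lambda> = (\<lambda>z\<in>carrier \<Lambda>. \<one>\<^bsub>L\<^esub>)"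

definition delta_config ::
    "('l, 'm) monoid_scheme \<Rightarrow> ('x, 'n) monoid_scheme \<Rightarrow> 'l \<Rightarrow> 'x \<Rightarrow> 'l" where
  "delta_config L \<Lambda> s = (\<lambda>z\<in>carrier \<Lambda>. if z = \<one>\<^bsub>\<Lambda>\<^esub> then s else \<one>\<^bsub>L\<^esub>)"

definition wreath_product ::
    "('l, 'm) monoid_scheme \<Rightarrow> ('x, 'n) monoid_scheme \<Rightarrow> (('x \<Rightarrow> 'l) \<times> 'x) monoid" where
  "wreath_product L \<Lambda> =
    \<lparr>carrier = {(\<Phi>, x). \<Phi> \<in> lamp_configs L \<Lambda> \<and> x \<in> carrier \<Lambda> \<and>
                       finite {z \<in> carrier \<Lambda>. \<Phi> z \<noteq> \<one>\<^bsub>L\<^esub>}},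
     monoid.mult = (\<lambda>(\<Phi>, x) (\<Psi>, y). (mult_config L \<Lambda> \<Phi> (translate_config \<Lambda> x \<Psi>), x \<otimes>\<^bsub>\<Lambda>\<^esub> y)),
     one = (id_config L \<Lambda>, \<one>\<^bsub>\<Lambda>\<^esub>)\<rparr>"

lemma group_wreath_product:
  assumes "group L" "group \<Lambda>"
  shows "group (wreath_product L \<Lambda>)"
proof -
  interpret L: group L by fact
  interpret B: group \<Lambda> by fact
  note defs = wreath_product_def lamp_configs_def translate_config_def mult_config_def id_config_def
  show ?thesis
  proof (rule groupI)
    fix g h assume "g \<in> carrier (wreath_product L \<Lambda>)" "h \<in> carrier (wreath_product L \<Lambda>)"
    then obtain \<Phi> x \<Psi> y where *: "g = (\<Phi>, x)" "h = (\<Psi>, y)" "\<Phi> \<in> lamp_configs L \<Lambda>"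
      "\<Psi> \<in> lamp_configs L \<Lambda>" "x \<in> carrier \<Lambda>" "y \<in> carrier \<Lambda>"
      "finite {z \<in> carrier \<Lambda>. \<Phi> z \<noteq> \<one>\<^bsub>L\<^esub>}" "finite {z \<in> carrier \<Lambda>. \<Psi> z \<noteq> \<one>\<^bsub>L\<^esub>}"
      by (cases g, cases h) (auto simp: wreath_product_def)
    have "{z \<in> carrier \<Lambda>. \<Phi> z \<otimes>\<^bsub>L\<^esub> \<Psi> (inv\<^bsub>\<Lambda>\<^esub> x \<otimes>\<^bsub>\<Lambda>\<^esub> z) \<noteq> \<one>\<^bsub>L\<^esub>}
        \<subseteq> {z \<in> carrier \<Lambda>. \<Phi> z \<noteq> \<one>\<^bsub>L\<^esub>} \<union> (\<lambda>z. x \<otimes>\<^bsub>\<Lambda>\<^esub> z) ` {z \<in> carrier \<Lambda>. \<Psi> z \<noteq> \<one>\<^bsub>L\<^esub>}"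
    proof
      fix z assume z: "z \<in> {z \<in> carrier \<Lambda>. \<Phi> z \<otimes>\<^bsub>L\<^esub> \<Psi> (inv\<^bsub>\<Lambda>\<^esub> x \<otimes>\<^bsub>\<Lambda>\<^esub> z) \<noteq> \<one>\<^bsub>L\<^esub>}"
      have "z = x \<otimes>\<^bsub>\<Lambda>\<^esub> (inv\<^bsub>\<Lambda>\<^esub> x \<otimes>\<^bsub>\<Lambda>\<^esub> z)" "inv\<^bsub>\<Lambda>\<^esub> x \<otimes>\<^bsub>\<Lambda>\<^esub> z \<in> carrier \<Lambda>"
        using z * by (auto simp: B.m_assoc[symmetric])
      then show "z \<in> {z \<in> carrier \<Lambda>. \<Phi> z \<noteq> \<one>\<^bsub>L\<^esub>} \<union> (\<lambda>z. x \<otimes>\<^bsub>\<Lambda>\<^esub> z) ` {z \<in> carrier \<Lambda>. \<Psi> z \<noteq> \<one>\<^bsub>L\<^esub>}"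
        using z by (cases "\<Psi> (inv\<^bsub>\<Lambda>\<^esub> x \<otimes>\<^bsub>\<Lambda>\<^esub> z) = \<one>\<^bsub>L\<^esub>") auto
    qed
    then have "finite {z \<in> carrier \<Lambda>. \<Phi> z \<otimes>\<^bsub>L\<^esub> \<Psi> (inv\<^bsub>\<Lambda>\<^esub> x \<otimes>\<^bsub>\<Lambda>\<^esub> z) \<noteq> \<one>\<^bsub>L\<^esub>}"
      by (rule finite_subset) (use * in auto)
    then show "g \<otimes>\<^bsub>wreath_product L \<Lambda>\<^esub> h \<in> carrier (wreath_product L \<Lambda>)"
      using * by (auto simp: defs PiE_iff cong: conj_cong)
  next
    show "\<one>\<^bsub>wreath_product L \<Lambda>\<^esub> \<in> carrier (wreath_product L \<Lambda>)"
      by (auto simp: defs cong: conj_cong)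
  next
    fix g h k
    assume "g \<in> carrier (wreath_product L \<Lambda>)" "h \<in> carrier (wreath_product L \<Lambda>)"
      "k \<in> carrier (wreath_product L \<Lambda>)"
    then show "g \<otimes>\<^bsub>wreath_product L \<Lambda>\<^esub> h \<otimes>\<^bsub>wreath_product L \<Lambda>\<^esub> k =
        g \<otimes>\<^bsub>wreath_product L \<Lambda>\<^esub> (h \<otimes>\<^bsub>wreath_product L \<Lambda>\<^esub> k)"
      by (auto simp: defs PiE_iff fun_eq_iff restrict_def L.m_assoc B.m_assoc B.inv_mult_group)
  next
    fix g assume "g \<in> carrier (wreath_product L \<Lambda>)"
    then show "\<one>\<^bsub>wreath_product L \<Lambda>\<^esub> \<otimes>\<^bsub>wreath_product L \<Lambda>\<^esub> g = g"
      by (auto simp: defs PiE_iff fun_eq_iff extensional_def)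
  next
    fix g assume "g \<in> carrier (wreath_product L \<Lambda>)"
    then obtain \<Phi> x where *: "g = (\<Phi>, x)" "\<Phi> \<in> lamp_configs L \<Lambda>" "x \<in> carrier \<Lambda>"
      "finite {z \<in> carrier \<Lambda>. \<Phi> z \<noteq> \<one>\<^bsub>L\<^esub>}"
      by (cases g) (auto simp: wreath_product_def)
    let ?\<Psi> = "\<lambda>z\<in>carrier \<Lambda>. inv\<^bsub>L\<^esub> \<Phi> (x \<otimes>\<^bsub>\<Lambda>\<^esub> z)"
    have \<Phi>: "\<Phi> z \<in> carrier L" if "z \<in> carrier \<Lambda>" for z
      using * that by (auto simp: lamp_configs_def)
    have "{z \<in> carrier \<Lambda>. ?\<Psi> z \<noteq> \<one>\<^bsub>L\<^esub>} \<subseteq> (\<lambda>z. inv\<^bsub>\<Lambda>\<^esub> x \<otimes>\<^bsub>\<Lambda>\<^esub> z) ` {z \<in> carrier \<Lambda>. \<Phi> z \<noteq> \<one>\<^bsub>L\<^esub>}"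
    proof
      fix z assume z: "z \<in> {z \<in> carrier \<Lambda>. ?\<Psi> z \<noteq> \<one>\<^bsub>L\<^esub>}"
      have "z = inv\<^bsub>\<Lambda>\<^esub> x \<otimes>\<^bsub>\<Lambda>\<^esub> (x \<otimes>\<^bsub>\<Lambda>\<^esub> z)" "x \<otimes>\<^bsub>\<Lambda>\<^esub> z \<in> carrier \<Lambda>"
        using z * by (auto simp: B.m_assoc[symmetric])
      moreover have "\<Phi> (x \<otimes>\<^bsub>\<Lambda>\<^esub> z) \<noteq> \<one>\<^bsub>L\<^esub>" using z by auto
      ultimately show "z \<in> (\<lambda>z. inv\<^bsub>\<Lambda>\<^esub> x \<otimes>\<^bsub>\<Lambda>\<^esub> z) ` {z \<in> carrier \<Lambda>. \<Phi> z \<noteq> \<one>\<^bsub>L\<^esub>}" by blast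
    qed
    then have fin: "finite {z \<in> carrier \<Lambda>. ?\<Psi> z \<noteq> \<one>\<^bsub>L\<^esub>}"
      by (rule finite_subset) (use * in auto)
    have "(?\<Psi>, inv\<^bsub>\<Lambda>\<^esub> x) \<in> carrier (wreath_product L \<Lambda>)"
      using fin \<Phi> * by (simp add: wreath_product_def lamp_configs_def PiE_iff)
    moreover have "(?\<Psi>, inv\<^bsub>\<Lambda>\<^esub> x) \<otimes>\<^bsub>wreath_product L \<Lambda>\<^esub> g = \<one>\<^bsub>wreath_product L \<Lambda>\<^esub>"
      using \<Phi> * by (auto simp: defs fun_eq_iff)
    ultimately show "\<exists>h\<in>carrier (wreath_product L \<Lambda>).
        h \<otimes>\<^bsub>wreath_product L \<Lambda>\<^esub> g = \<one>\<^bsub>wreath_product L \<Lambda>\<^esub>"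
      by blast
  qed
qed

definition int_lattice :: "(int ^ 'd) monoid" where
  "int_lattice = \<lparr>carrier = UNIV, monoid.mult = (+), one = 0\<rparr>"

lemma group_int_lattice: "group (int_lattice :: (int ^ 'd) monoid)"
proof (rule groupI)
  fix x :: "int ^ 'd"
  show "\<exists>y\<in>carrier int_lattice. y \<otimes>\<^bsub>int_lattice\<^esub> x = \<one>\<^bsub>int_lattice\<^esub>"
    by (rule bexI[of _ "- x"]) (simp_all add: int_lattice_def)
qed (simp_all add: int_lattice_def add.assoc)

section \<open>Random walks on countable groups\<close>

text \<open>The terms of the sum are nonnegative, hence a value in \<open>ennreal\<close>.\<close>

definition entropy_pmf :: "'g pmf \<Rightarrow> ennreal" where
  "entropy_pmf \<mu> = (\<integral>\<^sup>+ g. ennreal (- (pmf \<mu> g * ln (pmf \<mu> g))) \<partial>count_space UNIV)"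

definition path_space :: "('g, 'm) monoid_scheme \<Rightarrow> (nat \<Rightarrow> 'g) measure" where
  "path_space G = (\<Pi>\<^sub>M n\<in>UNIV. count_space (carrier G))"

text \<open>The walk is constructed from independent \<open>\<mu>\<close>-distributed increments; the lemma
  \<open>walk_law_cylinder\<close> below states that it is the Markov chain started at the identity
  with transition probabilities \<open>p(x, y) = \<mu>(x\<inverse>y)\<close>.\<close>

primrec walk_path :: "('g, 'm) monoid_scheme \<Rightarrow> (nat \<Rightarrow> 'g) \<Rightarrow> nat \<Rightarrow> 'g" where
  "walk_path G \<xi> 0 = \<one>\<^bsub>G\<^esub>"
| "walk_path G \<xi> (Suc n) = walk_path G \<xi> n \<otimes>\<^bsub>G\<^esub> \<xi> n"

definition walk_law :: "('g, 'm) monoid_scheme \<Rightarrow> 'g pmf \<Rightarrow> (nat \<Rightarrow> 'g) measure" where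
  "walk_law G \<mu> =
    distr (\<Pi>\<^sub>M n\<in>UNIV. restrict_space (measure_pmf \<mu>) (carrier G)) (path_space G) (walk_path G)"

lemma sets_restrict_pmf: "sets (restrict_space (measure_pmf \<mu>) A) = sets (count_space A)"
  by (auto simp: sets_restrict_space image_iff)

lemma prob_space_restrict_pmf:
  assumes "set_pmf \<mu> \<subseteq> A"
  shows "prob_space (restrict_space (measure_pmf \<mu>) A)"
proof (rule prob_space_restrict_space)
  show "emeasure (measure_pmf \<mu>) A = 1"
    using assms by (intro measure_pmf.emeasure_eq_1_AE) (auto simp: AE_measure_pmf_iff)
qed simp

lemma measurable_walk_path:
  assumes "group G" "countable (carrier G)"
  shows "walk_path G \<in> (\<Pi>\<^sub>M n\<in>UNIV. restrict_space (measure_pmf \<mu>) (carrier G)) \<rightarrow>\<^sub>M path_space G"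
proof -
  interpret group G by fact
  let ?M = "\<Pi>\<^sub>M n\<in>(UNIV::nat set). count_space (carrier G)"
  have "(\<lambda>\<xi>. walk_path G \<xi> n) \<in> ?M \<rightarrow>\<^sub>M count_space (carrier G)" for n
  proof (induction n)
    case (Suc n)
    have "(\<lambda>\<xi>. (walk_path G \<xi> n, \<xi> n)) \<in> ?M \<rightarrow>\<^sub>M count_space (carrier G) \<Otimes>\<^sub>M count_space (carrier G)"
      using Suc by measurable
    moreover have "(\<lambda>(a, b). a \<otimes>\<^bsub>G\<^esub> b) \<in> count_space (carrier G) \<Otimes>\<^sub>M count_space (carrier G)
        \<rightarrow>\<^sub>M count_space (carrier G)"
      using assms(2) by (subst pair_measure_countable) (auto simp: measurable_count_space_eq1)
    ultimately show ?case
      by (auto dest: measurable_compose)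
  qed simp
  then have m: "(\<lambda>\<xi>. walk_path G \<xi> n) \<in> ?M \<rightarrow>\<^sub>M count_space (carrier G)" for n .
  have "walk_path G \<in> ?M \<rightarrow>\<^sub>M path_space G"
    unfolding path_space_def
  proof (rule measurable_PiM_single')
    show "walk_path G \<in> space ?M \<rightarrow> (\<Pi>\<^sub>E n\<in>UNIV. space (count_space (carrier G)))"
    proof
      fix \<xi> assume "\<xi> \<in> space ?M"
      from measurable_space[OF m this] show "walk_path G \<xi> \<in> (\<Pi>\<^sub>E n\<in>UNIV. space (count_space (carrier G)))"
        by (simp add: PiE_iff)
    qed
  qed (rule m)
  moreover have "sets (\<Pi>\<^sub>M n\<in>(UNIV::nat set). restrict_space (measure_pmf \<mu>) (carrier G)) = sets ?M"
    by (intro sets_PiM_cong) (auto simp: sets_restrict_pmf)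
  ultimately show ?thesis
    using measurable_cong_sets by blast
qed

lemma walk_law_cylinder:
  assumes "group G" "countable (carrier G)" "set_pmf \<mu> \<subseteq> carrier G"
    and x: "\<And>i. i \<le> n \<Longrightarrow> x i \<in> carrier G"
  shows "measure (walk_law G \<mu>) {\<omega> \<in> space (path_space G). \<forall>i\<le>n. \<omega> i = x i} =
    (if x 0 = \<one>\<^bsub>G\<^esub> then \<Prod>i<n. pmf \<mu> (inv\<^bsub>G\<^esub> (x i) \<otimes>\<^bsub>G\<^esub> x (Suc i)) else 0)"
proof -
  interpret group G by fact
  let ?R = "restrict_space (measure_pmf \<mu>) (carrier G)"
  let ?M = "\<Pi>\<^sub>M n\<in>(UNIV::nat set). ?R"
  let ?C = "{\<omega> \<in> space (path_space G). \<forall>i\<le>n. \<omega> i = x i}"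
  interpret R: prob_space ?R using assms(3) by (rule prob_space_restrict_pmf)
  interpret P: product_prob_space "\<lambda>_::nat. ?R" UNIV by unfold_locales
  have spR: "space ?R = carrier G" by (simp add: space_restrict_space)
  have C: "?C \<in> sets (path_space G)"
  proof -
    have "?C = {\<omega> \<in> space (path_space G). \<forall>i\<in>{..n}. \<omega> i \<in> {x i}}" by auto
    also have "\<dots> \<in> sets (path_space G)"
      unfolding path_space_def using x
      by (intro sets.sets_Collect_finite_All' sets_PiM_I_countable sets_Collect_single) auto
    finally show ?thesis .
  qed
  have pre: "walk_path G -` ?C \<inter> space ?M =
      (if x 0 = \<one>\<^bsub>G\<^esub> then {\<xi> \<in> space ?M. \<forall>i\<in>{..<n}. \<xi> i \<in> {inv\<^bsub>G\<^esub> (x i) \<otimes>\<^bsub>G\<^esub> x (Suc i)}} else {})"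
  proof -
    have "(\<forall>i\<le>m. walk_path G \<xi> i = x i) \<longleftrightarrow>
        x 0 = \<one>\<^bsub>G\<^esub> \<and> (\<forall>i<m. \<xi> i = inv\<^bsub>G\<^esub> (x i) \<otimes>\<^bsub>G\<^esub> x (Suc i))"
      if \<xi>: "\<And>i. \<xi> i \<in> carrier G" and "m \<le> n" for \<xi> m
      using \<open>m \<le> n\<close>
    proof (induction m)
      case (Suc m)
      have xm: "x m \<in> carrier G" "x (Suc m) \<in> carrier G" using x Suc.prems by auto
      have "x m \<otimes>\<^bsub>G\<^esub> \<xi> m = x (Suc m) \<longleftrightarrow> \<xi> m = inv\<^bsub>G\<^esub> (x m) \<otimes>\<^bsub>G\<^esub> x (Suc m)"
        using xm \<xi>[of m] by (metis inv_solve_left)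
      with Suc show ?case
        by (auto simp: le_Suc_eq less_Suc_eq)
    qed auto
    moreover have "walk_path G \<xi> \<in> space (path_space G)" if "\<xi> \<in> space ?M" for \<xi>
      using measurable_space[OF measurable_walk_path[OF assms(1,2)] that] .
    moreover have "\<xi> i \<in> carrier G" if "\<xi> \<in> space ?M" for \<xi> i
      using that by (auto simp: space_PiM spR)
    ultimately have "\<xi> \<in> walk_path G -` ?C \<longleftrightarrow>
        x 0 = \<one>\<^bsub>G\<^esub> \<and> (\<forall>i<n. \<xi> i = inv\<^bsub>G\<^esub> (x i) \<otimes>\<^bsub>G\<^esub> x (Suc i))" if "\<xi> \<in> space ?M" for \<xi>
      using that by simp
    then show ?thesis by auto
  qed
  have "measure (walk_law G \<mu>) ?C = measure ?M (walk_path G -` ?C \<inter> space ?M)"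
    unfolding walk_law_def by (rule measure_distr[OF measurable_walk_path[OF assms(1,2)] C])
  also have "\<dots> = (if x 0 = \<one>\<^bsub>G\<^esub> then \<Prod>i<n. pmf \<mu> (inv\<^bsub>G\<^esub> (x i) \<otimes>\<^bsub>G\<^esub> x (Suc i)) else 0)"
  proof (cases "x 0 = \<one>\<^bsub>G\<^esub>")
    case True
    have c: "inv\<^bsub>G\<^esub> (x i) \<otimes>\<^bsub>G\<^esub> x (Suc i) \<in> carrier G" if "i < n" for i
      using x that by auto
    have "measure ?M {\<xi> \<in> space ?M. \<forall>i\<in>{..<n}. \<xi> i \<in> {inv\<^bsub>G\<^esub> (x i) \<otimes>\<^bsub>G\<^esub> x (Suc i)}} =
        (\<Prod>i<n. measure ?R {inv\<^bsub>G\<^esub> (x i) \<otimes>\<^bsub>G\<^esub> x (Suc i)})"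
    proof -
      have "{inv\<^bsub>G\<^esub> (x i) \<otimes>\<^bsub>G\<^esub> x (Suc i)} \<in> sets ?R" if "i \<in> {..<n}" for i
        using c that by (simp add: sets_restrict_pmf)
      then have "emeasure ?M {\<xi> \<in> space ?M. \<forall>i\<in>{..<n}. \<xi> i \<in> {inv\<^bsub>G\<^esub> (x i) \<otimes>\<^bsub>G\<^esub> x (Suc i)}} =
          (\<Prod>i<n. emeasure ?R {inv\<^bsub>G\<^esub> (x i) \<otimes>\<^bsub>G\<^esub> x (Suc i)})"
        by (intro P.emeasure_PiM_Collect) simp_all
      then show ?thesis
        unfolding P.emeasure_eq_measure R.emeasure_eq_measure
        by (simp add: prod_ennreal prod_nonneg)
    qed
    also have "\<dots> = (\<Prod>i<n. pmf \<mu> (inv\<^bsub>G\<^esub> (x i) \<otimes>\<^bsub>G\<^esub> x (Suc i)))"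
    proof (rule prod.cong[OF refl])
      fix i assume "i \<in> {..<n}"
      with c show "measure ?R {inv\<^bsub>G\<^esub> (x i) \<otimes>\<^bsub>G\<^esub> x (Suc i)} = pmf \<mu> (inv\<^bsub>G\<^esub> (x i) \<otimes>\<^bsub>G\<^esub> x (Suc i))"
        by (simp add: measure_restrict_space pmf.rep_eq)
    qed
    finally show ?thesis unfolding pre if_P[OF True] .
  next
    case False
    show ?thesis unfolding pre if_not_P[OF False] by (rule measure_empty)
  qed
  finally show ?thesis .
qed

section \<open>Poisson boundaries\<close>

definition path_shift :: "(nat \<Rightarrow> 'g) \<Rightarrow> nat \<Rightarrow> 'g" where
  "path_shift \<omega> = (\<lambda>n. \<omega> (Suc n))"

definition invariant_events :: "('g, 'm) monoid_scheme \<Rightarrow> (nat \<Rightarrow> 'g) set set" where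
  "invariant_events G =
    {A \<in> sets (path_space G). path_shift -` A \<inter> space (path_space G) = A}"

definition invariant_field :: "('g, 'm) monoid_scheme \<Rightarrow> (nat \<Rightarrow> 'g) measure" where
  "invariant_field G = sigma (space (path_space G)) (invariant_events G)"

lemma sets_invariant_field: "sets (invariant_field G) = invariant_events G"
proof -
  have "sigma_algebra (space (path_space G)) (invariant_events G)"
    unfolding sigma_algebra_iff2
  proof (intro conjI ballI allI impI)
    show "invariant_events G \<subseteq> Pow (space (path_space G))"
      using sets.sets_into_space by (auto simp: invariant_events_def)
    have sh: "path_shift \<omega> \<in> space (path_space G)" if "\<omega> \<in> space (path_space G)" for \<omega> :: "nat \<Rightarrow> 'a"
      using that by (simp add: path_space_def space_PiM path_shift_def PiE_iff)
    show "space (path_space G) - A \<in> invariant_events G" if "A \<in> invariant_events G" for A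
    proof -
      have A: "A \<in> sets (path_space G)" "path_shift -` A \<inter> space (path_space G) = A"
        using that unfolding invariant_events_def by blast+
      have "path_shift -` (space (path_space G) - A) \<inter> space (path_space G)
          = space (path_space G) - (path_shift -` A \<inter> space (path_space G))"
        using sh by blast
      with A show ?thesis
        unfolding invariant_events_def by (metis (mono_tags, lifting) mem_Collect_eq sets.compl_sets)
    qed
    show "(\<Union>i. A i) \<in> invariant_events G" if "range A \<subseteq> invariant_events G" for A :: "nat \<Rightarrow> _"
    proof -
      have A: "A i \<in> sets (path_space G)" "path_shift -` A i \<inter> space (path_space G) = A i" for i
        using that unfolding invariant_events_def by blast+
      have "path_shift -` (\<Union>i. A i) \<inter> space (path_space G) =
          (\<Union>i. path_shift -` A i \<inter> space (path_space G))"
        by blast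
      then have "path_shift -` (\<Union>i. A i) \<inter> space (path_space G) = (\<Union>i. A i)"
        by (simp add: A(2))
      with A(1) show ?thesis
        unfolding invariant_events_def by (simp add: sets.countable_nat_UN image_subset_iff)
    qed
  qed (simp add: invariant_events_def)
  then show ?thesis
    unfolding invariant_field_def by (simp add: sigma_algebra.sets_measure_of_eq)
qed

text \<open>The null sets adjoined to the sub-\<open>\<sigma>\<close>-field \<open>\<A>\<close> are those of \<open>M\<close> itself,
  not just those of the restriction of \<open>M\<close> to \<open>\<A>\<close>.\<close>

definition completed_field :: "'a measure \<Rightarrow> 'a set set \<Rightarrow> 'a set set" where
  "completed_field M \<A> = sigma_sets (space M) (\<A> \<union> {N. \<exists>N'\<in>null_sets M. N \<subseteq> N'})"

definition eq_mod_null :: "'a measure \<Rightarrow> 'a set set \<Rightarrow> 'a set set \<Rightarrow> bool" where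
  "eq_mod_null M \<A> \<B> \<longleftrightarrow> completed_field M \<A> = completed_field M \<B>"

definition countably_generated :: "'a measure \<Rightarrow> bool" where
  "countably_generated M \<longleftrightarrow>
    (\<exists>\<C>. countable \<C> \<and> \<C> \<subseteq> Pow (space M) \<and> sets M = sigma_sets (space M) \<C>)"

definition separates_points :: "'a measure \<Rightarrow> bool" where
  "separates_points M \<longleftrightarrow>
    (\<forall>x\<in>space M. \<forall>y\<in>space M. x \<noteq> y \<longrightarrow> (\<exists>A\<in>sets M. x \<in> A \<and> y \<notin> A))"

text \<open>The probability space \<open>(\<Theta>, \<F>, \<nu>)\<close> is the single measure \<open>N\<close>. As \<open>G\<close> is countable, its action
  is measurable iff each group element acts measurably.\<close>

definition poisson_boundary ::
    "('g, 'm) monoid_scheme \<Rightarrow> 'g pmf \<Rightarrow> 'b measure \<Rightarrow> ('g \<Rightarrow> 'b \<Rightarrow> 'b) \<Rightarrow>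
      ((nat \<Rightarrow> 'g) \<Rightarrow> 'b) \<Rightarrow> bool" where
  "poisson_boundary G \<mu> N act b \<longleftrightarrow>
    prob_space N \<and>
    group_action G (space N) act \<and>
    (\<forall>g\<in>carrier G. act g \<in> N \<rightarrow>\<^sub>M N) \<and>
    countably_generated N \<and>
    separates_points N \<and>
    b \<in> invariant_field G \<rightarrow>\<^sub>M N \<and>
    (\<forall>g\<in>carrier G. AE \<omega> in walk_law G \<mu>. b (\<lambda>n. g \<otimes>\<^bsub>G\<^esub> \<omega> n) = act g (b \<omega>)) \<and>
    distr (walk_law G \<mu>) N b = N \<and>
    eq_mod_null (walk_law G \<mu>)
      {b -` A \<inter> space (walk_law G \<mu>) | A. A \<in> sets N} (invariant_events G)"

section \<open>The limiting lamp configuration\<close>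

definition lamps_converge ::
    "('l, 'm) monoid_scheme \<Rightarrow> ('x, 'n) monoid_scheme \<Rightarrow> (nat \<Rightarrow> ('x \<Rightarrow> 'l) \<times> 'x) \<Rightarrow> bool" where
  "lamps_converge L \<Lambda> \<omega> \<longleftrightarrow>
    (\<forall>z\<in>carrier \<Lambda>. \<exists>l\<in>carrier L. \<forall>\<^sub>F n in sequentially. fst (\<omega> n) z = l)"

definition limit_lamps ::
    "('l, 'm) monoid_scheme \<Rightarrow> ('x, 'n) monoid_scheme \<Rightarrow>
      (nat \<Rightarrow> ('x \<Rightarrow> 'l) \<times> 'x) \<Rightarrow> 'x \<Rightarrow> 'l" where
  "limit_lamps L \<Lambda> \<omega> =
    (if lamps_converge L \<Lambda> \<omega>
     then (\<lambda>z\<in>carrier \<Lambda>. THE l. \<forall>\<^sub>F n in sequentially. fst (\<omega> n) z = l)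
     else id_config L \<Lambda>)"

definition lamp_space ::
    "('l, 'm) monoid_scheme \<Rightarrow> ('x, 'n) monoid_scheme \<Rightarrow> ('x \<Rightarrow> 'l) measure" where
  "lamp_space L \<Lambda> = (\<Pi>\<^sub>M z\<in>carrier \<Lambda>. count_space (carrier L))"

definition lamp_action ::
    "('l, 'm) monoid_scheme \<Rightarrow> ('x, 'n) monoid_scheme \<Rightarrow>
      ('x \<Rightarrow> 'l) \<times> 'x \<Rightarrow> ('x \<Rightarrow> 'l) \<Rightarrow> 'x \<Rightarrow> 'l" where
  "lamp_action L \<Lambda> = (\<lambda>(\<Phi>, x). \<lambda>\<phi>\<in>lamp_configs L \<Lambda>. mult_config L \<Lambda> \<Phi> (translate_config \<Lambda> x \<phi>))"

definition limit_law ::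
    "('l, 'm) monoid_scheme \<Rightarrow> ('x, 'n) monoid_scheme \<Rightarrow> (('x \<Rightarrow> 'l) \<times> 'x) pmf \<Rightarrow>
      ('x \<Rightarrow> 'l) measure" where
  "limit_law L \<Lambda> \<mu> =
    distr (walk_law (wreath_product L \<Lambda>) \<mu>) (lamp_space L \<Lambda>) (limit_lamps L \<Lambda>)"

end

theory Submission
  imports Defs "HOL-Real_Asymp.Real_Asymp"
begin

text \<open>
  By transience the limiting lamps determine the walk up to little information. Call the displacement of
  the base walk over each block of K steps its coarse path; it has entropy O(log K) per block. Given the
  coarse path, a site can only have been visited before time N by those blocks in whose neighbourhood it
  lies. If some such neighbourhood is not visited after time N, then the lamp at the site at time N is
  already the limiting one. So it suffices to reveal in addition all increments of the blocks whose
  neighbourhood is visited again after time N, and by transience these revelations have entropy o(N).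
  Hence H(X_N | limiting lamps in a finite window) = o(N).

  Such an estimate identifies the Poisson boundary by Kaimanovich's entropy argument, for which countably
  valued random variables suffice. If F is an invariant discrete function of the path (here the
  lamps in a window), equivariance bounds the entropy of n blocks of k increments given F below by n times
  the infimum over all windows of H(k increments | F), and the Markov property bounds it above by
  H(X_nk | F) + n sup_N H(k increments | X_N). For an invariant event A, H(k increments | A, F) is at
  least the same supremum, because A and F are functions of the path after time N for every N. So A has
  little entropy given F for a suitable window, that is, A is approximated by events in F.

  Transience: two steps 0 and v of positive probability spread the n-step distribution over a segment of
  length sqrt n in direction v; three independent directions give P(X_n = x) = O(n^(-3/2)).
\<close>

text \<open>\<open>L\<close> may be infinite, so even a rare event may carry much entropy. What
  saves the count of the revealed blocks is that the information in K increments is integrable: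
  increments shown only on an event of small probability have small entropy, uniformly over all
  blocks because their laws agree. First K is chosen so large that the entropy of a displacement,
  logarithmic in K, is small against K; then the number n of blocks so large that the boundedly many
  blocks near the end, which are likely to be seen again, are negligible among n. The space of
  configurations is uncountable, and the window grows with N. Hence the infimum over windows: a
  translate of one window is a function of another, so the infimum bounds all translates at once.
  The step 0 has positive probability because otherwise every increment would be a pure move and all
  lamps in the generated group would be trivial. Three independent directions exist because the
  steps of a generating set span R^d. Each direction contributes a factor n^(-1/2) on its own third
  of the time, and the exponent 3/2 is summable, as the Borel-Cantelli lemma requires.\<close>

section \<open>Conditional entropy of discrete random variables\<close>

context prob_space
begin

text \<open>Values are lists, pairs and options over arbitrary types, so measurability is asked of
  the fibres alone; as only countably many of them are nonempty, every function of \<open>X\<close>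
  is again measurable.\<close>

definition discrete_rv :: "('a \<Rightarrow> 'b) \<Rightarrow> bool" where
  "discrete_rv X \<longleftrightarrow> countable (X ` space M) \<and> (\<forall>b. X -` {b} \<inter> space M \<in> sets M)"

text \<open>The mass of the cell of \<open>\<omega>\<close> in the partition generated by
  \<open>X\<close>. Entropies become integrals of pointwise expressions, and variables with the same
  cells are interchangeable.\<close>

definition cell_prob :: "('a \<Rightarrow> 'b) \<Rightarrow> 'a \<Rightarrow> real" where
  "cell_prob X \<omega> = prob {\<omega>' \<in> space M. X \<omega>' = X \<omega>}"

definition ent :: "('a \<Rightarrow> 'b) \<Rightarrow> ennreal" where
  "ent X = (\<integral>\<^sup>+ \<omega>. ennreal (- ln (cell_prob X \<omega>)) \<partial>M)"

text \<open>The integrand is the information -ln P(X | Y) at \<open>\<omega>\<close>. It is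
  nonnegative because the joint cell lies in the cell of \<open>Y\<close>, so \<open>ennreal\<close>
  truncates nothing, and infinite entropies are allowed.\<close>

definition cond_ent :: "('a \<Rightarrow> 'b) \<Rightarrow> ('a \<Rightarrow> 'c) \<Rightarrow> ennreal" where
  "cond_ent X Y = (\<integral>\<^sup>+ \<omega>. ennreal (ln (cell_prob Y \<omega> / cell_prob (\<lambda>\<omega>. (X \<omega>, Y \<omega>)) \<omega>)) \<partial>M)"

text \<open>Recovery up to a null set: the position of the walk is recovered from its data only on
  trajectories with admissible increments and convergent lamps. Stating it through a property
  \<open>P\<close> avoids exhibiting a decoding function.\<close>

definition determines :: "('a \<Rightarrow> 'b) \<Rightarrow> ('a \<Rightarrow> 'c) \<Rightarrow> bool" where
  "determines Y X \<longleftrightarrow> (\<exists>P. (AE \<omega> in M. P \<omega>) \<and>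
    (\<forall>\<omega>\<in>space M. \<forall>\<omega>'\<in>space M. P \<omega> \<longrightarrow> P \<omega>' \<longrightarrow> Y \<omega> = Y \<omega>' \<longrightarrow> X \<omega> = X \<omega>'))"

lemma determinesI:
  assumes "\<And>\<omega> \<omega>'. \<omega> \<in> space M \<Longrightarrow> \<omega>' \<in> space M \<Longrightarrow> Y \<omega> = Y \<omega>' \<Longrightarrow> X \<omega> = X \<omega>'"
  shows "determines Y X"
  unfolding determines_def by (intro exI[of _ "\<lambda>_. True"]) (blast intro: assms AE_I2)

lemma determines_AE_I:
  assumes "AE \<omega> in M. X \<omega> = f (Y \<omega>)"
  shows "determines Y X"
  unfolding determines_def using assms by (intro exI[of _ "\<lambda>\<omega>. X \<omega> = f (Y \<omega>)"]) metis

lemma determines_trans: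
  assumes "determines X Y" "determines Y Z"
  shows "determines X Z"
proof -
  obtain P Q where "AE \<omega> in M. P \<omega>" "AE \<omega> in M. Q \<omega>"
    "\<forall>\<omega>\<in>space M. \<forall>\<omega>'\<in>space M. P \<omega> \<longrightarrow> P \<omega>' \<longrightarrow> X \<omega> = X \<omega>' \<longrightarrow> Y \<omega> = Y \<omega>'"
    "\<forall>\<omega>\<in>space M. \<forall>\<omega>'\<in>space M. Q \<omega> \<longrightarrow> Q \<omega>' \<longrightarrow> Y \<omega> = Y \<omega>' \<longrightarrow> Z \<omega> = Z \<omega>'"
    using assms unfolding determines_def by blast
  then show ?thesis
    unfolding determines_def by (intro exI[of _ "\<lambda>\<omega>. P \<omega> \<and> Q \<omega>"] conjI AE_conjI) blast+
qed

section \<open>Discrete random variables under composition and pairing\<close>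

lemma discrete_rv_measurable: "discrete_rv X \<Longrightarrow> X \<in> M \<rightarrow>\<^sub>M count_space UNIV"
proof (rule measurableI)
  fix A assume X: "discrete_rv X"
  have "X -` A \<inter> space M = (\<Union>b\<in>A \<inter> X ` space M. X -` {b} \<inter> space M)" by auto
  also have "\<dots> \<in> sets M"
    using X by (intro sets.countable_UN') (auto simp: discrete_rv_def)
  finally show "X -` A \<inter> space M \<in> sets M" .
qed simp

lemma discrete_rvI: "X \<in> M \<rightarrow>\<^sub>M count_space UNIV \<Longrightarrow> countable (X ` space M) \<Longrightarrow> discrete_rv X"
  by (auto simp: discrete_rv_def)

lemma discrete_rv_compose: "discrete_rv X \<Longrightarrow> discrete_rv (\<lambda>\<omega>. f (X \<omega>))"
proof (rule discrete_rvI)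
  assume X: "discrete_rv X"
  show "(\<lambda>\<omega>. f (X \<omega>)) \<in> M \<rightarrow>\<^sub>M count_space UNIV"
    by (rule measurable_compose[OF discrete_rv_measurable[OF X]]) simp
  have "(\<lambda>\<omega>. f (X \<omega>)) ` space M = f ` (X ` space M)" by auto
  then show "countable ((\<lambda>\<omega>. f (X \<omega>)) ` space M)"
    using X by (metis countable_image discrete_rv_def)
qed

lemma discrete_rv_Pair:
  assumes "discrete_rv X" "discrete_rv Y"
  shows "discrete_rv (\<lambda>\<omega>. (X \<omega>, Y \<omega>))"
proof -
  have "countable ((\<lambda>\<omega>. (X \<omega>, Y \<omega>)) ` space M)"
    by (rule countable_subset[of _ "X ` space M \<times> Y ` space M"])
      (use assms in \<open>auto simp: discrete_rv_def\<close>)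
  moreover have "(\<lambda>\<omega>. (X \<omega>, Y \<omega>)) -` {b} \<inter> space M =
      (X -` {fst b} \<inter> space M) \<inter> (Y -` {snd b} \<inter> space M)" for b
    by auto
  ultimately show ?thesis
    using assms by (auto simp: discrete_rv_def)
qed

lemma discrete_rv_const: "discrete_rv (\<lambda>_. c)"
  by (rule discrete_rvI) (auto intro: countable_subset[of _ "{c}"])

section \<open>Cells and their probabilities\<close>

lemma cell_sets: "discrete_rv X \<Longrightarrow> {\<omega> \<in> space M. X \<omega> = b} \<in> sets M"
proof -
  assume "discrete_rv X"
  moreover have "{\<omega> \<in> space M. X \<omega> = b} = X -` {b} \<inter> space M" by auto
  ultimately show ?thesis by (simp add: discrete_rv_def)
qed

lemma borel_measurable_discrete: "discrete_rv X \<Longrightarrow> (\<lambda>\<omega>. f (X \<omega>)) \<in> borel_measurable M"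
  by (rule measurable_compose[OF discrete_rv_measurable]) simp_all

lemma cell_prob_measurable: "discrete_rv X \<Longrightarrow> cell_prob X \<in> borel_measurable M"
  unfolding cell_prob_def
  using borel_measurable_discrete[of X "\<lambda>b. prob {\<omega>' \<in> space M. X \<omega>' = b}"] by simp

lemma cell_prob_nonneg: "0 \<le> cell_prob X \<omega>"
  by (simp add: cell_prob_def)

lemma cell_prob_cong:
  "(\<And>\<omega>'. \<omega>' \<in> space M \<Longrightarrow> X \<omega>' = X \<omega> \<longleftrightarrow> Y \<omega>' = Y \<omega>) \<Longrightarrow> cell_prob X \<omega> = cell_prob Y \<omega>"
  unfolding cell_prob_def by (intro arg_cong[of _ _ prob]) auto

text \<open>Countably many cells of probability zero have a null union. This keeps the quotients in
  \<open>cond_ent\<close> away from division by zero.\<close>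

lemma AE_cell_prob_pos:
  assumes "discrete_rv X"
  shows "AE \<omega> in M. 0 < cell_prob X \<omega>"
proof -
  have "AE \<omega> in M. \<forall>b\<in>X ` space M. prob {\<omega>' \<in> space M. X \<omega>' = b} = 0 \<longrightarrow> X \<omega> \<noteq> b"
  proof (subst AE_ball_countable)
    show "countable (X ` space M)" using assms by (simp add: discrete_rv_def)
    show "\<forall>b\<in>X ` space M. AE \<omega> in M. prob {\<omega>' \<in> space M. X \<omega>' = b} = 0 \<longrightarrow> X \<omega> \<noteq> b"
    proof
      fix b assume "b \<in> X ` space M"
      show "AE \<omega> in M. prob {\<omega>' \<in> space M. X \<omega>' = b} = 0 \<longrightarrow> X \<omega> \<noteq> b"
      proof (cases "prob {\<omega>' \<in> space M. X \<omega>' = b} = 0")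
        case True
        then have "{\<omega>' \<in> space M. X \<omega>' = b} \<in> null_sets M"
          using cell_sets[OF assms] by (auto simp: null_sets_def emeasure_eq_measure)
        then show ?thesis by (rule AE_I') auto
      qed auto
    qed
  qed
  then show ?thesis
    using AE_space
  proof eventually_elim
    case (elim \<omega>)
    then have "cell_prob X \<omega> \<noteq> 0" unfolding cell_prob_def by blast
    with cell_prob_nonneg[of X \<omega>] show ?case by linarith
  qed
qed

lemma cell_prob_Pair_le:
  assumes "discrete_rv Y" "discrete_rv X"
  shows "cell_prob (\<lambda>\<omega>. (X \<omega>, Y \<omega>)) \<omega> \<le> cell_prob Y \<omega>"
  unfolding cell_prob_def by (rule finite_measure_mono) (use cell_sets[OF assms(1)] in auto)

text \<open>The cells of \<open>Y\<close> and of the pair differ by a null set.\<close>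

lemma AE_cell_prob_determines:
  assumes "discrete_rv X" "discrete_rv Y" "determines Y X"
  shows "AE \<omega> in M. cell_prob (\<lambda>\<omega>. (X \<omega>, Y \<omega>)) \<omega> = cell_prob Y \<omega>"
proof -
  obtain P where P: "AE \<omega> in M. P \<omega>"
    "\<And>\<omega> \<omega>'. \<omega> \<in> space M \<Longrightarrow> \<omega>' \<in> space M \<Longrightarrow> P \<omega> \<Longrightarrow> P \<omega>' \<Longrightarrow> Y \<omega> = Y \<omega>' \<Longrightarrow> X \<omega> = X \<omega>'"
    using assms(3) unfolding determines_def by blast
  show ?thesis
    using P(1) AE_space
  proof eventually_elim
    case (elim \<omega>)
    show ?case
      unfolding cell_prob_def
    proof (rule measure_eq_AE)
      show "AE x in M. (x \<in> {\<omega>' \<in> space M. (X \<omega>', Y \<omega>') = (X \<omega>, Y \<omega>)}) =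
          (x \<in> {\<omega>' \<in> space M. Y \<omega>' = Y \<omega>})"
        using P(1)
      proof eventually_elim
        case (elim x)
        then show ?case using P(2)[of x \<omega>] \<open>P \<omega>\<close> \<open>\<omega> \<in> space M\<close> by auto
      qed
    qed (use cell_sets[OF discrete_rv_Pair[OF assms(1,2)]] cell_sets[OF assms(2)] in auto)
  qed
qed

text \<open>Lets facts on \<open>ent\<close> be read off from facts on \<open>cond_ent\<close> with
  a trivial condition.\<close>

lemma ent_eq_cond_ent: "ent X = cond_ent X (\<lambda>_. ())"
proof -
  have "cell_prob (\<lambda>\<omega>. (X \<omega>, ())) \<omega> = cell_prob X \<omega>" for \<omega>
    by (rule cell_prob_cong) auto
  moreover have "cell_prob (\<lambda>_. ()) \<omega> = 1" for \<omega>
    by (simp add: cell_prob_def prob_space)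
  ultimately show ?thesis
    unfolding ent_def cond_ent_def
    by (intro nn_integral_cong) (simp add: ln_div ln_inverse inverse_eq_divide[symmetric])
qed

section \<open>Chain rule and monotonicity\<close>

lemma cond_ent_measurable:
  "discrete_rv X \<Longrightarrow> discrete_rv Y \<Longrightarrow>
    (\<lambda>\<omega>. ennreal (ln (cell_prob Y \<omega> / cell_prob (\<lambda>\<omega>. (X \<omega>, Y \<omega>)) \<omega>))) \<in> borel_measurable M"
  using cell_prob_measurable[of Y] cell_prob_measurable[OF discrete_rv_Pair, of X Y] by measurable

text \<open>Pointwise the two informations add, as logarithms of quotients whose product telescopes.
  Both are nonnegative almost everywhere, so the identity survives the passage to
  \<open>ennreal\<close>.\<close>

lemma chain_rule:
  assumes X: "discrete_rv X" and Y: "discrete_rv Y" and Z: "discrete_rv Z"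
  shows "cond_ent (\<lambda>\<omega>. (X \<omega>, Y \<omega>)) Z = cond_ent Y Z + cond_ent X (\<lambda>\<omega>. (Y \<omega>, Z \<omega>))"
proof -
  note YZ = discrete_rv_Pair[OF Y Z] and XYZ = discrete_rv_Pair[OF X discrete_rv_Pair[OF Y Z]]
  have eq: "cell_prob (\<lambda>\<omega>. ((X \<omega>, Y \<omega>), Z \<omega>)) \<omega> = cell_prob (\<lambda>\<omega>. (X \<omega>, (Y \<omega>, Z \<omega>))) \<omega>" for \<omega>
    by (rule cell_prob_cong) auto
  show ?thesis
    unfolding cond_ent_def eq
  proof (subst nn_integral_add[symmetric])
    show "(\<integral>\<^sup>+ \<omega>. ennreal (ln (cell_prob Z \<omega> / cell_prob (\<lambda>\<omega>. (X \<omega>, Y \<omega>, Z \<omega>)) \<omega>)) \<partial>M) =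
      (\<integral>\<^sup>+ \<omega>. ennreal (ln (cell_prob Z \<omega> / cell_prob (\<lambda>\<omega>. (Y \<omega>, Z \<omega>)) \<omega>)) +
          ennreal (ln (cell_prob (\<lambda>\<omega>. (Y \<omega>, Z \<omega>)) \<omega> / cell_prob (\<lambda>\<omega>. (X \<omega>, Y \<omega>, Z \<omega>)) \<omega>)) \<partial>M)"
    proof (rule nn_integral_cong_AE, use AE_cell_prob_pos[OF XYZ] in eventually_elim)
      case (elim \<omega>)
      have le: "cell_prob (\<lambda>\<omega>. (X \<omega>, Y \<omega>, Z \<omega>)) \<omega> \<le> cell_prob (\<lambda>\<omega>. (Y \<omega>, Z \<omega>)) \<omega>"
        "cell_prob (\<lambda>\<omega>. (Y \<omega>, Z \<omega>)) \<omega> \<le> cell_prob Z \<omega>"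
        by (intro cell_prob_Pair_le YZ X Y Z)+
      have pos: "0 < cell_prob (\<lambda>\<omega>. (Y \<omega>, Z \<omega>)) \<omega>" "0 < cell_prob Z \<omega>" using elim le by linarith+
      with elim le have "0 \<le> ln (cell_prob Z \<omega> / cell_prob (\<lambda>\<omega>. (Y \<omega>, Z \<omega>)) \<omega>)"
        "0 \<le> ln (cell_prob (\<lambda>\<omega>. (Y \<omega>, Z \<omega>)) \<omega> / cell_prob (\<lambda>\<omega>. (X \<omega>, Y \<omega>, Z \<omega>)) \<omega>)"
        by (simp_all add: ln_ge_zero)
      with elim pos show ?case
        by (simp add: ln_div ennreal_plus[symmetric] del: ennreal_plus)
    qed
  qed (use cond_ent_measurable[OF Y Z] cond_ent_measurable[OF X YZ] in auto)
qed

text \<open>The law of \<open>T\<close> gives full mass to its atoms and is therefore a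
  \<open>pmf\<close>; this turns integrals into sums even when the type of values is
  uncountable.\<close>

lemma nn_integral_discrete:
  assumes T: "discrete_rv T"
  shows "(\<integral>\<^sup>+ \<omega>. f (T \<omega>) \<partial>M) = (\<integral>\<^sup>+ t. f t * prob {\<omega> \<in> space M. T \<omega> = t} \<partial>count_space UNIV)"
proof -
  let ?D = "distr M (count_space UNIV) T"
  have T': "T \<in> M \<rightarrow>\<^sub>M count_space UNIV" by (rule discrete_rv_measurable[OF T])
  have m: "measure ?D {t} = prob {\<omega> \<in> space M. T \<omega> = t}" for t
    by (simp add: measure_distr[OF T'] vimage_def Int_def conj_commute)
  have "AE t in ?D. measure ?D {t} \<noteq> 0"
    unfolding m by (subst AE_distr_iff[OF T'])
      (use AE_cell_prob_pos[OF T] in \<open>auto simp: cell_prob_def elim!: eventually_mono\<close>)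
  then have "?D \<in> {M. prob_space M \<and> sets M = UNIV \<and> (AE x in M. measure M {x} \<noteq> 0)}"
    using prob_space_distr[OF T'] by auto
  then have p: "measure_pmf (Abs_pmf ?D) = ?D"
    by (rule Abs_pmf_inverse)
  have "(\<integral>\<^sup>+ \<omega>. f (T \<omega>) \<partial>M) = (\<integral>\<^sup>+ t. f t \<partial>?D)"
    by (subst nn_integral_distr[OF T']) auto
  also have "\<dots> = (\<integral>\<^sup>+ t. ennreal (pmf (Abs_pmf ?D) t) * f t \<partial>count_space UNIV)"
    by (subst nn_integral_measure_pmf[symmetric]) (simp add: p)
  also have "\<dots> = (\<integral>\<^sup>+ t. f t * prob {\<omega> \<in> space M. T \<omega> = t} \<partial>count_space UNIV)"
    by (intro nn_integral_cong) (simp add: pmf.rep_eq p m mult.commute)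
  finally show ?thesis .
qed

lemma nn_integral_cell_sum:
  assumes X: "discrete_rv X" and Z: "discrete_rv Z"
  shows "(\<integral>\<^sup>+ x. ennreal (prob {\<omega> \<in> space M. X \<omega> = x \<and> Z \<omega> = z}) \<partial>count_space UNIV) =
    prob {\<omega> \<in> space M. Z \<omega> = z}"
proof -
  let ?Z = "{\<omega> \<in> space M. Z \<omega> = z}"
  have Zs: "?Z \<in> sets M" by (rule cell_sets[OF Z])
  have "(\<integral>\<^sup>+ x. ennreal (prob {\<omega> \<in> space M. X \<omega> = x \<and> Z \<omega> = z}) \<partial>count_space UNIV) =
     (\<integral>\<^sup>+ x. (\<integral>\<^sup>+ y. ennreal (prob {\<omega> \<in> space M. X \<omega> = x \<and> Z \<omega> = y}) * indicator {z} y \<partial>count_space UNIV) \<partial>count_space UNIV)"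
    by (simp add: nn_integral_indicator_singleton)
  also have "\<dots> = (\<integral>\<^sup>+ t. indicator {z} (snd t) * ennreal (prob {\<omega> \<in> space M. (X \<omega>, Z \<omega>) = t}) \<partial>count_space UNIV)"
    by (subst nn_integral_fst_count_space[symmetric]) (simp add: mult.commute)
  also have "\<dots> = (\<integral>\<^sup>+ \<omega>. indicator {z} (Z \<omega>) \<partial>M)"
    by (subst nn_integral_discrete[OF discrete_rv_Pair[OF X Z], of "\<lambda>t. indicator {z} (snd t)", symmetric]) simp
  also have "\<dots> = (\<integral>\<^sup>+ \<omega>. indicator ?Z \<omega> \<partial>M)"
    by (intro nn_integral_cong) (auto simp: indicator_def)
  also have "\<dots> = prob ?Z"
    using Zs by (simp add: emeasure_eq_measure)
  finally show ?thesis .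
qed

text \<open>The integrand compares the law that makes \<open>X\<close> and \<open>Y\<close>
  conditionally independent given \<open>Z\<close> with the joint law. There is no equality in
  general, because the former may charge triples to which the joint law gives no mass.\<close>

lemma likelihood_ratio_le_1:
  fixes X :: "'a \<Rightarrow> 'b" and Y :: "'a \<Rightarrow> 'c" and Z :: "'a \<Rightarrow> 'd"
  assumes X: "discrete_rv X" and Y: "discrete_rv Y" and Z: "discrete_rv Z"
  shows "(\<integral>\<^sup>+ \<omega>. ennreal (cell_prob (\<lambda>\<omega>. (X \<omega>, Z \<omega>)) \<omega> * cell_prob (\<lambda>\<omega>. (Y \<omega>, Z \<omega>)) \<omega> /
     (cell_prob Z \<omega> * cell_prob (\<lambda>\<omega>. (X \<omega>, Y \<omega>, Z \<omega>)) \<omega>)) \<partial>M) \<le> 1"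
proof -
  note XYZ = discrete_rv_Pair[OF X discrete_rv_Pair[OF Y Z]]
  define pxz where "pxz x z = prob {\<omega> \<in> space M. X \<omega> = x \<and> Z \<omega> = z}" for x z
  define pyz where "pyz y z = prob {\<omega> \<in> space M. Y \<omega> = y \<and> Z \<omega> = z}" for y z
  define pz where "pz z = prob {\<omega> \<in> space M. Z \<omega> = z}" for z
  define p where "p t = prob {\<omega> \<in> space M. (X \<omega>, Y \<omega>, Z \<omega>) = t}" for t
  have nn: "0 \<le> pxz x z" "0 \<le> pyz y z" "0 \<le> pz z" "0 \<le> p t" for x y z t
    by (simp_all add: pxz_def pyz_def pz_def p_def)
  have "(\<integral>\<^sup>+ \<omega>. ennreal (cell_prob (\<lambda>\<omega>. (X \<omega>, Z \<omega>)) \<omega> * cell_prob (\<lambda>\<omega>. (Y \<omega>, Z \<omega>)) \<omega> /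
     (cell_prob Z \<omega> * cell_prob (\<lambda>\<omega>. (X \<omega>, Y \<omega>, Z \<omega>)) \<omega>)) \<partial>M) =
     (\<integral>\<^sup>+ \<omega>. (\<lambda>(x, y, z). ennreal (pxz x z * pyz y z / (pz z * p (x, y, z)))) (X \<omega>, Y \<omega>, Z \<omega>) \<partial>M)"
    by (simp add: cell_prob_def pxz_def pyz_def pz_def p_def)
  also have "\<dots> = (\<integral>\<^sup>+ t. (\<lambda>(x, y, z). ennreal (pxz x z * pyz y z / (pz z * p (x, y, z)))) t * p t \<partial>count_space UNIV)"
    by (subst nn_integral_discrete[OF XYZ]) (simp add: p_def)
  also have "\<dots> \<le> (\<integral>\<^sup>+ t. (\<lambda>(x, y, z). ennreal (pxz x z) * ennreal (pyz y z / pz z)) t \<partial>count_space UNIV)"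
  proof (rule nn_integral_mono)
    fix t :: "'b \<times> 'c \<times> 'd"
    obtain x y z where t: "t = (x, y, z)" by (cases t)
    have "pxz x z * pyz y z / (pz z * p t) * p t \<le> pxz x z * (pyz y z / pz z)"
      using nn by (cases "p t = 0") (auto simp: field_simps)
    then have "ennreal (pxz x z * pyz y z / (pz z * p t) * p t) \<le> ennreal (pxz x z * (pyz y z / pz z))"
      by (rule ennreal_leI)
    then show "(\<lambda>(x, y, z). ennreal (pxz x z * pyz y z / (pz z * p (x, y, z)))) t * p t \<le>
      (\<lambda>(x, y, z). ennreal (pxz x z) * ennreal (pyz y z / pz z)) t"
      using nn by (simp add: t ennreal_mult[symmetric])
  qed
  also have "\<dots> = (\<integral>\<^sup>+ x. \<integral>\<^sup>+ t. ennreal (pxz x (snd t)) * ennreal (pyz (fst t) (snd t) / pz (snd t)) \<partial>count_space UNIV \<partial>count_space UNIV)"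
    by (subst nn_integral_fst_count_space[symmetric]) (simp add: split_beta')
  also have "\<dots> = (\<integral>\<^sup>+ t. \<integral>\<^sup>+ x. ennreal (pxz x (snd t)) * ennreal (pyz (fst t) (snd t) / pz (snd t)) \<partial>count_space UNIV \<partial>count_space UNIV)"
    by (rule nn_integral_fst_count_space[of "\<lambda>(x,t). ennreal (pxz x (snd t)) * ennreal (pyz (fst t) (snd t) / pz (snd t))", simplified, THEN trans])
      (rule nn_integral_snd_count_space[of "\<lambda>(x,t). ennreal (pxz x (snd t)) * ennreal (pyz (fst t) (snd t) / pz (snd t))", simplified, symmetric])
  also have "\<dots> = (\<integral>\<^sup>+ t. ennreal (pz (snd t)) * ennreal (pyz (fst t) (snd t) / pz (snd t)) \<partial>count_space UNIV)"
    by (simp add: nn_integral_multc nn_integral_cell_sum[OF X Z] pxz_def pz_def)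
  also have "\<dots> \<le> (\<integral>\<^sup>+ t. ennreal (pyz (fst t) (snd t)) \<partial>count_space UNIV)"
  proof (rule nn_integral_mono)
    fix t
    have "pz (snd t) * (pyz (fst t) (snd t) / pz (snd t)) \<le> pyz (fst t) (snd t)"
      using nn by simp
    then show "ennreal (pz (snd t)) * ennreal (pyz (fst t) (snd t) / pz (snd t)) \<le> ennreal (pyz (fst t) (snd t))"
      using nn by (subst ennreal_mult[symmetric]) (auto intro!: ennreal_leI)
  qed
  also have "\<dots> = (\<integral>\<^sup>+ t. 1 * prob {\<omega> \<in> space M. (Y \<omega>, Z \<omega>) = t} \<partial>count_space UNIV)"
    by (intro nn_integral_cong) (auto simp: pyz_def intro!: arg_cong[of _ _ "\<lambda>A. ennreal (prob A)"])
  also have "\<dots> = (\<integral>\<^sup>+ \<omega>. 1 \<partial>M)"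
    by (subst nn_integral_discrete[OF discrete_rv_Pair[OF Y Z], of "\<lambda>_. 1"]) simp
  also have "\<dots> = 1" by (simp add: emeasure_space_1)
  finally show ?thesis .
qed

text \<open>The inequality ln u \<le> u - 1 is applied to the likelihood ratio u. Its constant 1 is
  moved to the other side because \<open>ennreal\<close> has no proper subtraction; being finite, it
  cancels at the end.\<close>

lemma cond_ent_Pair_le:
  assumes X: "discrete_rv X" and Y: "discrete_rv Y" and Z: "discrete_rv Z"
  shows "cond_ent X (\<lambda>\<omega>. (Y \<omega>, Z \<omega>)) \<le> cond_ent X Z"
proof -
  note XYZ = discrete_rv_Pair[OF X discrete_rv_Pair[OF Y Z]]
  note XZ = discrete_rv_Pair[OF X Z] and YZ = discrete_rv_Pair[OF Y Z]
  let ?r = "\<lambda>\<omega>. cell_prob (\<lambda>\<omega>. (X \<omega>, Z \<omega>)) \<omega> * cell_prob (\<lambda>\<omega>. (Y \<omega>, Z \<omega>)) \<omega> /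
     (cell_prob Z \<omega> * cell_prob (\<lambda>\<omega>. (X \<omega>, Y \<omega>, Z \<omega>)) \<omega>)"
  let ?a = "\<lambda>\<omega>. ln (cell_prob (\<lambda>\<omega>. (Y \<omega>, Z \<omega>)) \<omega> / cell_prob (\<lambda>\<omega>. (X \<omega>, Y \<omega>, Z \<omega>)) \<omega>)"
  let ?b = "\<lambda>\<omega>. ln (cell_prob Z \<omega> / cell_prob (\<lambda>\<omega>. (X \<omega>, Z \<omega>)) \<omega>)"
  have mr: "(\<lambda>\<omega>. ennreal (?r \<omega>)) \<in> borel_measurable M"
    using cell_prob_measurable[OF XYZ] cell_prob_measurable[OF XZ] cell_prob_measurable[OF YZ]
      cell_prob_measurable[OF Z] by measurable
  have "cond_ent X (\<lambda>\<omega>. (Y \<omega>, Z \<omega>)) + 1 = (\<integral>\<^sup>+ \<omega>. ennreal (?a \<omega>) + 1 \<partial>M)"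
    unfolding cond_ent_def
    by (subst nn_integral_add) (use cond_ent_measurable[OF X YZ] in \<open>auto simp: emeasure_space_1\<close>)
  also have "\<dots> \<le> (\<integral>\<^sup>+ \<omega>. ennreal (?b \<omega>) + ennreal (?r \<omega>) \<partial>M)"
  proof (rule nn_integral_mono_AE, use AE_cell_prob_pos[OF XYZ] in eventually_elim)
    case (elim \<omega>)
    define p pyz pxz pz where d: "p = cell_prob (\<lambda>\<omega>. (X \<omega>, Y \<omega>, Z \<omega>)) \<omega>"
      "pyz = cell_prob (\<lambda>\<omega>. (Y \<omega>, Z \<omega>)) \<omega>" "pxz = cell_prob (\<lambda>\<omega>. (X \<omega>, Z \<omega>)) \<omega>"
      "pz = cell_prob Z \<omega>"
    have le: "p \<le> pyz" "pxz \<le> pz" unfolding d by (intro cell_prob_Pair_le YZ X Y Z)+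
    have "p \<le> pxz"
      unfolding d cell_prob_def by (rule finite_measure_mono) (use cell_sets[OF XZ] in auto)
    moreover have "0 < p" using elim d by simp
    ultimately have pos: "0 < p" "0 < pyz" "0 < pxz" "0 < pz" using le by linarith+
    have "ln (pxz * pyz / (pz * p)) \<le> pxz * pyz / (pz * p) - 1"
      using pos by (intro ln_le_minus_one) simp
    then have "ln (pyz / p) + 1 \<le> ln (pz / pxz) + pxz * pyz / (pz * p)"
      using pos by (simp add: ln_div ln_mult)
    moreover have "0 \<le> ln (pyz / p)" "0 \<le> ln (pz / pxz)" using le pos by simp_all
    ultimately show ?case
      unfolding d[symmetric] using pos
      by (simp flip: ennreal_plus ennreal_1 add: ennreal_leI)
  qed
  also have "\<dots> = cond_ent X Z + (\<integral>\<^sup>+ \<omega>. ennreal (?r \<omega>) \<partial>M)"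
    unfolding cond_ent_def by (rule nn_integral_add[OF cond_ent_measurable[OF X Z] mr])
  also have "\<dots> \<le> cond_ent X Z + 1"
    by (intro add_left_mono likelihood_ratio_le_1 X Y Z)
  finally show ?thesis by simp
qed

lemma cond_ent_cong_AE:
  assumes "AE \<omega> in M. cell_prob Y \<omega> = cell_prob Y' \<omega>"
    "AE \<omega> in M. cell_prob (\<lambda>\<omega>. (X \<omega>, Y \<omega>)) \<omega> = cell_prob (\<lambda>\<omega>. (X' \<omega>, Y' \<omega>)) \<omega>"
  shows "cond_ent X Y = cond_ent X' Y'"
  unfolding cond_ent_def
  by (rule nn_integral_cong_AE, use assms in eventually_elim) simp

text \<open>Adjoining \<open>W\<close> to \<open>Y\<close> changes the cells by null sets only, and
  after that \<open>Y\<close> is dropped from the condition.\<close>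

lemma cond_ent_antimono:
  assumes X: "discrete_rv X" and Y: "discrete_rv Y" and W: "discrete_rv W" and d: "determines Y W"
  shows "cond_ent X Y \<le> cond_ent X W"
proof -
  have "cond_ent X Y = cond_ent X (\<lambda>\<omega>. (Y \<omega>, W \<omega>))"
  proof (rule cond_ent_cong_AE)
    have e: "cell_prob (\<lambda>\<omega>. (Y \<omega>, W \<omega>)) \<omega> = cell_prob (\<lambda>\<omega>. (W \<omega>, Y \<omega>)) \<omega>"
      "cell_prob (\<lambda>\<omega>. (X \<omega>, Y \<omega>, W \<omega>)) \<omega> = cell_prob (\<lambda>\<omega>. (W \<omega>, X \<omega>, Y \<omega>)) \<omega>" for \<omega>
      by (rule cell_prob_cong; auto)+
    show "AE \<omega> in M. cell_prob Y \<omega> = cell_prob (\<lambda>\<omega>. (Y \<omega>, W \<omega>)) \<omega>"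
      using AE_cell_prob_determines[OF W Y d] by (simp add: e eq_commute)
    have "determines (\<lambda>\<omega>. (X \<omega>, Y \<omega>)) W"
      by (rule determines_trans[OF _ d], rule determinesI) auto
    then show "AE \<omega> in M. cell_prob (\<lambda>\<omega>. (X \<omega>, Y \<omega>)) \<omega> = cell_prob (\<lambda>\<omega>. (X \<omega>, Y \<omega>, W \<omega>)) \<omega>"
      using AE_cell_prob_determines[OF W discrete_rv_Pair[OF X Y]] by (simp add: e eq_commute)
  qed
  also have "\<dots> \<le> cond_ent X W"
    by (rule cond_ent_Pair_le[OF X Y W])
  finally show ?thesis .
qed

lemma cond_ent_0:
  assumes X: "discrete_rv X" and Y: "discrete_rv Y" and d: "determines Y X"
  shows "cond_ent X Y = 0"
proof -
  have "cond_ent X Y = (\<integral>\<^sup>+ \<omega>. 0 \<partial>M)"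
    unfolding cond_ent_def
    by (rule nn_integral_cong_AE,
      use AE_cell_prob_determines[OF X Y d] AE_cell_prob_pos[OF Y] in eventually_elim) simp
  then show ?thesis by simp
qed

text \<open>Expand the entropy of the pair of \<open>X\<close> and \<open>X'\<close> in both orders;
  the term of \<open>X\<close> given \<open>X'\<close> and \<open>Z\<close> vanishes.\<close>

lemma cond_ent_mono:
  assumes X: "discrete_rv X" and X': "discrete_rv X'" and Z: "discrete_rv Z"
    and d: "determines (\<lambda>\<omega>. (X' \<omega>, Z \<omega>)) X"
  shows "cond_ent X Z \<le> cond_ent X' Z"
proof -
  have "cond_ent X Z \<le> cond_ent (\<lambda>\<omega>. (X' \<omega>, X \<omega>)) Z"
    unfolding chain_rule[OF X' X Z] by simp
  also have "\<dots> = cond_ent (\<lambda>\<omega>. (X \<omega>, X' \<omega>)) Z"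
    by (rule cond_ent_cong_AE, simp, rule AE_I2, rule cell_prob_cong) auto
  also have "\<dots> = cond_ent X' Z"
    unfolding chain_rule[OF X X' Z] using cond_ent_0[OF X discrete_rv_Pair[OF X' Z] d] by simp
  finally show ?thesis .
qed

lemma cond_ent_le_ent: "discrete_rv X \<Longrightarrow> discrete_rv Y \<Longrightarrow> cond_ent X Y \<le> ent X"
  unfolding ent_eq_cond_ent by (intro cond_ent_antimono discrete_rv_const determinesI) auto

lemma ent_mono: "discrete_rv X \<Longrightarrow> discrete_rv Y \<Longrightarrow> determines Y X \<Longrightarrow> ent X \<le> ent Y"
  unfolding ent_eq_cond_ent
  by (rule cond_ent_mono[OF _ _ discrete_rv_const])
    (assumption+, rule determines_trans[of _ Y], auto intro!: determinesI)

lemma ent_Pair_le: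
  assumes "discrete_rv X" "discrete_rv Y"
  shows "ent (\<lambda>\<omega>. (X \<omega>, Y \<omega>)) \<le> ent X + ent Y"
proof -
  have "ent (\<lambda>\<omega>. (X \<omega>, Y \<omega>)) = ent Y + cond_ent X (\<lambda>\<omega>. (Y \<omega>, ()))"
    unfolding ent_eq_cond_ent by (rule chain_rule[OF assms discrete_rv_const])
  also have "\<dots> \<le> ent Y + ent X"
    by (intro add_left_mono cond_ent_le_ent discrete_rv_Pair assms discrete_rv_const)
  finally show ?thesis by (simp add: add.commute)
qed

section \<open>Finite families and finite ranges\<close>

lemma discrete_rv_map:
  assumes "\<And>i. i \<in> set is \<Longrightarrow> discrete_rv (X i)"
  shows "discrete_rv (\<lambda>\<omega>. map (\<lambda>i. X i \<omega>) is)"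
  using assms
proof (induction "is")
  case Nil then show ?case by (simp add: discrete_rv_const)
next
  case (Cons i "is")
  then show ?case
    using discrete_rv_compose[OF discrete_rv_Pair[of "X i" "\<lambda>\<omega>. map (\<lambda>i. X i \<omega>) is"], of "\<lambda>(a, b). a # b"]
    by simp
qed

lemma ent_map_le:
  assumes "\<And>i. i \<in> set is \<Longrightarrow> discrete_rv (X i)"
  shows "ent (\<lambda>\<omega>. map (\<lambda>i. X i \<omega>) is) \<le> (\<Sum>i\<leftarrow>is. ent (X i))"
  using assms
proof (induction "is")
  case Nil
  have "ent (\<lambda>\<omega>. []) = 0" by (simp add: ent_def cell_prob_def prob_space)
  then show ?case by simp
next
  case (Cons i "is")
  have X: "discrete_rv (X i)" "discrete_rv (\<lambda>\<omega>. map (\<lambda>i. X i \<omega>) is)"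
    using Cons.prems by (auto intro!: discrete_rv_map)
  have "ent (\<lambda>\<omega>. map (\<lambda>i. X i \<omega>) (i # is)) \<le> ent (\<lambda>\<omega>. (X i \<omega>, map (\<lambda>i. X i \<omega>) is))"
    using Cons.prems by (intro ent_mono discrete_rv_map discrete_rv_Pair X determinesI) auto
  also have "\<dots> \<le> ent (X i) + ent (\<lambda>\<omega>. map (\<lambda>i. X i \<omega>) is)"
    by (rule ent_Pair_le[OF X])
  also have "\<dots> \<le> (\<Sum>i\<leftarrow>i # is. ent (X i))"
    using Cons by (auto intro!: add_left_mono)
  finally show ?case .
qed

lemma ent_discrete:
  assumes "discrete_rv X"
  shows "ent X = (\<integral>\<^sup>+ x. ennreal (- (prob {\<omega> \<in> space M. X \<omega> = x} * ln (prob {\<omega> \<in> space M. X \<omega> = x}))) \<partial>count_space UNIV)"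
proof -
  have "ent X = (\<integral>\<^sup>+ \<omega>. (\<lambda>x. ennreal (- ln (prob {\<omega> \<in> space M. X \<omega> = x}))) (X \<omega>) \<partial>M)"
    by (simp add: ent_def cell_prob_def)
  also have "\<dots> = (\<integral>\<^sup>+ x. ennreal (- ln (prob {\<omega> \<in> space M. X \<omega> = x})) * prob {\<omega> \<in> space M. X \<omega> = x} \<partial>count_space UNIV)"
    by (rule nn_integral_discrete[OF assms])
  also have "\<dots> = (\<integral>\<^sup>+ x. ennreal (- (prob {\<omega> \<in> space M. X \<omega> = x} * ln (prob {\<omega> \<in> space M. X \<omega> = x}))) \<partial>count_space UNIV)"
    by (intro nn_integral_cong)
      (subst ennreal_mult''[symmetric], simp, simp add: mult.commute)
  finally show ?thesis .
qed

lemma ent_le_ln_card: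
  assumes X: "discrete_rv X" and R: "finite R" "X ` space M \<subseteq> R"
  shows "ent X \<le> ennreal (ln (card R))"
proof -
  have ne: "R \<noteq> {}" using R not_empty by auto
  let ?p = "\<lambda>x. prob {\<omega> \<in> space M. X \<omega> = x}"
  have c: "0 < real (card R)" using ne R by (simp add: card_gt_0_iff)
  have s1: "(\<Sum>x\<in>R. ?p x) = 1"
  proof -
    have "(\<Sum>x\<in>R. ?p x) = prob (\<Union>x\<in>R. {\<omega> \<in> space M. X \<omega> = x})"
      by (rule finite_measure_finite_Union[symmetric])
        (use R cell_sets[OF X] in \<open>auto simp: disjoint_family_on_def\<close>)
    also have "(\<Union>x\<in>R. {\<omega> \<in> space M. X \<omega> = x}) = space M" using R by auto
    finally show ?thesis by (simp add: prob_space)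
  qed
  have z: "?p x = 0" if "x \<notin> R" for x
  proof -
    have e: "{\<omega> \<in> space M. X \<omega> = x} = {}" using that R by auto
    show ?thesis unfolding e by simp
  qed
  have "ent X = (\<integral>\<^sup>+ x. ennreal (- (?p x * ln (?p x))) \<partial>count_space R)"
    unfolding ent_discrete[OF X]
    by (rule nn_integral_count_space_eq) (use z in auto)
  also have "\<dots> = (\<Sum>x\<in>R. ennreal (- (?p x * ln (?p x))))"
    by (rule nn_integral_count_space_finite[OF R(1)])
  also have "\<dots> = ennreal (\<Sum>x\<in>R. - (?p x * ln (?p x)))"
  proof (rule sum_ennreal)
    fix x
    have "ln (?p x) \<le> 0 \<or> ?p x = 0" by (metis ln_le_zero_iff measure_nonneg order_le_less prob_le_1)
    then show "0 \<le> - (?p x * ln (?p x))" by (auto simp: mult_nonneg_nonpos)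
  qed
  \<comment> \<open>This is ln u \<le> u - 1 at u = 1 / (|R| p), a comparison with the uniform law;
    the corrections 1/|R| - p sum to zero.\<close>
  also have "(\<Sum>x\<in>R. - (?p x * ln (?p x))) \<le> (\<Sum>x\<in>R. ?p x * ln (card R) + (1 / card R - ?p x))"
  proof (rule sum_mono)
    fix x
    show "- (?p x * ln (?p x)) \<le> ?p x * ln (card R) + (1 / card R - ?p x)"
    proof (cases "?p x = 0")
      case False
      then have p: "0 < ?p x" by (simp add: measure_nonneg order_less_le)
      have "ln (1 / (card R * ?p x)) \<le> 1 / (card R * ?p x) - 1"
        using p c by (intro ln_le_minus_one) simp
      then have "?p x * ln (1 / (card R * ?p x)) \<le> ?p x * (1 / (card R * ?p x) - 1)"
        using p by (intro mult_left_mono) auto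
      moreover have "?p x * (1 / (card R * ?p x) - 1) = 1 / card R - ?p x"
        using p c by (simp add: field_simps)
      moreover have "?p x * ln (1 / (card R * ?p x)) = - (?p x * ln (card R)) - ?p x * ln (?p x)"
        using p c by (simp add: ln_div ln_mult algebra_simps)
      ultimately show ?thesis by linarith
    qed auto
  qed
  also have "\<dots> = ln (card R)"
    using c by (simp add: sum.distrib sum_subtractf s1 sum_distrib_right[symmetric])
  finally show ?thesis by (simp add: ennreal_leI)
qed

section \<open>Entropy carried by small events, and approximation of events\<close>

lemma inverse_cell_prob_integral:
  fixes X :: "'a \<Rightarrow> 'b" and B :: "'a \<Rightarrow> bool"
  assumes X: "discrete_rv X" and B: "discrete_rv B"
  shows "(\<integral>\<^sup>+ \<omega>. ennreal (cell_prob X \<omega> / cell_prob (\<lambda>\<omega>. (X \<omega>, B \<omega>)) \<omega>) \<partial>M) \<le> 2"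
proof -
  define p where "p x = prob {\<omega> \<in> space M. X \<omega> = x}" for x
  define q where "q t = prob {\<omega> \<in> space M. (X \<omega>, B \<omega>) = t}" for t
  have nn: "0 \<le> p x" "0 \<le> q t" for x t by (simp_all add: p_def q_def)
  have "(\<integral>\<^sup>+ \<omega>. ennreal (cell_prob X \<omega> / cell_prob (\<lambda>\<omega>. (X \<omega>, B \<omega>)) \<omega>) \<partial>M) =
    (\<integral>\<^sup>+ \<omega>. (\<lambda>t. ennreal (p (fst t) / q t)) (X \<omega>, B \<omega>) \<partial>M)"
    by (simp add: p_def q_def cell_prob_def)
  also have "\<dots> = (\<integral>\<^sup>+ t. ennreal (p (fst t) / q t) * q t \<partial>count_space UNIV)"
    by (subst nn_integral_discrete[OF discrete_rv_Pair[OF X B]]) (simp add: q_def)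
  \<comment> \<open>Each pair (x, b) of positive probability contributes P(X = x), so the total is
    at most the number of values of \<open>B\<close>.\<close>
  also have "\<dots> \<le> (\<integral>\<^sup>+ t. ennreal (p (fst t)) \<partial>count_space (UNIV :: ('b \<times> bool) set))"
  proof (rule nn_integral_mono)
    fix t :: "'b \<times> bool"
    have "p (fst t) / q t * q t \<le> p (fst t)" using nn by simp
    then show "ennreal (p (fst t) / q t) * q t \<le> p (fst t)"
      using nn by (subst ennreal_mult[symmetric]) (auto intro!: ennreal_leI)
  qed
  also have "\<dots> = (\<integral>\<^sup>+ x. \<integral>\<^sup>+ (b::bool). ennreal (p x) \<partial>count_space UNIV \<partial>count_space UNIV)"
    by (subst nn_integral_fst_count_space[symmetric]) simp
  also have "\<dots> = (\<integral>\<^sup>+ x. ennreal (p x) * 2 \<partial>count_space UNIV)"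
    by (intro nn_integral_cong) (simp add: UNIV_bool nn_integral_count_space_finite mult_2_right)
  also have "\<dots> = (\<integral>\<^sup>+ x. 2 * prob {\<omega> \<in> space M. X \<omega> = x} \<partial>count_space UNIV)"
    by (simp add: p_def mult.commute ennreal_mult)
  also have "\<dots> = (\<integral>\<^sup>+ x. 2 * ennreal (prob {\<omega> \<in> space M. X \<omega> = x}) \<partial>count_space UNIV)"
    by (simp add: ennreal_mult)
  also have "\<dots> = (\<integral>\<^sup>+ \<omega>. 2 \<partial>M)"
    by (rule nn_integral_discrete[OF X, of "\<lambda>_. 2", symmetric])
  also have "\<dots> = 2" by (simp add: emeasure_space_1)
  finally show ?thesis .
qed

text \<open>The information of \<open>X\<close> is integrable, so the part above a high level has
  small integral, by dominated convergence.\<close>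

lemma entropy_tail:
  assumes X: "discrete_rv X" and fin: "ent X < \<infinity>" and \<epsilon>: "0 < \<epsilon>"
  shows "\<exists>C\<ge>0::real. (\<integral>\<^sup>+ \<omega>. ennreal (- ln (cell_prob X \<omega>) - C) \<partial>M) \<le> ennreal \<epsilon>"
proof -
  let ?u = "\<lambda>n \<omega>. ennreal (- ln (cell_prob X \<omega>) - real n)"
  have m[measurable]: "cell_prob X \<in> borel_measurable M" by (rule cell_prob_measurable[OF X])
  have "(\<lambda>n. \<integral>\<^sup>+ \<omega>. ?u n \<omega> \<partial>M) \<longlonglongrightarrow> (\<integral>\<^sup>+ \<omega>. 0 \<partial>M)"
  proof (rule nn_integral_dominated_convergence[where w = "\<lambda>\<omega>. ennreal (- ln (cell_prob X \<omega>))"])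
    show "(\<integral>\<^sup>+ \<omega>. ennreal (- ln (cell_prob X \<omega>)) \<partial>M) < \<infinity>" using fin by (simp add: ent_def)
    show "AE \<omega> in M. (\<lambda>n. ?u n \<omega>) \<longlonglongrightarrow> 0"
    proof (rule AE_I2)
      fix \<omega>
      obtain N :: nat where N: "- ln (cell_prob X \<omega>) \<le> N" using real_arch_simple by blast
      have "eventually (\<lambda>n. ?u n \<omega> = 0) sequentially"
        using eventually_ge_at_top[of N] by eventually_elim (use N in \<open>simp add: ennreal_neg\<close>)
      then show "(\<lambda>n. ?u n \<omega>) \<longlonglongrightarrow> 0" by (rule tendsto_eventually)
    qed
  qed (auto intro!: ennreal_leI)
  then have "(\<lambda>n. \<integral>\<^sup>+ \<omega>. ?u n \<omega> \<partial>M) \<longlonglongrightarrow> 0" by simp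
  then have "eventually (\<lambda>n. (\<integral>\<^sup>+ \<omega>. ?u n \<omega> \<partial>M) < ennreal \<epsilon>) sequentially"
    by (rule order_tendstoD) (use \<epsilon> in simp)
  then obtain n where "(\<integral>\<^sup>+ \<omega>. ?u n \<omega> \<partial>M) < ennreal \<epsilon>" by (auto simp: eventually_sequentially)
  then show ?thesis by (intro exI[of _ "real n"]) auto
qed

lemma discrete_rv_event: "E \<in> sets M \<Longrightarrow> discrete_rv (\<lambda>\<omega>. \<omega> \<in> E)"
  by (rule discrete_rvI) auto

lemma discrete_rv_restrict:
  assumes "discrete_rv X" "E \<in> sets M"
  shows "discrete_rv (\<lambda>\<omega>. if \<omega> \<in> E then Some (X \<omega>) else None)"
  using discrete_rv_compose[OF discrete_rv_Pair[OF assms(1) discrete_rv_event[OF assms(2)]],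
    of "\<lambda>(x, b). if b then Some x else None"] by simp

text \<open>The bound on \<open>prob E\<close> depends on the law of \<open>X\<close> only, which makes it uniform over
  stationary families.\<close>

lemma ent_restrict_small:
  fixes X0 :: "'a \<Rightarrow> 'b"
  assumes X0: "discrete_rv X0" and fin: "ent X0 < \<infinity>" and \<epsilon>: "0 < \<epsilon>"
  obtains \<delta> where "0 < \<delta>"
    "\<And>X E. discrete_rv X \<Longrightarrow>
      (\<And>x. prob {\<omega> \<in> space M. X \<omega> = x} = prob {\<omega> \<in> space M. X0 \<omega> = x}) \<Longrightarrow>
      E \<in> sets M \<Longrightarrow> prob E \<le> \<delta> \<Longrightarrow>
      ent (\<lambda>\<omega>. if \<omega> \<in> E then Some (X \<omega>) else None) \<le> ennreal \<epsilon>"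
proof -
  obtain C :: real where C: "0 \<le> C" "(\<integral>\<^sup>+ \<omega>. ennreal (- ln (cell_prob X0 \<omega>) - C) \<partial>M) \<le> ennreal (\<epsilon> / 4)"
    using entropy_tail[OF X0 fin, of "\<epsilon> / 4"] \<epsilon> by auto
  \<comment> \<open>Shares of \<epsilon>: a quarter for the tail of the information above C, a
    quarter for 2 s, and half for D \<delta>.\<close>
  define s where "s = min 1 (\<epsilon> / 8)"
  have s: "0 < s" "s \<le> 1" "s \<le> \<epsilon> / 8" using \<epsilon> by (auto simp: s_def)
  \<comment> \<open>The 1 pays for the constant value off \<open>E\<close>, whose cell contributes
    at most P(E); C - ln s is the bounded part of the information on \<open>E\<close>.\<close>
  define D where "D = 1 + C - ln s"
  have ls: "ln s \<le> 0" using s by simp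
  then have lsC: "ln s \<le> C" and D: "1 \<le> D" using C(1) unfolding D_def by linarith+
  define \<delta> where "\<delta> = \<epsilon> / (2 * D)"
  have \<delta>: "0 < \<delta>" "D * \<delta> = \<epsilon> / 2" using \<epsilon> D by (simp_all add: \<delta>_def)
  show ?thesis
  proof (rule that[OF \<delta>(1)])
    fix X E
    assume X: "discrete_rv X"
      and law: "\<And>x. prob {\<omega> \<in> space M. X \<omega> = x} = prob {\<omega> \<in> space M. X0 \<omega> = x}"
      and E: "E \<in> sets M" "prob E \<le> \<delta>"
    let ?B = "\<lambda>\<omega>. \<omega> \<in> E"
    let ?V = "\<lambda>\<omega>. if \<omega> \<in> E then Some (X \<omega>) else None"
    have V: "discrete_rv ?V" by (rule discrete_rv_restrict[OF X E(1)])
    have B: "discrete_rv ?B" by (rule discrete_rv_event[OF E(1)])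
    have m[measurable]: "cell_prob X \<in> borel_measurable M" by (rule cell_prob_measurable[OF X])
    have m'[measurable]: "cell_prob (\<lambda>\<omega>. (X \<omega>, ?B \<omega>)) \<in> borel_measurable M"
      by (rule cell_prob_measurable[OF discrete_rv_Pair[OF X B]])
    have sp: "E \<subseteq> space M" using E sets.sets_into_space by auto
    define t where "t = prob (space M - E)"
    have te: "t = 1 - prob E" using E by (simp add: t_def prob_compl)
    have "ent ?V \<le> (\<integral>\<^sup>+ \<omega>. (ennreal (- ln t) * indicator (space M - E) \<omega> +
        ennreal (C - ln s) * indicator E \<omega>) +
        (ennreal (- ln (cell_prob X \<omega>) - C) +
        ennreal s * ennreal (cell_prob X \<omega> / cell_prob (\<lambda>\<omega>. (X \<omega>, ?B \<omega>)) \<omega>)) \<partial>M)"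
      unfolding ent_def
    proof (rule nn_integral_mono_AE, use AE_cell_prob_pos[OF discrete_rv_Pair[OF X B]] AE_space in eventually_elim)
      case (elim \<omega>)
      show ?case
      proof (cases "\<omega> \<in> E")
        case False
        have "cell_prob ?V \<omega> = t"
          unfolding cell_prob_def t_def by (rule arg_cong[of _ _ prob]) (use False in auto)
        then show ?thesis using False elim by (simp add: add_increasing2)
      next
        case True
        define p q where pq: "p = cell_prob X \<omega>" "q = cell_prob (\<lambda>\<omega>. (X \<omega>, ?B \<omega>)) \<omega>"
        have Vq: "cell_prob ?V \<omega> = q"
          unfolding pq by (rule cell_prob_cong) (use True in auto)
        have q: "0 < q" using elim by (simp add: pq)
        have "q \<le> p"
          unfolding pq cell_prob_def by (rule finite_measure_mono) (use cell_sets[OF X] in auto)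
        with q have p: "0 < p" by linarith
        \<comment> \<open>On \<open>E\<close> the information is -ln p + ln (p/q). The quotient p/q
          has integral at most 2, which is not small; inserting the factor s makes it small at the
          price of the constant -ln s.\<close>
        have "ln (s * p / q) \<le> s * p / q - 1"
          using p q s by (intro ln_le_minus_one) simp
        then have "- ln q \<le> (C - ln s) + ((- ln p - C) + s * (p / q))"
          using p q s by (simp add: ln_div ln_mult)
        then have "- ln q \<le> (C - ln s) + (max 0 (- ln p - C) + s * (p / q))" by linarith
        then have "ennreal (- ln q) \<le> ennreal ((C - ln s) + (max 0 (- ln p - C) + s * (p / q)))"
          by (rule ennreal_leI)
        also have "\<dots> = ennreal (C - ln s) + (ennreal (max 0 (- ln p - C)) + ennreal (s * (p / q)))"
          using p q s lsC by (subst ennreal_plus; simp)+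
        also have "\<dots> = ennreal (C - ln s) + (ennreal (- ln p - C) + ennreal s * ennreal (p / q))"
        proof -
          have "ennreal (s * (p / q)) = ennreal s * ennreal (p / q)"
            using p q s by (intro ennreal_mult) auto
          moreover have "ennreal (max 0 (- ln p - C)) = ennreal (- ln p - C)"
            by (simp add: max_def ennreal_neg)
          ultimately show ?thesis by (simp only:)
        qed
        finally show ?thesis using True elim
          unfolding Vq by (simp add: pq)
      qed
    qed
    also have "\<dots> = (ennreal (- ln t) * t + ennreal (C - ln s) * prob E) +
        ((\<integral>\<^sup>+ \<omega>. ennreal (- ln (cell_prob X \<omega>) - C) \<partial>M) +
         ennreal s * (\<integral>\<^sup>+ \<omega>. ennreal (cell_prob X \<omega> / cell_prob (\<lambda>\<omega>. (X \<omega>, ?B \<omega>)) \<omega>) \<partial>M))"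
      using E(1) by (simp add: nn_integral_add nn_integral_cmult nn_integral_cmult_indicator t_def emeasure_eq_measure)
    also have "\<dots> \<le> (ennreal \<delta> + ennreal (C - ln s) * ennreal \<delta>) + (ennreal (\<epsilon> / 4) + ennreal s * 2)"
    proof (intro add_mono mult_left_mono)
      show "ennreal (- ln t) * ennreal t \<le> ennreal \<delta>"
      proof (cases "t = 0")
        case False
        then have t: "0 < t" by (simp add: t_def measure_nonneg order_less_le)
        have "ln (1 / t) \<le> 1 / t - 1" using t by (intro ln_le_minus_one) simp
        then have "- ln t * t \<le> (1 / t - 1) * t" using t by (intro mult_right_mono) (simp_all add: ln_div)
        also have "\<dots> = 1 - t" using t by (simp add: left_diff_distrib)
        also have "\<dots> = prob E" by (simp add: te)
        finally have "- ln t * t \<le> \<delta>" using E by simp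
        moreover have "0 \<le> - ln t" using t by (simp add: te)
        ultimately show ?thesis using t by (simp add: ennreal_mult[symmetric] ennreal_leI)
      qed simp
      define h where "h x = ennreal (- ln (prob {\<omega> \<in> space M. X0 \<omega> = x}) - C)" for x
      have "(\<integral>\<^sup>+ \<omega>. h (X \<omega>) \<partial>M) = (\<integral>\<^sup>+ \<omega>. h (X0 \<omega>) \<partial>M)"
        unfolding nn_integral_discrete[OF X, of h] nn_integral_discrete[OF X0, of h] law ..
      then show "(\<integral>\<^sup>+ \<omega>. ennreal (- ln (cell_prob X \<omega>) - C) \<partial>M) \<le> ennreal (\<epsilon> / 4)"
        using C(2) by (simp add: h_def cell_prob_def law)
    qed (use E(2) inverse_cell_prob_integral[OF X B] in \<open>auto intro: ennreal_leI\<close>)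
    also have "\<dots> = ennreal (D * \<delta> + (\<epsilon> / 4 + s * 2))"
    proof -
      have "ennreal s * 2 = ennreal (s * 2)" using s by (simp add: ennreal_mult)
      moreover have "0 \<le> C - ln s" using lsC by simp
      ultimately show ?thesis
        using \<delta> \<epsilon> s by (simp add: D_def ennreal_mult[symmetric] ennreal_plus[symmetric] algebra_simps
          del: ennreal_plus)
    qed
    also have "\<dots> \<le> ennreal \<epsilon>"
      using \<delta> s by (intro ennreal_leI) simp
    finally show "ent ?V \<le> ennreal \<epsilon>" .
  qed
qed

text \<open>Given \<open>B\<close>, the event \<open>A\<close> is known from the indicator of the
  symmetric difference, a rare event. The preceding lemma with a constant variable bounds its
  entropy.\<close>

lemma cond_ent_close_events:
  assumes \<epsilon>: "0 < \<epsilon>"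
  obtains \<delta> where "0 < \<delta>"
    "\<And>A B. A \<in> sets M \<Longrightarrow> B \<in> sets M \<Longrightarrow> prob ((A - B) \<union> (B - A)) \<le> \<delta> \<Longrightarrow>
      cond_ent (\<lambda>\<omega>. \<omega> \<in> A) (\<lambda>\<omega>. \<omega> \<in> B) \<le> ennreal \<epsilon>"
proof -
  have c: "ent (\<lambda>_. ()) < \<infinity>" by (simp add: ent_def cell_prob_def prob_space)
  obtain \<delta> where \<delta>: "0 < \<delta>"
    "\<And>X E. discrete_rv X \<Longrightarrow> (\<And>x. prob {\<omega> \<in> space M. X \<omega> = x} = prob {\<omega> \<in> space M. () = x}) \<Longrightarrow>
      E \<in> sets M \<Longrightarrow> prob E \<le> \<delta> \<Longrightarrow> ent (\<lambda>\<omega>. if \<omega> \<in> E then Some (X \<omega>) else None) \<le> ennreal \<epsilon>"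
    using ent_restrict_small[OF discrete_rv_const[of "()"] c \<epsilon>] by blast
  show ?thesis
  proof (rule that[OF \<delta>(1)])
    fix A B assume A: "A \<in> sets M" and B: "B \<in> sets M" and p: "prob ((A - B) \<union> (B - A)) \<le> \<delta>"
    define E where "E = (A - B) \<union> (B - A)"
    let ?V = "\<lambda>\<omega>. if \<omega> \<in> E then Some () else None"
    have E: "E \<in> sets M" using A B by (auto simp: E_def)
    have V: "discrete_rv ?V" by (rule discrete_rv_restrict[OF discrete_rv_const E])
    have "cond_ent (\<lambda>\<omega>. \<omega> \<in> A) (\<lambda>\<omega>. \<omega> \<in> B) \<le> cond_ent ?V (\<lambda>\<omega>. \<omega> \<in> B)"
    proof (rule cond_ent_mono[OF discrete_rv_event[OF A] V discrete_rv_event[OF B] determinesI])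
      fix \<omega> \<omega>'
      assume eq: "(?V \<omega>, \<omega> \<in> B) = (?V \<omega>', \<omega>' \<in> B)"
      have "(\<omega> \<in> E) = (\<omega>' \<in> E)" using eq by (metis Pair_inject option.distinct(1))
      moreover have "(\<omega> \<in> B) = (\<omega>' \<in> B)" using eq by (metis Pair_inject)
      ultimately show "(\<omega> \<in> A) = (\<omega>' \<in> A)" unfolding E_def by blast
    qed
    also have "\<dots> \<le> ent ?V"
      by (rule cond_ent_le_ent[OF V discrete_rv_event[OF B]])
    also have "\<dots> \<le> ennreal \<epsilon>"
      using p by (intro \<delta>(2)[OF discrete_rv_const _ E]) (simp_all add: E_def)
    finally show "cond_ent (\<lambda>\<omega>. \<omega> \<in> A) (\<lambda>\<omega>. \<omega> \<in> B) \<le> ennreal \<epsilon>" .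
  qed
qed

text \<open>\<open>D\<close> is the majority vote on each cell of \<open>F\<close>. Where the vote
  errs, the conditional probability of what happened is at most 1/2, so the information is at least
  ln 2; Markov's inequality then bounds the probability of an error.\<close>

lemma event_approx_of_cond_ent:
  assumes A: "A \<in> sets M" and F: "discrete_rv F"
    and H: "cond_ent (\<lambda>\<omega>. \<omega> \<in> A) F \<le> ennreal (\<epsilon> * ln 2)" and \<epsilon>: "0 \<le> \<epsilon>"
  shows "\<exists>D. prob {\<omega> \<in> space M. \<omega> \<in> A \<longleftrightarrow> F \<omega> \<notin> D} \<le> \<epsilon>"
proof -
  let ?B = "\<lambda>\<omega>. \<omega> \<in> A"
  have B: "discrete_rv ?B" by (rule discrete_rv_event[OF A])
  have BF: "discrete_rv (\<lambda>\<omega>. (?B \<omega>, F \<omega>))" by (rule discrete_rv_Pair[OF B F])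
  define r where "r b f = prob {\<omega> \<in> space M. (?B \<omega>, F \<omega>) = (b, f)}" for b f
  define D where "D = {f. r False f \<le> r True f}"
  let ?E = "{\<omega> \<in> space M. \<omega> \<in> A \<longleftrightarrow> F \<omega> \<notin> D}"
  have E: "?E \<in> sets M"
  proof -
    have "?E = (\<lambda>\<omega>. (?B \<omega>, F \<omega>)) -` {(b, f). b \<longleftrightarrow> f \<notin> D} \<inter> space M" by auto
    then show ?thesis using measurable_sets[OF discrete_rv_measurable[OF BF], of "{(b, f). b \<longleftrightarrow> f \<notin> D}"] by simp
  qed
  have tot: "prob {\<omega>' \<in> space M. F \<omega>' = f} = r True f + r False f" for f
  proof -
    have "prob {\<omega>' \<in> space M. F \<omega>' = f} =
        prob ({\<omega> \<in> space M. (?B \<omega>, F \<omega>) = (True, f)} \<union> {\<omega> \<in> space M. (?B \<omega>, F \<omega>) = (False, f)})"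
      by (rule arg_cong[of _ _ prob]) auto
    also have "\<dots> = r True f + r False f"
      unfolding r_def by (rule finite_measure_Union) (use cell_sets[OF BF, of "(True, f)"] cell_sets[OF BF, of "(False, f)"] in auto)
    finally show ?thesis .
  qed
  have "ennreal (ln 2) * prob ?E = (\<integral>\<^sup>+ \<omega>. ennreal (ln 2) * indicator ?E \<omega> \<partial>M)"
    using E by (simp add: nn_integral_cmult_indicator emeasure_eq_measure)
  also have "\<dots> \<le> cond_ent ?B F"
    unfolding cond_ent_def
  proof (rule nn_integral_mono_AE, use AE_cell_prob_pos[OF BF] in eventually_elim)
    case (elim \<omega>)
    show ?case
    proof (cases "\<omega> \<in> ?E")
      case True
      have "2 * cell_prob (\<lambda>\<omega>. (?B \<omega>, F \<omega>)) \<omega> \<le> cell_prob F \<omega>"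
        using True unfolding cell_prob_def[of F] tot
        by (cases "\<omega> \<in> A") (auto simp: D_def cell_prob_def r_def)
      then have "2 \<le> cell_prob F \<omega> / cell_prob (\<lambda>\<omega>. (?B \<omega>, F \<omega>)) \<omega>"
        using elim by (simp add: field_simps)
      then have "ln 2 \<le> ln (cell_prob F \<omega> / cell_prob (\<lambda>\<omega>. (?B \<omega>, F \<omega>)) \<omega>)"
        by simp
      then show ?thesis using True by (simp add: ennreal_leI)
    qed simp
  qed
  also note H
  finally have "ennreal (ln 2 * prob ?E) \<le> ennreal (\<epsilon> * ln 2)"
    by (simp add: ennreal_mult)
  then have "prob ?E \<le> \<epsilon>" using \<epsilon> by (simp add: ennreal_le_iff mult.commute)
  then show ?thesis by blast
qed

end

section \<open>Shifts of independent sequences\<close>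

definition shift_by :: "nat \<Rightarrow> (nat \<Rightarrow> 'a) \<Rightarrow> nat \<Rightarrow> 'a" where
  "shift_by t \<omega> = (\<lambda>i. \<omega> (i + t))"

lemma shift_comb_seq [simp]: "shift_by t (comb_seq t \<omega> \<omega>') = \<omega>'"
  by (simp add: shift_by_def comb_seq_def)

context sequence_space
begin

definition depends_on_past :: "nat \<Rightarrow> ((nat \<Rightarrow> 'a) \<Rightarrow> 'b) \<Rightarrow> bool" where
  "depends_on_past t p \<longleftrightarrow> (\<forall>\<omega>\<in>space S. \<forall>\<omega>'\<in>space S. (\<forall>i<t. \<omega> i = \<omega>' i) \<longrightarrow> p \<omega> = p \<omega>')"

lemma depends_on_pastI:
  "(\<And>\<omega> \<omega>'. \<omega> \<in> space S \<Longrightarrow> \<omega>' \<in> space S \<Longrightarrow> (\<And>i. i < t \<Longrightarrow> \<omega> i = \<omega>' i) \<Longrightarrow> p \<omega> = p \<omega>') \<Longrightarrow>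
    depends_on_past t p"
  unfolding depends_on_past_def by blast

lemma comb_seq_space: "\<omega> \<in> space S \<Longrightarrow> \<omega>' \<in> space S \<Longrightarrow> comb_seq t \<omega> \<omega>' \<in> space S"
  by (auto simp: space_PiM PiE_iff comb_seq_def)

lemma shift_space: "\<omega> \<in> space S \<Longrightarrow> shift_by t \<omega> \<in> space S"
  by (auto simp: space_PiM PiE_iff shift_by_def)

lemma past_comb_seq:
  "depends_on_past t p \<Longrightarrow> \<omega> \<in> space S \<Longrightarrow> \<omega>' \<in> space S \<Longrightarrow> p (comb_seq t \<omega> \<omega>') = p \<omega>"
  using comb_seq_space[of \<omega> \<omega>' t] unfolding depends_on_past_def by (metis comb_seq_less)

lemma measurable_shift [measurable]: "shift_by t \<in> S \<rightarrow>\<^sub>M S"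
  unfolding shift_by_def by (rule measurable_PiM_single') (auto simp: space_PiM PiE_iff)

text \<open>Gluing the first t entries of one sample to an independent sample reproduces the law.
  This is the form in which independence and stationarity of the increments are used.\<close>

lemma nn_integral_split:
  assumes f: "f \<in> borel_measurable S"
  shows "(\<integral>\<^sup>+ \<omega>. f \<omega> \<partial>S) = (\<integral>\<^sup>+ \<omega>. \<integral>\<^sup>+ \<omega>'. f (comb_seq t \<omega> \<omega>') \<partial>S \<partial>S)"
proof -
  have "(\<integral>\<^sup>+ \<omega>. f \<omega> \<partial>S) = (\<integral>\<^sup>+ \<omega>. f \<omega> \<partial>distr (S \<Otimes>\<^sub>M S) S (\<lambda>(\<omega>, \<omega>'). comb_seq t \<omega> \<omega>'))"
    by (simp add: PiM_comb_seq)
  also have "\<dots> = (\<integral>\<^sup>+ x. f (case x of (\<omega>, \<omega>') \<Rightarrow> comb_seq t \<omega> \<omega>') \<partial>(S \<Otimes>\<^sub>M S))"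
    by (rule nn_integral_distr[OF measurable_comb_seq]) (use f in simp)
  also have "\<dots> = (\<integral>\<^sup>+ \<omega>. \<integral>\<^sup>+ \<omega>'. f (comb_seq t \<omega> \<omega>') \<partial>S \<partial>S)"
    by (subst P.nn_integral_fst[symmetric])
      (use measurable_compose[OF measurable_comb_seq f] in auto)
  finally show ?thesis .
qed

lemma distr_shift: "distr S S (shift_by t) = S"
proof (rule measure_eqI)
  fix A assume "A \<in> sets (distr S S (shift_by t))"
  then have A: "A \<in> sets S" by simp
  have "emeasure (distr S S (shift_by t)) A = (\<integral>\<^sup>+ \<omega>. indicator A (shift_by t \<omega>) \<partial>S)"
    using A by (subst nn_integral_indicator[symmetric], simp) (rule nn_integral_distr, auto)
  also have "\<dots> = (\<integral>\<^sup>+ \<omega>. \<integral>\<^sup>+ \<omega>'. indicator A \<omega>' \<partial>S \<partial>S)"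
    by (subst nn_integral_split[of _ t]) (use A in auto)
  also have "\<dots> = emeasure S A"
    using A by (simp add: P.emeasure_space_1)
  finally show "emeasure (distr S S (shift_by t)) A = emeasure S A" .
qed simp

lemma prob_shift:
  assumes "A \<in> sets S"
  shows "P.prob {\<omega> \<in> space S. shift_by t \<omega> \<in> A} = P.prob A"
proof -
  have "{\<omega> \<in> space S. shift_by t \<omega> \<in> A} = shift_by t -` A \<inter> space S" by auto
  then show ?thesis
    using measure_distr[OF measurable_shift assms, of t] by (simp add: distr_shift)
qed

lemma discrete_rv_shift:
  assumes "P.discrete_rv X"
  shows "P.discrete_rv (\<lambda>\<omega>. X (shift_by t \<omega>))"
proof (rule P.discrete_rvI)
  show "(\<lambda>\<omega>. X (shift_by t \<omega>)) \<in> S \<rightarrow>\<^sub>M count_space UNIV"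
    by (rule measurable_compose[OF measurable_shift P.discrete_rv_measurable[OF assms]])
  show "countable ((\<lambda>\<omega>. X (shift_by t \<omega>)) ` space S)"
    by (rule countable_subset[of _ "X ` space S"])
      (use assms shift_space in \<open>auto simp: P.discrete_rv_def\<close>)
qed

text \<open>\<open>Y\<close> may be chosen by the past: on a cell of \<open>p\<close> it is one
  fixed function of the future, so the joint cell is an intersection of independent events.\<close>

lemma cell_prob_past_future:
  assumes p: "P.discrete_rv p" "depends_on_past t p" and Y: "P.discrete_rv (Y (p \<omega>))"
  shows "P.cell_prob (\<lambda>\<omega>. (p \<omega>, Y (p \<omega>) (shift_by t \<omega>))) \<omega> =
    P.cell_prob p \<omega> * P.cell_prob (Y (p \<omega>)) (shift_by t \<omega>)"
proof -
  define A where "A = {\<omega>' \<in> space S. p \<omega>' = p \<omega>}"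
  define B where "B = {\<omega>' \<in> space S. Y (p \<omega>) \<omega>' = Y (p \<omega>) (shift_by t \<omega>)}"
  define C where "C = {\<omega>' \<in> space S. (p \<omega>', Y (p \<omega>') (shift_by t \<omega>')) = (p \<omega>, Y (p \<omega>) (shift_by t \<omega>))}"
  have A[measurable]: "A \<in> sets S" and B[measurable]: "B \<in> sets S"
    using P.cell_sets[OF p(1)] P.cell_sets[OF Y] by (simp_all add: A_def B_def)
  have C: "C = A \<inter> (shift_by t -` B \<inter> space S)"
    unfolding A_def B_def C_def using shift_space by auto
  have Cs[measurable]: "C \<in> sets S" unfolding C by simp
  have "ennreal (P.prob C) = (\<integral>\<^sup>+ \<omega>. indicator C \<omega> \<partial>S)"
    by (simp add: P.emeasure_eq_measure)
  also have "\<dots> = (\<integral>\<^sup>+ \<omega>. \<integral>\<^sup>+ \<omega>'. indicator C (comb_seq t \<omega> \<omega>') \<partial>S \<partial>S)"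
    by (rule nn_integral_split) simp
  also have "\<dots> = (\<integral>\<^sup>+ \<omega>. \<integral>\<^sup>+ \<omega>'. indicator A \<omega> * indicator B \<omega>' \<partial>S \<partial>S)"
  proof (intro nn_integral_cong)
    fix \<omega>1 \<omega>2 assume "\<omega>1 \<in> space S" "\<omega>2 \<in> space S"
    then show "indicator C (comb_seq t \<omega>1 \<omega>2) = (indicator A \<omega>1 * indicator B \<omega>2 :: ennreal)"
      unfolding C using past_comb_seq[OF p(2)] comb_seq_space
      by (auto simp: A_def indicator_def)
  qed
  also have "\<dots> = ennreal (P.prob A * P.prob B)"
    by (simp add: nn_integral_cmult nn_integral_multc P.emeasure_eq_measure ennreal_mult)
  finally have "P.prob C = P.prob A * P.prob B" by simp
  then show ?thesis by (simp add: A_def B_def C_def P.cell_prob_def)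
qed

lemma discrete_rv_past_future:
  assumes p: "P.discrete_rv p" and Y: "\<And>a. a \<in> p ` space S \<Longrightarrow> P.discrete_rv (Y a)"
  shows "P.discrete_rv (\<lambda>\<omega>. Y (p \<omega>) (shift_by t \<omega>))"
  unfolding P.discrete_rv_def
proof (intro conjI allI)
  have c: "countable (p ` space S)" using p by (simp add: P.discrete_rv_def)
  show "countable ((\<lambda>\<omega>. Y (p \<omega>) (shift_by t \<omega>)) ` space S)"
  proof (rule countable_subset)
    show "(\<lambda>\<omega>. Y (p \<omega>) (shift_by t \<omega>)) ` space S \<subseteq> (\<Union>a\<in>p ` space S. Y a ` space S)"
      using shift_space by blast
    show "countable (\<Union>a\<in>p ` space S. Y a ` space S)"
      by (rule countable_UN[OF c]) (use Y in \<open>simp add: P.discrete_rv_def\<close>)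
  qed
  fix b
  have "(\<lambda>\<omega>. Y (p \<omega>) (shift_by t \<omega>)) -` {b} \<inter> space S =
      (\<Union>a\<in>p ` space S. (p -` {a} \<inter> space S) \<inter> ((\<lambda>\<omega>. Y a (shift_by t \<omega>)) -` {b} \<inter> space S))"
    by auto
  also have "\<dots> \<in> sets S"
  proof (rule sets.countable_UN'[OF c], rule image_subsetI, rule sets.Int)
    fix a assume a: "a \<in> p ` space S"
    show "p -` {a} \<inter> space S \<in> sets S" using p by (simp add: P.discrete_rv_def)
    show "(\<lambda>\<omega>. Y a (shift_by t \<omega>)) -` {b} \<inter> space S \<in> sets S"
      using discrete_rv_shift[OF Y[OF a]] by (simp add: P.discrete_rv_def)
  qed
  finally show "(\<lambda>\<omega>. Y (p \<omega>) (shift_by t \<omega>)) -` {b} \<inter> space S \<in> sets S" .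
qed

text \<open>Once the value of \<open>p\<close> is known, the future is a fresh sample; the entropy
  is the average over that value.\<close>

lemma cond_ent_past_future:
  assumes p: "P.discrete_rv p" "depends_on_past t p" and X: "P.discrete_rv X"
    and Y: "\<And>a. a \<in> p ` space S \<Longrightarrow> P.discrete_rv (Y a)"
  shows "P.cond_ent (\<lambda>\<omega>. X (shift_by t \<omega>)) (\<lambda>\<omega>. (p \<omega>, Y (p \<omega>) (shift_by t \<omega>))) =
    (\<integral>\<^sup>+ \<omega>. P.cond_ent X (Y (p \<omega>)) \<partial>S)"
proof -
  let ?f = "\<lambda>\<omega>. ennreal (ln (P.cell_prob (\<lambda>\<omega>. (p \<omega>, Y (p \<omega>) (shift_by t \<omega>))) \<omega> /
      P.cell_prob (\<lambda>\<omega>. (X (shift_by t \<omega>), p \<omega>, Y (p \<omega>) (shift_by t \<omega>))) \<omega>))"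
  have XY: "P.discrete_rv (\<lambda>\<omega>. (X \<omega>, Y a \<omega>))" if "a \<in> p ` space S" for a
    by (rule P.discrete_rv_Pair[OF X Y[OF that]])
  have m: "?f \<in> borel_measurable S"
    by (rule P.cond_ent_measurable[OF discrete_rv_shift[OF X]
          P.discrete_rv_Pair[OF p(1) discrete_rv_past_future[OF p(1) Y]]])
  have "P.cond_ent (\<lambda>\<omega>. X (shift_by t \<omega>)) (\<lambda>\<omega>. (p \<omega>, Y (p \<omega>) (shift_by t \<omega>))) = (\<integral>\<^sup>+ \<omega>. ?f \<omega> \<partial>S)"
    by (simp add: P.cond_ent_def)
  also have "\<dots> = (\<integral>\<^sup>+ \<omega>. \<integral>\<^sup>+ \<omega>'. ?f (comb_seq t \<omega> \<omega>') \<partial>S \<partial>S)"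
    by (rule nn_integral_split[OF m])
  also have "\<dots> = (\<integral>\<^sup>+ \<omega>. P.cond_ent X (Y (p \<omega>)) \<partial>S)"
  proof (rule nn_integral_cong_AE, use P.AE_cell_prob_pos[OF p(1)] AE_space in eventually_elim)
    case (elim \<omega>)
    have pS: "p \<omega> \<in> p ` space S" using elim by auto
    show ?case
      unfolding P.cond_ent_def
    proof (rule nn_integral_cong)
      fix \<omega>' assume \<omega>': "\<omega>' \<in> space S"
      let ?c = "comb_seq t \<omega> \<omega>'"
      have pc: "p ?c = p \<omega>" by (rule past_comb_seq[OF p(2) elim(2) \<omega>'])
      have 1: "P.cell_prob (\<lambda>\<omega>. (p \<omega>, Y (p \<omega>) (shift_by t \<omega>))) ?c =
          P.cell_prob p \<omega> * P.cell_prob (Y (p \<omega>)) \<omega>'"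
        using cell_prob_past_future[OF p, of Y ?c] Y[OF pS] by (simp add: pc P.cell_prob_def)
      have "P.cell_prob (\<lambda>\<omega>. (X (shift_by t \<omega>), p \<omega>, Y (p \<omega>) (shift_by t \<omega>))) ?c =
          P.cell_prob (\<lambda>\<omega>. (p \<omega>, (X (shift_by t \<omega>), Y (p \<omega>) (shift_by t \<omega>)))) ?c"
        by (rule P.cell_prob_cong) auto
      also have "\<dots> = P.cell_prob p \<omega> * P.cell_prob (\<lambda>\<omega>'. (X \<omega>', Y (p \<omega>) \<omega>')) \<omega>'"
        using cell_prob_past_future[OF p, of "\<lambda>a \<omega>'. (X \<omega>', Y a \<omega>')" ?c] XY[OF pS]
        by (simp add: pc P.cell_prob_def)
      finally show "?f ?c = ennreal (ln (P.cell_prob (Y (p \<omega>)) \<omega>' /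
          P.cell_prob (\<lambda>\<omega>'. (X \<omega>', Y (p \<omega>) \<omega>')) \<omega>'))"
        using 1 elim by simp
    qed
  qed
  finally show ?thesis .
qed

text \<open>Given the function \<open>q\<close> of the past, the past is independent of the future, so what depends on
  the past through \<open>q\<close> only carries no further information.\<close>

lemma cond_ent_Markov:
  assumes X: "P.discrete_rv X" "depends_on_past t X" and q: "P.discrete_rv q" "depends_on_past t q"
    and Y: "\<And>a. a \<in> q ` space S \<Longrightarrow> P.discrete_rv (Y a)"
  shows "P.cond_ent X q \<le> P.cond_ent X (\<lambda>\<omega>. Y (q \<omega>) (shift_by t \<omega>))"
proof -
  let ?V = "\<lambda>\<omega>. Y (q \<omega>) (shift_by t \<omega>)"
  have V: "P.discrete_rv ?V" by (rule discrete_rv_past_future[OF q(1) Y])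
  have Xq: "P.discrete_rv (\<lambda>\<omega>. (X \<omega>, q \<omega>))" "depends_on_past t (\<lambda>\<omega>. (X \<omega>, q \<omega>))"
     apply (rule P.discrete_rv_Pair[OF X(1) q(1)])
    using X(2) q(2) unfolding depends_on_past_def by blast
  \<comment> \<open>Adjoining \<open>?V\<close> multiplies both cell probabilities by the same
    future factor, which cancels in the quotient. Dropping \<open>q\<close> afterwards can only
    increase the entropy.\<close>
  have "P.cond_ent X q = P.cond_ent X (\<lambda>\<omega>. (q \<omega>, ?V \<omega>))"
    unfolding P.cond_ent_def
  proof (rule nn_integral_cong_AE,
      use P.AE_cell_prob_pos[OF P.discrete_rv_Pair[OF q(1) V]] AE_space in eventually_elim)
    case (elim \<omega>)
    have Yq: "P.discrete_rv (Y (q \<omega>))" using Y elim by auto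
    have 1: "P.cell_prob (\<lambda>\<omega>. (q \<omega>, ?V \<omega>)) \<omega> = P.cell_prob q \<omega> * P.cell_prob (Y (q \<omega>)) (shift_by t \<omega>)"
      by (rule cell_prob_past_future[of q t Y \<omega>, OF q Yq])
    have "P.cell_prob (\<lambda>\<omega>. (X \<omega>, q \<omega>, ?V \<omega>)) \<omega> = P.cell_prob (\<lambda>\<omega>. ((X \<omega>, q \<omega>), ?V \<omega>)) \<omega>"
      by (rule P.cell_prob_cong) auto
    also have "\<dots> = P.cell_prob (\<lambda>\<omega>. (X \<omega>, q \<omega>)) \<omega> * P.cell_prob (Y (q \<omega>)) (shift_by t \<omega>)"
      using cell_prob_past_future[OF Xq, of "\<lambda>a. Y (snd a)" \<omega>] Yq by simp
    moreover have "P.cell_prob (Y (q \<omega>)) (shift_by t \<omega>) \<noteq> 0"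
      using elim(1) unfolding 1 by auto
    ultimately show ?case using 1 by simp
  qed
  also have "\<dots> \<le> P.cond_ent X ?V"
    by (rule P.cond_ent_Pair_le[OF X(1) q(1) V])
  finally show ?thesis .
qed

end

section \<open>The entropy criterion\<close>

locale group_walk = group G for G :: "('a, 'm) monoid_scheme" (structure) +
  fixes \<mu> :: "'a pmf"
  assumes countable_carrier: "countable (carrier G)" and supp: "set_pmf \<mu> \<subseteq> carrier G"

sublocale group_walk \<subseteq> sequence_space "restrict_space (measure_pmf \<mu>) (carrier G)"
proof -
  interpret prob_space "restrict_space (measure_pmf \<mu>) (carrier G)"
    by (rule prob_space_restrict_pmf[OF supp])
  show "sequence_space (restrict_space (measure_pmf \<mu>) (carrier G))"
    by unfold_locales
qed

context group_walk
begin

abbreviation walk :: "(nat \<Rightarrow> 'a) \<Rightarrow> nat \<Rightarrow> 'a" where "walk \<equiv> walk_path G"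

abbreviation translate :: "'a \<Rightarrow> (nat \<Rightarrow> 'a) \<Rightarrow> nat \<Rightarrow> 'a" where
  "translate g w \<equiv> (\<lambda>n. g \<otimes> w n)"

definition incs :: "nat \<Rightarrow> (nat \<Rightarrow> 'a) \<Rightarrow> 'a list" where
  "incs k \<omega> = map \<omega> [0..<k]"

definition word :: "'a list \<Rightarrow> 'a" where
  "word l = foldl (\<otimes>) \<one> l"

section \<open>Increments and positions of the walk\<close>

lemma space_increments: "\<omega> \<in> space S \<Longrightarrow> \<omega> i \<in> carrier G"
  by (auto simp: space_PiM space_restrict_space PiE_iff)

lemma walk_closed: "\<omega> \<in> space S \<Longrightarrow> walk \<omega> n \<in> carrier G"
  by (induction n) (auto simp: space_increments)

lemma word_incs: "word (incs n \<omega>) = walk \<omega> n"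
  by (induction n) (auto simp: word_def incs_def)

lemma walk_shift:
  assumes "\<omega> \<in> space S"
  shows "walk \<omega> (n + t) = walk \<omega> t \<otimes> walk (shift_by t \<omega>) n"
proof (induction n)
  case (Suc n)
  have "shift_by t \<omega> n = \<omega> (n + t)" by (simp add: shift_by_def)
  then show ?case
    using Suc assms shift_space[OF assms, of t]
    by (simp add: m_assoc walk_closed space_increments)
qed (use assms in \<open>simp add: walk_closed\<close>)

lemma walk_measurable: "walk \<in> S \<rightarrow>\<^sub>M path_space G"
  by (rule measurable_walk_path[OF is_group countable_carrier])

lemma walk_in_path_space: "\<omega> \<in> space S \<Longrightarrow> walk \<omega> \<in> space (path_space G)"
  by (rule measurable_space[OF walk_measurable])

lemma space_path_space: "w \<in> space (path_space G) \<longleftrightarrow> (\<forall>n. w n \<in> carrier G)"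
  by (auto simp: path_space_def space_PiM PiE_iff)

lemma discrete_rv_increment: "P.discrete_rv (\<lambda>\<omega>. \<omega> i)"
proof (rule P.discrete_rvI)
  have "(\<lambda>\<omega>. \<omega> i) \<in> S \<rightarrow>\<^sub>M restrict_space (measure_pmf \<mu>) (carrier G)" by measurable
  moreover have "(\<lambda>x. x) \<in> restrict_space (measure_pmf \<mu>) (carrier G) \<rightarrow>\<^sub>M count_space UNIV"
    by (rule measurableI) (auto simp: sets_restrict_pmf space_restrict_space)
  ultimately show "(\<lambda>\<omega>. \<omega> i) \<in> S \<rightarrow>\<^sub>M count_space UNIV"
    by (rule measurable_compose)
  show "countable ((\<lambda>\<omega>. \<omega> i) ` space S)"
    by (rule countable_subset[OF _ countable_carrier]) (auto intro: space_increments)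
qed

lemma discrete_rv_incs: "P.discrete_rv (incs k)"
  using P.discrete_rv_map[of "[0..<k]" "\<lambda>i \<omega>. \<omega> i", OF discrete_rv_increment]
  unfolding incs_def by simp

lemma discrete_rv_walk: "P.discrete_rv (\<lambda>\<omega>. walk \<omega> n)"
  using P.discrete_rv_compose[OF discrete_rv_incs, of word n] by (simp add: word_incs)

lemma incs_past: "k \<le> t \<Longrightarrow> depends_on_past t (incs k)"
  by (rule depends_on_pastI) (simp add: incs_def)

lemma walk_past: "n \<le> t \<Longrightarrow> depends_on_past t (\<lambda>\<omega>. walk \<omega> n)"
proof (rule depends_on_pastI)
  fix \<omega> \<omega>' :: "nat \<Rightarrow> 'a" assume "n \<le> t" "\<And>i. i < t \<Longrightarrow> \<omega> i = \<omega>' i"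
  then have "incs n \<omega> = incs n \<omega>'" by (simp add: incs_def)
  then show "walk \<omega> n = walk \<omega>' n" by (metis word_incs)
qed

lemma incs_add: "incs (t + k) \<omega> = incs t \<omega> @ incs k (shift_by t \<omega>)"
proof -
  have "map \<omega> [t..<t + k] = map (\<lambda>i. \<omega> (i + t)) [0..<k]"
    by (rule nth_equalityI) (auto simp: add.commute)
  then show ?thesis
    by (simp add: incs_def shift_by_def upt_add_eq_append[of 0 t k])
qed

section \<open>Block decomposition of the entropy of the increments\<close>

lemma cond_ent_incs_blocks:
  assumes F: "P.discrete_rv F"
  shows "P.cond_ent (incs (n * k)) F =
    (\<Sum>j<n. P.cond_ent (\<lambda>\<omega>. incs k (shift_by (j * k) \<omega>)) (\<lambda>\<omega>. (incs (j * k) \<omega>, F \<omega>)))"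
proof (induction n)
  case 0
  have "P.cond_ent (incs 0) F = 0"
    by (rule P.cond_ent_0[OF discrete_rv_incs F P.determinesI]) (simp add: incs_def)
  then show ?case by simp
next
  case (Suc n)
  let ?B = "\<lambda>\<omega>. incs k (shift_by (n * k) \<omega>)"
  have B: "P.discrete_rv ?B" by (rule discrete_rv_shift[OF discrete_rv_incs])
  have BI: "P.discrete_rv (\<lambda>\<omega>. (?B \<omega>, incs (n * k) \<omega>))"
    by (rule P.discrete_rv_Pair[OF B discrete_rv_incs])
  have app: "incs (Suc n * k) \<omega> = incs (n * k) \<omega> @ ?B \<omega>" for \<omega>
    using incs_add[of "n * k" k \<omega>] by (simp add: add.commute)
  have len: "length (incs (n * k) \<omega>) = n * k" for \<omega> by (simp add: incs_def)
  have "P.cond_ent (incs (Suc n * k)) F = P.cond_ent (\<lambda>\<omega>. (?B \<omega>, incs (n * k) \<omega>)) F"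
  proof (rule antisym)
    show "P.cond_ent (incs (Suc n * k)) F \<le> P.cond_ent (\<lambda>\<omega>. (?B \<omega>, incs (n * k) \<omega>)) F"
      by (rule P.cond_ent_mono[OF discrete_rv_incs BI F P.determinesI])
        (simp only: app prod.inject)
    show "P.cond_ent (\<lambda>\<omega>. (?B \<omega>, incs (n * k) \<omega>)) F \<le> P.cond_ent (incs (Suc n * k)) F"
      by (rule P.cond_ent_mono[OF BI discrete_rv_incs F P.determinesI])
        (simp only: app prod.inject, metis append_eq_append_conv len)
  qed
  also have "\<dots> = P.cond_ent (incs (n * k)) F + P.cond_ent ?B (\<lambda>\<omega>. (incs (n * k) \<omega>, F \<omega>))"
    by (rule P.chain_rule[OF B discrete_rv_incs F])
  finally show ?case using Suc by simp
qed

text \<open>After t steps \<open>F\<close> is the function \<open>Y g\<close> of the fresh future,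
  where g is the current position. So every block of k increments has conditional entropy at least
  \<open>\<eta>\<close>, wherever the walk stands.\<close>

lemma cond_ent_incs_ge:
  assumes Y: "\<And>g. g \<in> carrier G \<Longrightarrow> P.discrete_rv (Y g)"
    and F: "P.discrete_rv F" "\<And>\<omega> t. \<omega> \<in> space S \<Longrightarrow> F \<omega> = Y (walk \<omega> t) (shift_by t \<omega>)"
    and le: "\<And>g. g \<in> carrier G \<Longrightarrow> \<eta> \<le> P.cond_ent (incs k) (Y g)"
  shows "of_nat n * \<eta> \<le> P.cond_ent (incs (n * k)) F"
proof -
  have "\<eta> \<le> P.cond_ent (\<lambda>\<omega>. incs k (shift_by t \<omega>)) (\<lambda>\<omega>. (incs t \<omega>, F \<omega>))" for t
  proof -
    let ?Y = "\<lambda>l. Y (word l)"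
    have w: "word l \<in> carrier G" if l: "l \<in> incs t ` space S" for l
      using l by (auto simp: word_incs walk_closed)
    have m: "P.discrete_rv (\<lambda>\<omega>. ?Y (incs t \<omega>) (shift_by t \<omega>))"
      by (rule discrete_rv_past_future[OF discrete_rv_incs]) (use w Y in auto)
    have "\<eta> = (\<integral>\<^sup>+ \<omega>. \<eta> \<partial>S)" by (simp add: P.emeasure_space_1)
    also have "\<dots> \<le> (\<integral>\<^sup>+ \<omega>. P.cond_ent (incs k) (?Y (incs t \<omega>)) \<partial>S)"
      by (rule nn_integral_mono) (simp add: le word_incs walk_closed)
    also have "\<dots> = P.cond_ent (\<lambda>\<omega>. incs k (shift_by t \<omega>)) (\<lambda>\<omega>. (incs t \<omega>, ?Y (incs t \<omega>) (shift_by t \<omega>)))"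
      by (rule cond_ent_past_future[symmetric, where Y = ?Y, OF discrete_rv_incs incs_past discrete_rv_incs])
        (use w Y in auto)
    also have "\<dots> \<le> P.cond_ent (\<lambda>\<omega>. incs k (shift_by t \<omega>)) (\<lambda>\<omega>. (incs t \<omega>, F \<omega>))"
      by (rule P.cond_ent_antimono[OF discrete_rv_shift[OF discrete_rv_incs]
            P.discrete_rv_Pair[OF discrete_rv_incs m] P.discrete_rv_Pair[OF discrete_rv_incs F(1)] P.determinesI])
        (use F(2) in \<open>simp add: word_incs\<close>)
    finally show ?thesis .
  qed
  then have "(\<Sum>j<n. \<eta>) \<le> P.cond_ent (incs (n * k)) F"
    unfolding cond_ent_incs_blocks[OF F(1)] by (intro sum_mono)
  then show ?thesis by simp
qed

text \<open>Given the increments before block j, the end point and the position of the restarted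
  walk at the remaining time N = (n - j) k determine each other. As N \<ge> k, the block is bounded
  by c.\<close>

lemma cond_ent_incs_walk_le:
  assumes c: "\<And>N. k \<le> N \<Longrightarrow> P.cond_ent (incs k) (\<lambda>\<omega>. walk \<omega> N) \<le> c"
  shows "P.cond_ent (incs (n * k)) (\<lambda>\<omega>. walk \<omega> (n * k)) \<le> of_nat n * c"
proof -
  have "P.cond_ent (\<lambda>\<omega>. incs k (shift_by (j * k) \<omega>)) (\<lambda>\<omega>. (incs (j * k) \<omega>, walk \<omega> (n * k))) \<le> c"
    if j: "j < n" for j
  proof -
    define t where "t = j * k"
    define N where "N = (n - j) * k"
    have N: "n * k = N + t" "k \<le> N"
      using j mult_le_mono1[of 1 "n - j" k]
      by (simp_all add: N_def t_def add_mult_distrib[symmetric] Suc_le_eq del: mult_le_cancel2)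
    let ?Y = "\<lambda>l \<omega>. word l \<otimes> walk \<omega> N"
    have Y: "P.discrete_rv (?Y l)" for l
      by (rule P.discrete_rv_compose[OF discrete_rv_walk])
    have m: "P.discrete_rv (\<lambda>\<omega>. ?Y (incs t \<omega>) (shift_by t \<omega>))"
      by (rule discrete_rv_past_future[OF discrete_rv_incs Y])
    have "P.cond_ent (\<lambda>\<omega>. incs k (shift_by t \<omega>)) (\<lambda>\<omega>. (incs t \<omega>, walk \<omega> (N + t))) \<le>
        P.cond_ent (\<lambda>\<omega>. incs k (shift_by t \<omega>)) (\<lambda>\<omega>. (incs t \<omega>, ?Y (incs t \<omega>) (shift_by t \<omega>)))"
    proof (rule P.cond_ent_antimono[OF discrete_rv_shift[OF discrete_rv_incs]
           P.discrete_rv_Pair[OF discrete_rv_incs discrete_rv_walk] P.discrete_rv_Pair[OF discrete_rv_incs m] P.determinesI])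
      fix \<omega> \<omega>' assume "\<omega> \<in> space S" "\<omega>' \<in> space S"
        and eq: "(incs t \<omega>, walk \<omega> (N + t)) = (incs t \<omega>', walk \<omega>' (N + t))"
      then have "?Y (incs t \<omega>) (shift_by t \<omega>) = walk \<omega> (N + t)"
        "?Y (incs t \<omega>') (shift_by t \<omega>') = walk \<omega>' (N + t)"
        by (simp_all only: word_incs walk_shift)
      with eq show "(incs t \<omega>, ?Y (incs t \<omega>) (shift_by t \<omega>)) = (incs t \<omega>', ?Y (incs t \<omega>') (shift_by t \<omega>'))"
        by (metis prod.inject)
    qed
    also have "\<dots> = (\<integral>\<^sup>+ \<omega>. P.cond_ent (incs k) (?Y (incs t \<omega>)) \<partial>S)"
      by (rule cond_ent_past_future[where Y = ?Y, OF discrete_rv_incs incs_past discrete_rv_incs Y]) simp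
    also have "\<dots> \<le> (\<integral>\<^sup>+ \<omega>. c \<partial>S)"
    proof (rule nn_integral_mono)
      fix \<omega> assume \<omega>: "\<omega> \<in> space S"
      have "P.cond_ent (incs k) (?Y (incs t \<omega>)) \<le> P.cond_ent (incs k) (\<lambda>\<omega>. walk \<omega> N)"
        by (rule P.cond_ent_antimono[OF discrete_rv_incs Y discrete_rv_walk P.determinesI])
          (use \<omega> in \<open>simp add: word_incs walk_closed\<close>)
      also have "\<dots> \<le> c" by (rule c[OF N(2)])
      finally show "P.cond_ent (incs k) (?Y (incs t \<omega>)) \<le> c" .
    qed
    also have "\<dots> = c" by (simp add: P.emeasure_space_1)
    finally show ?thesis by (simp add: t_def N)
  qed
  then have "(\<Sum>j<n. P.cond_ent (\<lambda>\<omega>. incs k (shift_by (j * k) \<omega>)) (\<lambda>\<omega>. (incs (j * k) \<omega>, walk \<omega> (n * k)))) \<le> (\<Sum>j<n. c)"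
    by (intro sum_mono) simp
  then show ?thesis
    unfolding cond_ent_incs_blocks[OF discrete_rv_walk] by simp
qed

lemma prob_increment: "P.prob {\<omega> \<in> space S. \<omega> i = x} = pmf \<mu> x"
proof (cases "x \<in> carrier G")
  case True
  have "emeasure S {\<omega> \<in> space S. \<omega> i \<in> {x}} = emeasure (restrict_space (measure_pmf \<mu>) (carrier G)) {x}"
    by (rule emeasure_PiM_Collect_single) (use True in \<open>auto simp: sets_restrict_pmf\<close>)
  then have "P.prob {\<omega> \<in> space S. \<omega> i = x} = measure (restrict_space (measure_pmf \<mu>) (carrier G)) {x}"
    by (simp add: measure_def)
  then show ?thesis
    using True by (simp add: measure_restrict_space pmf.rep_eq)
next
  case False
  then have e: "{\<omega> \<in> space S. \<omega> i = x} = {}" using space_increments by auto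
  have "pmf \<mu> x = 0" using False supp by (auto simp: pmf_eq_0_set_pmf)
  then show ?thesis unfolding e by simp
qed

lemma ent_increment: "P.ent (\<lambda>\<omega>. \<omega> i) = entropy_pmf \<mu>"
  unfolding P.ent_discrete[OF discrete_rv_increment] entropy_pmf_def prob_increment ..

lemma ent_incs_le: "P.ent (incs k) \<le> of_nat k * entropy_pmf \<mu>"
proof -
  have "incs k = (\<lambda>\<omega>. map (\<lambda>i. \<omega> i) [0..<k])" by (simp add: incs_def fun_eq_iff)
  then show ?thesis
    using P.ent_map_le[of "[0..<k]" "\<lambda>i \<omega>. \<omega> i", OF discrete_rv_increment]
    by (simp add: ent_increment sum_list_triv)
qed

section \<open>Approximation of events by finitely many increments\<close>

definition cylinder :: "(nat \<Rightarrow> 'a) set \<Rightarrow> bool" where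
  "cylinder B \<longleftrightarrow> (\<exists>k T. B = {\<omega> \<in> space S. incs k \<omega> \<in> T})"

lemma cylinder_sets: "cylinder B \<Longrightarrow> B \<in> sets S"
proof -
  assume "cylinder B"
  then obtain k T where "B = {\<omega> \<in> space S. incs k \<omega> \<in> T}" by (auto simp: cylinder_def)
  also have "\<dots> = incs k -` T \<inter> space S" by auto
  finally show ?thesis
    using measurable_sets[OF P.discrete_rv_measurable[OF discrete_rv_incs], of T] by simp
qed

lemma cylinder_mono:
  assumes "B = {\<omega> \<in> space S. incs k \<omega> \<in> T}" "k \<le> m"
  shows "\<exists>T. B = {\<omega> \<in> space S. incs m \<omega> \<in> T}"
proof -
  have "take k (incs m \<omega>) = incs k \<omega>" for \<omega>
    using assms(2) by (simp add: incs_def take_map)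
  then have "B = {\<omega> \<in> space S. incs m \<omega> \<in> {l. take k l \<in> T}}" using assms(1) by simp
  then show ?thesis by blast
qed

lemma cylinder_Un:
  assumes "cylinder A" "cylinder B"
  shows "cylinder (A \<union> B)"
proof -
  obtain k T k' T' where kT: "A = {\<omega> \<in> space S. incs k \<omega> \<in> T}" "B = {\<omega> \<in> space S. incs k' \<omega> \<in> T'}"
    using assms by (auto simp: cylinder_def)
  obtain U where U: "A = {\<omega> \<in> space S. incs (max k k') \<omega> \<in> U}"
    using cylinder_mono[OF kT(1), of "max k k'"] by auto
  obtain U' where U': "B = {\<omega> \<in> space S. incs (max k k') \<omega> \<in> U'}"
    using cylinder_mono[OF kT(2), of "max k k'"] by auto
  have "A \<union> B = {\<omega> \<in> space S. incs (max k k') \<omega> \<in> U \<union> U'}" using U U' by auto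
  then show ?thesis unfolding cylinder_def by blast
qed

lemma cylinder_compl: "cylinder A \<Longrightarrow> cylinder (space S - A)"
proof -
  assume "cylinder A"
  then obtain k T where "A = {\<omega> \<in> space S. incs k \<omega> \<in> T}" by (auto simp: cylinder_def)
  then have "space S - A = {\<omega> \<in> space S. incs k \<omega> \<in> - T}" by auto
  then show ?thesis unfolding cylinder_def by blast
qed

text \<open>The approximable events contain the generating sets and are closed under complements and
  countable unions.\<close>

lemma cylinder_approx:
  assumes "A \<in> sets S" "0 < \<delta>"
  shows "\<exists>B. cylinder B \<and> P.prob ((A - B) \<union> (B - A)) \<le> \<delta>"
proof -
  let ?R = "restrict_space (measure_pmf \<mu>) (carrier G)"
  let ?Q = "\<lambda>A. A \<in> sets S \<and> (\<forall>\<delta>>0. \<exists>B. cylinder B \<and> P.prob ((A - B) \<union> (B - A)) \<le> \<delta>)"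
  let ?X = "\<Pi>\<^sub>E i\<in>(UNIV::nat set). space ?R"
  let ?C = "{{f \<in> ?X. f i \<in> A} | i A. i \<in> UNIV \<and> A \<in> sets ?R}"
  have sets_eq: "sets S = sigma_sets ?X ?C" by (rule sets_PiM_single)
  have spS: "space S = ?X" by (simp add: space_PiM)
  have un: "?Q (A \<union> B)" if Q: "?Q A" "?Q B" for A B
  proof (intro conjI allI impI)
    show "A \<union> B \<in> sets S" using that by auto
    fix \<delta> :: real assume "0 < \<delta>"
    then have h: "0 < \<delta> / 2" by simp
    obtain A' where A': "cylinder A'" "P.prob ((A - A') \<union> (A' - A)) \<le> \<delta> / 2"
      using Q(1) h by blast
    obtain B' where B': "cylinder B'" "P.prob ((B - B') \<union> (B' - B)) \<le> \<delta> / 2"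
      using Q(2) h by blast
    note AB = A' B'
    have "P.prob ((A \<union> B - (A' \<union> B')) \<union> (A' \<union> B' - (A \<union> B))) \<le>
        P.prob (((A - A') \<union> (A' - A)) \<union> ((B - B') \<union> (B' - B)))"
      by (rule P.finite_measure_mono) (use that AB cylinder_sets in auto)
    also have "\<dots> \<le> P.prob ((A - A') \<union> (A' - A)) + P.prob ((B - B') \<union> (B' - B))"
      by (rule measure_Un_le) (use that AB cylinder_sets in auto)
    also have "\<dots> \<le> \<delta>" using AB by simp
    finally show "\<exists>C. cylinder C \<and> P.prob ((A \<union> B - C) \<union> (C - (A \<union> B))) \<le> \<delta>"
      using cylinder_Un[OF AB(1,3)] by blast
  qed
  have exact: "?Q A" if "cylinder A" for A
    using that cylinder_sets by (auto intro!: exI[of _ A])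
  have "?Q A" if "A \<in> sigma_sets ?X ?C" for A
    using that
  proof (induction A rule: sigma_sets.induct)
    case (Basic a)
    then obtain i B where a: "a = {f \<in> ?X. f i \<in> B}" by blast
    have "a = {\<omega> \<in> space S. incs (Suc i) \<omega> \<in> {l. l ! i \<in> B}}"
      unfolding a spS by (auto simp: incs_def nth_append)
    then have "cylinder a" unfolding cylinder_def by blast
    then show ?case by (rule exact)
  next
    case Empty
    have "cylinder {}" unfolding cylinder_def by (intro exI[of _ 0] exI[of _ "{}"]) auto
    then show ?case by (rule exact)
  next
    case (Compl a)
    show ?case
    proof (intro conjI allI impI)
      show "?X - a \<in> sets S" using Compl unfolding spS[symmetric] by auto
      fix \<delta> :: real assume "0 < \<delta>"
      then obtain B where B: "cylinder B" "P.prob ((a - B) \<union> (B - a)) \<le> \<delta>"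
        using Compl by blast
      have "a \<subseteq> space S" "B \<subseteq> space S"
        using Compl cylinder_sets[OF B(1)] sets.sets_into_space by blast+
      then have "(?X - a - (space S - B)) \<union> (space S - B - (?X - a)) = (a - B) \<union> (B - a)"
        unfolding spS[symmetric] by auto
      with B(2) show "\<exists>B. cylinder B \<and> P.prob ((?X - a - B) \<union> (B - (?X - a))) \<le> \<delta>"
        using cylinder_compl[OF B(1)] by (intro exI[of _ "space S - B"]) simp
    qed
  next
    case (Union a)
    have aS: "a i \<in> sets S" for i using Union by blast
    show ?case
    proof (intro conjI allI impI)
      show "(\<Union>i. a i) \<in> sets S" using aS by auto
      fix \<delta> :: real assume \<delta>: "0 < \<delta>"
      let ?U = "\<lambda>n. \<Union>i<n. a i"
      have QU: "?Q (?U n)" for n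
      proof (induction n)
        case 0
        have "cylinder {}" unfolding cylinder_def by (intro exI[of _ 0] exI[of _ "{}"]) auto
        then show ?case using exact[of "{}"] by simp
      next
        case (Suc n)
        have "?U (Suc n) = ?U n \<union> a n" by (auto simp: less_Suc_eq)
        then show ?case using un[OF Suc Union.IH[of n]] by simp
      qed
      \<comment> \<open>Continuity from below replaces the countable union by a finite one at the
        cost of \<delta>/2.\<close>
      have "(\<lambda>n. P.prob (?U n)) \<longlonglongrightarrow> P.prob (\<Union>n. ?U n)"
        by (rule P.finite_Lim_measure_incseq) (use aS in \<open>auto simp: incseq_def, force\<close>)
      moreover have "(\<Union>n. ?U n) = (\<Union>i. a i)" by auto
      ultimately have "eventually (\<lambda>n. P.prob (\<Union>i. a i) - \<delta> / 2 < P.prob (?U n)) sequentially"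
        using \<delta> by (intro order_tendstoD(1)) auto
      then obtain n where n: "P.prob (\<Union>i. a i) - \<delta> / 2 < P.prob (?U n)"
        by (auto simp: eventually_sequentially)
      obtain B where B: "cylinder B" "P.prob ((?U n - B) \<union> (B - ?U n)) \<le> \<delta> / 2"
        using QU[of n] half_gt_zero[OF \<delta>] by blast
      have BS: "B \<in> sets S" by (rule cylinder_sets[OF B(1)])
      have "P.prob (((\<Union>i. a i) - B) \<union> (B - (\<Union>i. a i))) \<le>
          P.prob (((\<Union>i. a i) - ?U n) \<union> ((?U n - B) \<union> (B - ?U n)))"
        by (rule P.finite_measure_mono) (use aS BS in auto)
      also have "\<dots> \<le> P.prob ((\<Union>i. a i) - ?U n) + P.prob ((?U n - B) \<union> (B - ?U n))"
        by (rule measure_Un_le) (use aS BS in auto)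
      also have "P.prob ((\<Union>i. a i) - ?U n) = P.prob (\<Union>i. a i) - P.prob (?U n)"
        by (rule P.finite_measure_Diff) (use aS in auto)
      finally show "\<exists>B. cylinder B \<and> P.prob (((\<Union>i. a i) - B) \<union> (B - (\<Union>i. a i))) \<le> \<delta>"
        using B n by (intro exI[of _ B]) auto
    qed
  qed
  with assms sets_eq show ?thesis by blast
qed

section \<open>Shift-invariant functions of the path\<close>

lemma path_shift_space: "w \<in> space (path_space G) \<Longrightarrow> path_shift w \<in> space (path_space G)"
  by (simp add: space_path_space path_shift_def)

lemma translate_in_path_space:
  "g \<in> carrier G \<Longrightarrow> w \<in> space (path_space G) \<Longrightarrow> translate g w \<in> space (path_space G)"
  by (simp add: space_path_space)

lemma translate_measurable:
  assumes "g \<in> carrier G"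
  shows "translate g \<in> path_space G \<rightarrow>\<^sub>M path_space G"
proof -
  have "(\<lambda>w n. g \<otimes> w n) \<in> path_space G \<rightarrow>\<^sub>M (\<Pi>\<^sub>M n\<in>(UNIV::nat set). count_space (carrier G))"
  proof (rule measurable_PiM_single')
    fix i :: nat
    have "(\<lambda>w. w i) \<in> path_space G \<rightarrow>\<^sub>M count_space (carrier G)"
      unfolding path_space_def by measurable
    moreover have "(\<lambda>x. g \<otimes> x) \<in> count_space (carrier G) \<rightarrow>\<^sub>M count_space (carrier G)"
      using assms by simp
    ultimately show "(\<lambda>w. g \<otimes> w i) \<in> path_space G \<rightarrow>\<^sub>M count_space (carrier G)"
      by (rule measurable_compose)
  qed (use assms in \<open>auto simp: path_space_def space_PiM PiE_iff\<close>)
  then show ?thesis by (simp add: path_space_def)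
qed

lemma invariant_funpow:
  assumes inv: "\<And>w. w \<in> space (path_space G) \<Longrightarrow> F (path_shift w) = F w"
    and w: "w \<in> space (path_space G)"
  shows "F (\<lambda>n. w (n + t)) = F w"
proof (induction t)
  case (Suc t)
  have "(\<lambda>n. w (n + Suc t)) = path_shift (\<lambda>n. w (n + t))" by (simp add: path_shift_def)
  moreover have "(\<lambda>n. w (n + t)) \<in> space (path_space G)" using w by (simp add: space_path_space)
  ultimately show ?case using inv[of "\<lambda>n. w (n + t)"] Suc by simp
qed simp

text \<open>An invariant function depends only on the path after time t, and that path is the walk
  of the fresh increments translated by the current position.\<close>

lemma invariant_walk_shift:
  assumes inv: "\<And>w. w \<in> space (path_space G) \<Longrightarrow> F (path_shift w) = F w"
    and \<omega>: "\<omega> \<in> space S"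
  shows "F (walk \<omega>) = F (translate (walk \<omega> t) (walk (shift_by t \<omega>)))"
proof -
  have "F (walk \<omega>) = F (\<lambda>n. walk \<omega> (n + t))"
    by (rule invariant_funpow[of F "walk \<omega>" t, OF inv walk_in_path_space[OF \<omega>], symmetric])
  also have "\<dots> = F (translate (walk \<omega> t) (walk (shift_by t \<omega>)))"
    by (simp add: walk_shift[OF \<omega>])
  finally show ?thesis .
qed

lemma discrete_rv_path_function:
  assumes F: "F \<in> path_space G \<rightarrow>\<^sub>M count_space UNIV" "countable (F ` space (path_space G))"
    and g: "g \<in> carrier G"
  shows "P.discrete_rv (\<lambda>\<omega>. F (translate g (walk \<omega>)))"
proof (rule P.discrete_rvI)
  show "(\<lambda>\<omega>. F (translate g (walk \<omega>))) \<in> S \<rightarrow>\<^sub>M count_space UNIV"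
    by (rule measurable_compose[OF measurable_compose[OF walk_measurable translate_measurable[OF g]] F(1)])
  show "countable ((\<lambda>\<omega>. F (translate g (walk \<omega>))) ` space S)"
    by (rule countable_subset[OF _ F(2)])
      (use translate_in_path_space[OF g] walk_in_path_space in blast)
qed

lemma discrete_rv_path_function':
  assumes F: "F \<in> path_space G \<rightarrow>\<^sub>M count_space UNIV" "countable (F ` space (path_space G))"
  shows "P.discrete_rv (\<lambda>\<omega>. F (walk \<omega>))"
proof (rule P.discrete_rvI)
  show "(\<lambda>\<omega>. F (walk \<omega>)) \<in> S \<rightarrow>\<^sub>M count_space UNIV"
    by (rule measurable_compose[OF walk_measurable F(1)])
  show "countable ((\<lambda>\<omega>. F (walk \<omega>)) ` space S)"
    by (rule countable_subset[OF _ F(2)]) (use walk_in_path_space in blast)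
qed

text \<open>The family \<open>F\<close> stands for a map to a candidate boundary, seen through
  countably valued functions. The indices are related only by \<open>equiv\<close>: a translate of
  one function is determined by another. \<open>H\<close> asks for one suitable n for each block
  length k.\<close>

theorem entropy_criterion:
  fixes F :: "'i \<Rightarrow> (nat \<Rightarrow> 'a) \<Rightarrow> 'c"
  assumes fin: "entropy_pmf \<mu> < \<infinity>"
    and F: "\<And>i. F i \<in> path_space G \<rightarrow>\<^sub>M count_space UNIV" "\<And>i. countable (F i ` space (path_space G))"
    and inv: "\<And>i w. w \<in> space (path_space G) \<Longrightarrow> F i (path_shift w) = F i w"
    and equiv: "\<And>i g. g \<in> carrier G \<Longrightarrow>
      \<exists>i'. P.determines (\<lambda>\<omega>. F i' (walk \<omega>)) (\<lambda>\<omega>. F i (translate g (walk \<omega>)))"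
    and H: "\<And>k \<epsilon>. 0 < k \<Longrightarrow> 0 < \<epsilon> \<Longrightarrow>
      \<exists>n>0. \<exists>i. P.cond_ent (\<lambda>\<omega>. walk \<omega> (n * k)) (\<lambda>\<omega>. F i (walk \<omega>)) \<le> ennreal (\<epsilon> * real n)"
    and A: "A \<in> invariant_events G" and \<epsilon>: "0 < \<epsilon>"
  shows "\<exists>i D. measure (walk_law G \<mu>) {w \<in> space (path_space G). w \<in> A \<longleftrightarrow> F i w \<notin> D} \<le> \<epsilon>"
proof -
  \<comment> \<open>Two errors of size e occur, one from the choice of the index and one from the
    approximation of \<open>A'\<close> by a cylinder; ln 2 is the price of an error of the majority
    vote.\<close>
  define e where "e = \<epsilon> * ln 2 / 2"
  have e: "0 < e" using \<epsilon> by (simp add: e_def)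
  define A' where "A' = {\<omega> \<in> space S. walk \<omega> \<in> A}"
  have As: "A \<in> sets (path_space G)"
    and Ainv: "\<And>w. w \<in> space (path_space G) \<Longrightarrow> path_shift w \<in> A \<longleftrightarrow> w \<in> A"
    using A by (auto simp: invariant_events_def)
  have A's: "A' \<in> sets S"
    using measurable_sets[OF walk_measurable As] by (simp add: A'_def vimage_def Int_def conj_commute)
  have Arv: "P.discrete_rv (\<lambda>\<omega>. \<omega> \<in> A')" by (rule P.discrete_rv_event[OF A's])
  have Frv: "P.discrete_rv (\<lambda>\<omega>. F i (walk \<omega>))" for i
    by (rule discrete_rv_path_function'[OF F])
  have Fgrv: "P.discrete_rv (\<lambda>\<omega>. F i (translate g (walk \<omega>)))" if "g \<in> carrier G" for g i
    by (rule discrete_rv_path_function[OF F that])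

  obtain \<delta> where \<delta>: "0 < \<delta>"
    "\<And>A B. A \<in> sets S \<Longrightarrow> B \<in> sets S \<Longrightarrow> P.prob ((A - B) \<union> (B - A)) \<le> \<delta> \<Longrightarrow>
      P.cond_ent (\<lambda>\<omega>. \<omega> \<in> A) (\<lambda>\<omega>. \<omega> \<in> B) \<le> ennreal e"
    using P.cond_ent_close_events[OF e] by blast
  obtain B where B: "cylinder B" "P.prob ((A' - B) \<union> (B - A')) \<le> \<delta>"
    using cylinder_approx[OF A's \<delta>(1)] by blast
  obtain k0 T0 where B0: "B = {\<omega> \<in> space S. incs k0 \<omega> \<in> T0}"
    using B(1) unfolding cylinder_def by (elim exE)
  have "\<exists>T. B = {\<omega> \<in> space S. incs (Suc k0) \<omega> \<in> T}"
    by (rule cylinder_mono[OF B0]) simp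
  then obtain T where BT: "B = {\<omega> \<in> space S. incs (Suc k0) \<omega> \<in> T}" ..
  \<comment> \<open>One increment more than the cylinder uses, so that k > 0 and \<open>H\<close>
    applies.\<close>
  define k where "k = Suc k0"
  have k: "0 < k" and BT: "B = {\<omega> \<in> space S. incs k \<omega> \<in> T}"
    using BT unfolding k_def by simp_all
  have HA: "P.cond_ent (\<lambda>\<omega>. \<omega> \<in> A') (incs k) \<le> ennreal e"
  proof -
    have "P.cond_ent (\<lambda>\<omega>. \<omega> \<in> A') (incs k) \<le> P.cond_ent (\<lambda>\<omega>. \<omega> \<in> A') (\<lambda>\<omega>. \<omega> \<in> B)"
      by (rule P.cond_ent_antimono[OF Arv discrete_rv_incs P.discrete_rv_event[OF cylinder_sets[OF B(1)]] P.determinesI])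
        (simp add: BT)
    also have "\<dots> \<le> ennreal e" by (rule \<delta>(2)[OF A's cylinder_sets[OF B(1)] B(2)])
    finally show ?thesis .
  qed

  \<comment> \<open>Plays the role of the entropy of the first k increments given the tail of the
    path.\<close>
  define c where "c = (SUP N\<in>{k..}. P.cond_ent (incs k) (\<lambda>\<omega>. walk \<omega> N))"
  have c_ge: "P.cond_ent (incs k) (\<lambda>\<omega>. walk \<omega> N) \<le> c" if "k \<le> N" for N
    unfolding c_def by (rule SUP_upper) (use that in simp)
  have "c \<le> P.ent (incs k)"
    unfolding c_def by (intro SUP_least P.cond_ent_le_ent discrete_rv_incs discrete_rv_walk)
  also have "\<dots> \<le> of_nat k * entropy_pmf \<mu>" by (rule ent_incs_le)
  also have "\<dots> < \<infinity>" using fin by (simp add: ennreal_mult_less_top of_nat_less_top)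
  finally have c_fin: "c < \<infinity>" .

  obtain i where i: "P.cond_ent (incs k) (\<lambda>\<omega>. F i (walk \<omega>)) \<le> c + ennreal e"
  proof -
    \<comment> \<open>An infimum over all indices, because the translation by the current position
      changes the index from block to block.\<close>
    define \<eta> where "\<eta> = (INF i. P.cond_ent (incs k) (\<lambda>\<omega>. F i (walk \<omega>)))"
    obtain n j where n: "0 < n"
      and nj: "P.cond_ent (\<lambda>\<omega>. walk \<omega> (n * k)) (\<lambda>\<omega>. F j (walk \<omega>)) \<le> ennreal (e / 2 * real n)"
      using H[OF k, of "e / 2"] e by auto
    have "of_nat n * \<eta> \<le> P.cond_ent (incs (n * k)) (\<lambda>\<omega>. F j (walk \<omega>))"
    proof (rule cond_ent_incs_ge[where Y = "\<lambda>g \<omega>. F j (translate g (walk \<omega>))"])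
      show "F j (walk \<omega>) = F j (translate (walk \<omega> t) (walk (shift_by t \<omega>)))" if "\<omega> \<in> space S" for \<omega> t
        by (rule invariant_walk_shift[of "F j", OF inv that])
      fix g assume g: "g \<in> carrier G"
      obtain j' where j': "P.determines (\<lambda>\<omega>. F j' (walk \<omega>)) (\<lambda>\<omega>. F j (translate g (walk \<omega>)))"
        using equiv[OF g] by blast
      have "\<eta> \<le> P.cond_ent (incs k) (\<lambda>\<omega>. F j' (walk \<omega>))"
        unfolding \<eta>_def by (rule INF_lower) simp
      also have "\<dots> \<le> P.cond_ent (incs k) (\<lambda>\<omega>. F j (translate g (walk \<omega>)))"
        by (rule P.cond_ent_antimono[OF discrete_rv_incs Frv Fgrv[OF g] j'])
      finally show "\<eta> \<le> P.cond_ent (incs k) (\<lambda>\<omega>. F j (translate g (walk \<omega>)))" .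
    qed (rule Fgrv Frv, assumption?)+
    also have "\<dots> \<le> P.cond_ent (\<lambda>\<omega>. (incs (n * k) \<omega>, walk \<omega> (n * k))) (\<lambda>\<omega>. F j (walk \<omega>))"
      by (rule P.cond_ent_mono[OF discrete_rv_incs P.discrete_rv_Pair[OF discrete_rv_incs discrete_rv_walk] Frv P.determinesI])
        simp
    also have "\<dots> = P.cond_ent (\<lambda>\<omega>. walk \<omega> (n * k)) (\<lambda>\<omega>. F j (walk \<omega>)) +
        P.cond_ent (incs (n * k)) (\<lambda>\<omega>. (walk \<omega> (n * k), F j (walk \<omega>)))"
      by (rule P.chain_rule[OF discrete_rv_incs discrete_rv_walk Frv])
    also have "\<dots> \<le> ennreal (e / 2 * real n) + P.cond_ent (incs (n * k)) (\<lambda>\<omega>. walk \<omega> (n * k))"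
      by (intro add_mono nj P.cond_ent_antimono discrete_rv_incs discrete_rv_walk P.discrete_rv_Pair Frv P.determinesI)
        simp
    also have "\<dots> \<le> ennreal (e / 2 * real n) + of_nat n * c"
      by (intro add_left_mono cond_ent_incs_walk_le c_ge)
    also have "\<dots> = of_nat n * (c + ennreal (e / 2))"
    proof -
      have "ennreal (e / 2 * real n) = ennreal (e / 2) * ennreal (real n)"
        using e by (intro ennreal_mult) auto
      then show ?thesis
        by (simp add: ennreal_of_nat_eq_real_of_nat distrib_left mult.commute add.commute)
    qed
    finally have "\<eta> \<le> c + ennreal (e / 2)"
      using n by (simp add: ennreal_mult_le_mult_iff of_nat_less_top less_top[symmetric])
    \<comment> \<open>The spare half of e makes the inequality strict, so that an actual index does
      as well as the infimum.\<close>
    also have "\<dots> < c + ennreal e"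
      using c_fin e by (simp add: ennreal_add_left_cancel_less ennreal_less_iff)
    finally obtain i where "P.cond_ent (incs k) (\<lambda>\<omega>. F i (walk \<omega>)) < c + ennreal e"
      unfolding \<eta>_def INF_less_iff by blast
    then show ?thesis by (rule that[OF less_imp_le])
  qed

  have lower: "c \<le> P.cond_ent (incs k) (\<lambda>\<omega>. (\<omega> \<in> A', F i (walk \<omega>)))"
    unfolding c_def
  proof (rule SUP_least)
    fix N assume "N \<in> {k..}"
    then have N: "k \<le> N" by simp
    let ?Y = "\<lambda>g \<omega>. (translate g (walk \<omega>) \<in> A, F i (translate g (walk \<omega>)))"
    have Y: "P.discrete_rv (?Y g)" if "g \<in> (\<lambda>\<omega>. walk \<omega> N) ` space S" for g
    proof -
      have g: "g \<in> carrier G" using that walk_closed by auto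
      have "P.discrete_rv (\<lambda>\<omega>. (\<lambda>w. w \<in> A) (translate g (walk \<omega>)))"
        by (rule discrete_rv_path_function[OF _ _ g]) (use As in auto)
      then show ?thesis using Fgrv[OF g] by (intro P.discrete_rv_Pair) auto
    qed
    have "P.cond_ent (incs k) (\<lambda>\<omega>. walk \<omega> N) \<le> P.cond_ent (incs k) (\<lambda>\<omega>. ?Y (walk \<omega> N) (shift_by N \<omega>))"
      by (rule cond_ent_Markov[where Y = ?Y, OF discrete_rv_incs incs_past[OF N] discrete_rv_walk walk_past Y]) auto
    also have "\<dots> \<le> P.cond_ent (incs k) (\<lambda>\<omega>. (\<omega> \<in> A', F i (walk \<omega>)))"
    proof (rule P.cond_ent_antimono[OF discrete_rv_incs _ _ P.determinesI])
      show "P.discrete_rv (\<lambda>\<omega>. ?Y (walk \<omega> N) (shift_by N \<omega>))"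
        by (rule discrete_rv_past_future[where Y = ?Y, OF discrete_rv_walk Y])
      show "P.discrete_rv (\<lambda>\<omega>. (\<omega> \<in> A', F i (walk \<omega>)))"
        by (rule P.discrete_rv_Pair[OF Arv Frv])
      have eq: "(\<omega> \<in> A', F i (walk \<omega>)) = ?Y (walk \<omega> N) (shift_by N \<omega>)" if "\<omega> \<in> space S" for \<omega>
        using invariant_walk_shift[of "F i", OF inv that] invariant_walk_shift[of "\<lambda>w. w \<in> A", OF Ainv that] that
        by (simp add: A'_def)
      fix \<omega> \<omega>' assume "\<omega> \<in> space S" "\<omega>' \<in> space S" "?Y (walk \<omega> N) (shift_by N \<omega>) = ?Y (walk \<omega>' N) (shift_by N \<omega>')"
      then show "(\<omega> \<in> A', F i (walk \<omega>)) = (\<omega>' \<in> A', F i (walk \<omega>'))"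
        using eq by metis
    qed
    finally show "P.cond_ent (incs k) (\<lambda>\<omega>. walk \<omega> N) \<le> P.cond_ent (incs k) (\<lambda>\<omega>. (\<omega> \<in> A', F i (walk \<omega>)))" .
  qed

  let ?F = "\<lambda>\<omega>. F i (walk \<omega>)" and ?A = "\<lambda>\<omega>. \<omega> \<in> A'"
  \<comment> \<open>The entropy of the increments together with \<open>A'\<close>, given
    \<open>F i\<close>, is expanded in both orders. One order yields at least c plus the entropy of
    \<open>A'\<close>, the other at most c + 2e, and c is finite.\<close>
  have "c + P.cond_ent ?A ?F \<le> P.cond_ent ?A ?F + P.cond_ent (incs k) (\<lambda>\<omega>. (?A \<omega>, ?F \<omega>))"
    using lower by (simp add: add.commute add_mono)
  also have "\<dots> = P.cond_ent (\<lambda>\<omega>. (incs k \<omega>, ?A \<omega>)) ?F"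
    by (rule P.chain_rule[OF discrete_rv_incs Arv Frv, symmetric])
  also have "\<dots> \<le> P.cond_ent (\<lambda>\<omega>. (?A \<omega>, incs k \<omega>)) ?F"
    by (rule P.cond_ent_mono[OF P.discrete_rv_Pair[OF discrete_rv_incs Arv] P.discrete_rv_Pair[OF Arv discrete_rv_incs] Frv P.determinesI])
      simp
  also have "\<dots> = P.cond_ent (incs k) ?F + P.cond_ent ?A (\<lambda>\<omega>. (incs k \<omega>, ?F \<omega>))"
    by (rule P.chain_rule[OF Arv discrete_rv_incs Frv])
  also have "\<dots> \<le> (c + ennreal e) + P.cond_ent ?A (incs k)"
    by (intro add_mono i P.cond_ent_antimono Arv discrete_rv_incs P.discrete_rv_Pair Frv P.determinesI) simp
  also have "\<dots> \<le> (c + ennreal e) + ennreal e" by (intro add_left_mono HA)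
  also have "\<dots> = c + ennreal (\<epsilon> * ln 2)"
    using e by (simp add: e_def add.assoc ennreal_plus[symmetric] del: ennreal_plus)
  finally have "P.cond_ent ?A ?F \<le> ennreal (\<epsilon> * ln 2)"
    using c_fin by (auto simp: ennreal_add_left_cancel_le)
  then obtain D where D: "P.prob {\<omega> \<in> space S. \<omega> \<in> A' \<longleftrightarrow> F i (walk \<omega>) \<notin> D} \<le> \<epsilon>"
    using P.event_approx_of_cond_ent[OF A's Frv] \<epsilon> by fastforce
  let ?E = "{w \<in> space (path_space G). w \<in> A \<longleftrightarrow> F i w \<notin> D}"
  have FD: "F i -` D \<inter> space (path_space G) \<in> sets (path_space G)"
    by (rule measurable_sets[OF F(1)]) simp
  have "?E = (A - F i -` D \<inter> space (path_space G)) \<union> (F i -` D \<inter> space (path_space G) - A)"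
    using sets.sets_into_space[OF As] by auto
  then have Es: "?E \<in> sets (path_space G)" using As FD by auto
  have "measure (walk_law G \<mu>) ?E = P.prob (walk -` ?E \<inter> space S)"
    unfolding walk_law_def by (rule measure_distr[OF walk_measurable Es])
  also have "walk -` ?E \<inter> space S = {\<omega> \<in> space S. \<omega> \<in> A' \<longleftrightarrow> F i (walk \<omega>) \<notin> D}"
    using walk_in_path_space by (auto simp: A'_def)
  finally show ?thesis using D by (intro exI[of _ i] exI[of _ D]) simp
qed

end

section \<open>Transience of random walks\<close>

lemma central_binomial_sqrt_bound:
  "(real ((2 * j) choose j) / 4 ^ j)\<^sup>2 * real (2 * j + 1) \<le> 1"
proof (induction j)
  case (Suc j)
  let ?c = "\<lambda>j. real ((2 * j) choose j) / 4 ^ j"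
  have "(2 * Suc j choose Suc j) * Suc j * Suc j = (2 * j choose j) * (2 * j + 1) * (2 * j + 2)"
  proof -
    have "(2 * Suc j choose Suc j) * Suc j = (2 * j + 1 choose j) * (2 * j + 2)"
      using Suc_times_binomial_eq[of "2 * j + 1" j] by (simp add: mult.commute)
    moreover have "(2 * j + 1 choose j) * Suc j = (2 * j choose j) * (2 * j + 1)"
    proof -
      have "(2 * j + 1 choose j) = (2 * j + 1 choose Suc j)"
        using binomial_symmetric[of j "2 * j + 1"] by simp
      then show ?thesis
        using Suc_times_binomial_eq[of "2 * j" j] by (simp add: mult.commute)
    qed
    ultimately show ?thesis by (metis mult.assoc mult.commute)
  qed
  then have eq: "real (2 * Suc j choose Suc j) * real (Suc j) * real (Suc j) =
      real (2 * j choose j) * real (2 * j + 1) * real (2 * j + 2)"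
    by (metis of_nat_mult)
  have gen: "a / (4 * z) = b / z * y / (2 * x)"
    if "a * x * x = b * y * (2 * x)" "0 < x" "0 < z" for a b x y z :: real
  proof -
    have "a * x = b * y * 2" using that by (simp add: mult.assoc)
    then show ?thesis using that by (simp add: field_simps)
  qed
  have c: "?c (Suc j) = ?c j * real (2 * j + 1) / real (2 * j + 2)"
    using gen[of "real (2 * Suc j choose Suc j)" "real (Suc j)" "real (2 * j choose j)" "real (2 * j + 1)" "4 ^ j"] eq
    by (simp del: binomial_Suc_Suc add: algebra_simps)
  \<comment> \<open>The squared form is made for induction: the quotient of consecutive terms is
    (2j+1)(2j+3)/(2j+2)^2, which is at most 1.\<close>
  have "(?c (Suc j))\<^sup>2 * real (2 * Suc j + 1) =
      ((?c j)\<^sup>2 * real (2 * j + 1)) * (real (2 * j + 1) * real (2 * j + 3) / (real (2 * j + 2))\<^sup>2)"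
  proof -
    have "(a * x / y)\<^sup>2 * z = (a\<^sup>2 * x) * (x * z / y\<^sup>2)" for a x y z :: real
      by (simp add: power2_eq_square)
    moreover have "2 * Suc j + 1 = 2 * j + 3" by simp
    ultimately show ?thesis unfolding c by (simp only:)
  qed
  also have "\<dots> \<le> 1 * 1"
  proof (rule mult_mono[OF Suc])
    have "real (2 * j + 1) * real (2 * j + 3) \<le> (real (2 * j + 2))\<^sup>2"
      by (simp add: power2_eq_square algebra_simps)
    then show "real (2 * j + 1) * real (2 * j + 3) / (real (2 * j + 2))\<^sup>2 \<le> 1" by simp
  qed auto
  finally show ?case by simp
qed simp

text \<open>The middle coefficient is the largest, and an odd row reduces to the next even one, as
  C(2j+1, j) is half of C(2j+2, j+1).\<close>

lemma binomial_half_le: "real (m choose k) / 2 ^ m \<le> 1 / sqrt (real (m + 1))"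
proof -
  have *: "real ((2 * j) choose j) / 4 ^ j \<le> 1 / sqrt (real (2 * j + 1))" for j
  proof -
    have "(real ((2 * j) choose j) / 4 ^ j)\<^sup>2 \<le> (1 / sqrt (real (2 * j + 1)))\<^sup>2"
      using central_binomial_sqrt_bound[of j] by (simp add: power_divide field_simps)
    then show ?thesis by (rule power2_le_imp_le) simp
  qed
  have "real (m choose k) / 2 ^ m \<le> real (m choose (m div 2)) / 2 ^ m"
    using binomial_maximum[of m k] by (intro divide_right_mono) auto
  also have "\<dots> \<le> 1 / sqrt (real (m + 1))"
  proof (cases "even m")
    case True
    then obtain j where m: "m = 2 * j" by blast
    then show ?thesis using *[of j] by (simp add: power_mult)
  next
    case False
    then obtain j where m: "m = 2 * j + 1" by (auto elim: oddE)
    have "(2 * Suc j choose Suc j) = 2 * (2 * j + 1 choose j)"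
    proof -
      have "(2 * Suc j choose Suc j) = (2 * j + 1 choose j) + (2 * j + 1 choose Suc j)"
        by simp
      also have "(2 * j + 1 choose Suc j) = (2 * j + 1 choose j)"
        using binomial_symmetric[of j "2 * j + 1"] by simp
      finally show ?thesis by simp
    qed
    then have "real (m choose (m div 2)) / 2 ^ m = real (2 * Suc j choose Suc j) / 4 ^ Suc j"
      unfolding m by (simp add: power_mult)
    also have "\<dots> \<le> 1 / sqrt (real (2 * Suc j + 1))" by (rule *)
    also have "\<dots> \<le> 1 / sqrt (real (m + 1))"
      unfolding m by (intro divide_left_mono) auto
    finally show ?thesis .
  qed
  finally show ?thesis .
qed

text \<open>The identity C(n, m) / (m+1) = C(n+1, m+1) / (n+1) turns the sum into the binomial
  expansion with exponent n+1 without its first term.\<close>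

lemma binomial_pmf_inverse_Suc:
  assumes "0 < \<beta>" "\<beta> \<le> 1"
  shows "(\<integral>\<^sup>+ m. ennreal (1 / real (m + 1)) \<partial>binomial_pmf n \<beta>) \<le> ennreal (1 / (\<beta> * real (n + 1)))"
proof -
  have "(\<integral>\<^sup>+ m. ennreal (1 / real (m + 1)) \<partial>binomial_pmf n \<beta>) =
      (\<Sum>m\<le>n. ennreal (1 / real (m + 1)) * ennreal (pmf (binomial_pmf n \<beta>) m))"
    using assms by (intro nn_integral_measure_pmf_support) (auto simp: set_pmf_binomial_eq split: if_splits)
  also have "\<dots> = (\<Sum>m\<le>n. ennreal (1 / real (m + 1) * (real (n choose m) * \<beta> ^ m * (1 - \<beta>) ^ (n - m))))"
    using assms by (intro sum.cong refl, subst ennreal_mult[symmetric]) auto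
  also have "\<dots> = ennreal (\<Sum>m\<le>n. 1 / real (m + 1) * (real (n choose m) * \<beta> ^ m * (1 - \<beta>) ^ (n - m)))"
    by (rule sum_ennreal) (use assms in auto)
  also have "\<dots> \<le> ennreal (1 / (\<beta> * real (n + 1)))"
  proof (rule ennreal_leI)
    have "(\<Sum>m\<le>n. 1 / real (m + 1) * (real (n choose m) * \<beta> ^ m * (1 - \<beta>) ^ (n - m))) =
        (\<Sum>m\<le>n. (real (Suc n choose Suc m) * \<beta> ^ Suc m * (1 - \<beta>) ^ (Suc n - Suc m)) / (\<beta> * real (n + 1)))"
    proof (rule sum.cong[OF refl])
      fix m
      have "real (Suc m) * real (Suc n choose Suc m) = real (Suc n) * real (n choose m)"
        using Suc_times_binomial_eq[of n m] by (metis mult.commute of_nat_mult)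
      then have "real (Suc n choose Suc m) = real (Suc n) * real (n choose m) / real (Suc m)"
        by (simp add: field_simps)
      then show "1 / real (m + 1) * (real (n choose m) * \<beta> ^ m * (1 - \<beta>) ^ (n - m)) =
          real (Suc n choose Suc m) * \<beta> ^ Suc m * (1 - \<beta>) ^ (Suc n - Suc m) / (\<beta> * real (n + 1))"
        using assms by simp
    qed
    also have "\<dots> = (\<Sum>m\<le>n. real (Suc n choose Suc m) * \<beta> ^ Suc m * (1 - \<beta>) ^ (Suc n - Suc m)) / (\<beta> * real (n + 1))"
      by (simp only: sum_divide_distrib)
    also have "\<dots> \<le> 1 / (\<beta> * real (n + 1))"
    proof (intro divide_right_mono)
      have "(\<Sum>m\<le>Suc n. real (Suc n choose m) * \<beta> ^ m * (1 - \<beta>) ^ (Suc n - m)) = (\<beta> + (1 - \<beta>)) ^ Suc n"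
        by (rule binomial_ring[symmetric])
      then have "(\<Sum>m\<le>Suc n. real (Suc n choose m) * \<beta> ^ m * (1 - \<beta>) ^ (Suc n - m)) = 1"
        by simp
      moreover have "0 \<le> (1 - \<beta>) ^ Suc n" using assms by simp
      ultimately show "(\<Sum>m\<le>n. real (Suc n choose Suc m) * \<beta> ^ Suc m * (1 - \<beta>) ^ (Suc n - Suc m)) \<le> 1"
        by (subst (asm) sum.atMost_Suc_shift) simp
    qed (use assms in auto)
    finally show "(\<Sum>m\<le>n. 1 / real (m + 1) * (real (n choose m) * \<beta> ^ m * (1 - \<beta>) ^ (n - m))) \<le> 1 / (\<beta> * real (n + 1))" .
  qed
  finally show ?thesis .
qed

text \<open>Averages the bound of \<open>binomial_half_le\<close> when the number m of fair choices
  is itself random.\<close>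

lemma binomial_pmf_inverse_sqrt_Suc:
  assumes "0 < \<beta>" "\<beta> \<le> 1"
  shows "(\<integral>\<^sup>+ m. ennreal (1 / sqrt (real (m + 1))) \<partial>binomial_pmf n \<beta>) \<le> ennreal (1 / sqrt (\<beta> * real (n + 1)))"
proof -
  \<comment> \<open>Balances the two terms of the inequality below: each then contributes at most
    1/(2s).\<close>
  define s where "s = sqrt (\<beta> * real (n + 1))"
  have s: "0 < s" "s * s = \<beta> * real (n + 1)" using assms by (auto simp: s_def)
  \<comment> \<open>AM-GM instead of Jensen's inequality for the square root\<close>
  have "1 / sqrt (real (m + 1)) \<le> s / 2 * (1 / real (m + 1)) + 1 / (2 * s)" for m :: nat
  proof -
    define r where "r = sqrt (real (m + 1))"
    have r: "0 < r" "r * r = real (m + 1)" by (auto simp: r_def)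
    have "0 \<le> (s / r - 1)\<^sup>2 / (2 * s)" using s by simp
    also have "(s / r - 1)\<^sup>2 / (2 * s) = s / 2 * (1 / (r * r)) + 1 / (2 * s) - 1 / r"
      using r(1) s(1) by (simp add: power2_eq_square field_simps)
    finally show ?thesis
      unfolding r_def[symmetric] unfolding r(2)[symmetric] by simp
  qed
  then have "(\<integral>\<^sup>+ m. ennreal (1 / sqrt (real (m + 1))) \<partial>binomial_pmf n \<beta>) \<le>
      (\<integral>\<^sup>+ m. ennreal (s / 2) * ennreal (1 / real (m + 1)) + ennreal (1 / (2 * s)) \<partial>binomial_pmf n \<beta>)"
    using s by (intro nn_integral_mono)
      (simp add: ennreal_mult[symmetric] ennreal_plus[symmetric] ennreal_leI del: ennreal_plus)
  also have "\<dots> = ennreal (s / 2) * (\<integral>\<^sup>+ m. ennreal (1 / real (m + 1)) \<partial>binomial_pmf n \<beta>) + ennreal (1 / (2 * s))"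
    by (simp add: nn_integral_add nn_integral_cmult measure_pmf.emeasure_space_1)
  also have "\<dots> \<le> ennreal (s / 2) * ennreal (1 / (s * s)) + ennreal (1 / (2 * s))"
    unfolding s(2) by (intro add_mono mult_left_mono binomial_pmf_inverse_Suc assms) auto
  also have "\<dots> = ennreal (s / 2 * (1 / (s * s)) + 1 / (2 * s))"
    using s(1) by (simp add: ennreal_mult[symmetric] ennreal_plus[symmetric] del: ennreal_plus)
  also have "s / 2 * (1 / (s * s)) + 1 / (2 * s) = 1 / s" using s(1) by (simp add: field_simps)
  finally show ?thesis by (simp add: s_def)
qed

section \<open>Step laws that contain a fair choice between 0 and v\<close>

primrec walk_pmf :: "'v::ab_group_add pmf \<Rightarrow> nat \<Rightarrow> 'v pmf" where
  "walk_pmf p 0 = return_pmf 0"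
| "walk_pmf p (Suc n) = bind_pmf p (\<lambda>x. map_pmf (\<lambda>y. x + y) (walk_pmf p n))"

lemma walk_pmf_add:
  "walk_pmf p (m + n) = bind_pmf (walk_pmf p m) (\<lambda>x. map_pmf (\<lambda>y. x + y) (walk_pmf p n))"
proof (induction m)
  case 0
  have "(+) (0::'a) = id" by (rule ext) simp
  then have "map_pmf ((+) 0) (walk_pmf p n) = walk_pmf p n" by (simp only: pmf.map_id id_apply)
  then show ?case by (simp add: bind_return_pmf)
next
  case (Suc m)
  have "(+) (x + y) = (\<lambda>z. x + (y + z))" for x y :: 'a by (auto simp: add.assoc)
  with Suc show ?case
    by (simp add: bind_assoc_pmf bind_map_pmf map_bind_pmf map_pmf_comp)
qed

text \<open>A step is, with probability \<open>\<beta>\<close>, a fair choice between \<open>0\<close> and \<open>v\<close>. The pair records the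
  number of such steps and the sum of all other steps.\<close>

primrec count_pmf :: "real \<Rightarrow> 'v::ab_group_add pmf \<Rightarrow> nat \<Rightarrow> (nat \<times> 'v) pmf" where
  "count_pmf \<beta> q 0 = return_pmf (0, 0)"
| "count_pmf \<beta> q (Suc n) = bind_pmf (bernoulli_pmf \<beta>) (\<lambda>b.
    if b then map_pmf (\<lambda>(m, y). (Suc m, y)) (count_pmf \<beta> q n)
    else bind_pmf q (\<lambda>s. map_pmf (\<lambda>(m, y). (m, s + y)) (count_pmf \<beta> q n)))"

lemma map_fst_count_pmf:
  assumes "0 \<le> \<beta>" "\<beta> \<le> 1"
  shows "map_pmf fst (count_pmf \<beta> q n) = binomial_pmf n \<beta>"
proof (induction n)
  case (Suc n)
  have "map_pmf fst (count_pmf \<beta> q (Suc n)) =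
      bind_pmf (bernoulli_pmf \<beta>) (\<lambda>b. map_pmf (\<lambda>k. (if b then 1 else 0) + k) (map_pmf fst (count_pmf \<beta> q n)))"
    by (simp add: map_bind_pmf if_distrib[of "map_pmf fst"] map_pmf_comp split_beta' bind_pmf_const
        cong: if_cong) (intro bind_pmf_cong, auto simp: map_pmf_comp)
  then show ?case
    using assms unfolding Suc by (simp add: binomial_pmf_Suc map_pmf_def)
qed (use assms in \<open>simp add: binomial_pmf_0\<close>)

text \<open>Take equal masses away from 0 and v; what remains, normalised, is the law
  \<open>q\<close> of the other steps.\<close>

lemma lazy_decomposition:
  assumes p: "0 \<in> set_pmf p" "v \<in> set_pmf p" "v \<noteq> (0 :: 'v :: ab_group_add)"
  obtains \<beta> q where "0 < \<beta>" "\<beta> \<le> 1"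
    "p = bind_pmf (bernoulli_pmf \<beta>) (\<lambda>b. if b then map_pmf (\<lambda>c. if c then v else 0) (bernoulli_pmf (1/2)) else q)"
proof -
  \<comment> \<open>Halved so that 2 \<alpha> \<le> 1/2: the remainder has positive mass even if
    \<open>p\<close> charges 0 and v only.\<close>
  define \<alpha> where "\<alpha> = min (pmf p 0) (pmf p v) / 2"
  have p0: "0 < pmf p 0" "0 < pmf p v" using p by (auto simp: pmf_positive)
  have "pmf p 0 + pmf p v = measure_pmf.prob p {0, v}"
    using p(3) by (subst measure_measure_pmf_finite) auto
  then have s: "pmf p 0 + pmf p v \<le> 1" by simp
  have \<alpha>: "0 < \<alpha>" "2 * \<alpha> \<le> 1 / 2" "\<alpha> \<le> pmf p 0" "\<alpha> \<le> pmf p v"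
    using p0 s by (auto simp: \<alpha>_def)
  define r where "r x = (if x = 0 \<or> x = v then \<alpha> else 0)" for x
  define h where "h x = (pmf p x - r x) / (1 - 2 * \<alpha>)" for x
  have h0: "0 \<le> h x" for x using \<alpha> by (auto simp: h_def r_def)
  have "(\<integral>\<^sup>+ x. ennreal (h x) \<partial>count_space UNIV) * ennreal (1 - 2 * \<alpha>) + ennreal (2 * \<alpha>) = 1"
  proof -
    have "(\<integral>\<^sup>+ x. ennreal (r x) \<partial>count_space UNIV) = (\<Sum>x\<in>{0, v}. ennreal (r x))"
      by (rule nn_integral_count_space'[of "{0, v}"]) (auto simp: r_def)
    then have r2: "(\<integral>\<^sup>+ x. ennreal (r x) \<partial>count_space UNIV) = ennreal (2 * \<alpha>)"
      using p(3) \<alpha> by (simp add: r_def mult_2[symmetric] ennreal_mult)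
    have "(\<integral>\<^sup>+ x. ennreal (h x) \<partial>count_space UNIV) * ennreal (1 - 2 * \<alpha>) + ennreal (2 * \<alpha>) =
        (\<integral>\<^sup>+ x. ennreal (h x) * ennreal (1 - 2 * \<alpha>) + ennreal (r x) \<partial>count_space UNIV)"
      by (simp add: nn_integral_add nn_integral_multc r2)
    also have "\<dots> = (\<integral>\<^sup>+ x. ennreal (pmf p x) \<partial>count_space UNIV)"
    proof (rule nn_integral_cong)
      fix x
      have "h x * (1 - 2 * \<alpha>) + r x = pmf p x" using \<alpha> by (simp add: h_def)
      moreover have "0 \<le> r x" using \<alpha> by (simp add: r_def)
      ultimately show "ennreal (h x) * ennreal (1 - 2 * \<alpha>) + ennreal (r x) = ennreal (pmf p x)"
        using h0[of x] \<alpha> by (simp add: ennreal_mult[symmetric] ennreal_plus[symmetric] del: ennreal_plus)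
    qed
    also have "\<dots> = 1" by (rule nn_integral_pmf_eq_1)
    finally show ?thesis .
  qed
  then have "(\<integral>\<^sup>+ x. ennreal (h x) \<partial>count_space UNIV) * ennreal (1 - 2 * \<alpha>) + ennreal (2 * \<alpha>) =
     1 * ennreal (1 - 2 * \<alpha>) + ennreal (2 * \<alpha>)"
    using \<alpha> by (simp add: ennreal_plus[symmetric] del: ennreal_plus)
  then have "(\<integral>\<^sup>+ x. ennreal (h x) \<partial>count_space UNIV) * ennreal (1 - 2 * \<alpha>) = 1 * ennreal (1 - 2 * \<alpha>)"
    by (simp add: ennreal_add_left_cancel add.commute[of _ "ennreal (2 * \<alpha>)"])
  then have h1: "(\<integral>\<^sup>+ x. ennreal (h x) \<partial>count_space UNIV) = 1"
    using \<alpha> ennreal_mult_cancel_left[of "ennreal (1 - 2 * \<alpha>)" "\<integral>\<^sup>+ x. ennreal (h x) \<partial>count_space UNIV" 1]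
    by (simp add: mult.commute)
  define q where "q = embed_pmf h"
  have q: "pmf q x = h x" for x unfolding q_def by (rule pmf_embed_pmf[OF h0 h1])
  show ?thesis
  proof (rule that[of "2 * \<alpha>" q])
    show "p = bind_pmf (bernoulli_pmf (2 * \<alpha>)) (\<lambda>b. if b then map_pmf (\<lambda>c. if c then v else 0) (bernoulli_pmf (1/2)) else q)"
      (is "_ = bind_pmf _ (\<lambda>b. if b then ?u else q)")
    proof (rule pmf_eqI)
      fix x
      have "ennreal (pmf ?u x) = ennreal (if x = 0 \<or> x = v then 1 / 2 else 0)"
        using p(3) unfolding ennreal_pmf_map
        by (auto simp: nn_integral_measure_pmf UNIV_bool nn_integral_count_space_finite indicator_def
            emeasure_pmf_single_eq_zero_iff measure_pmf.emeasure_eq_measure)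
      then have u: "pmf ?u x = (if x = 0 \<or> x = v then 1 / 2 else 0)"
        by (simp split: if_splits)
      have "pmf (bind_pmf (bernoulli_pmf (2 * \<alpha>)) (\<lambda>b. if b then ?u else q)) x = 2 * \<alpha> * pmf ?u x + (1 - 2 * \<alpha>) * pmf q x"
        using \<alpha> by (simp add: pmf_bind)
      also have "\<dots> = pmf p x" unfolding u q using \<alpha> by (simp add: h_def r_def)
      finally show "pmf p x = pmf (bind_pmf (bernoulli_pmf (2 * \<alpha>)) (\<lambda>b. if b then ?u else q)) x" ..
    qed
  qed (use \<alpha> in auto)
qed

text \<open>Steps commute, so the m fair choices can be collected. The number of them that equal v
  is binomial and independent of the sum of the other steps.\<close>

lemma walk_pmf_count_pmf:
  fixes v :: "int ^ 'd" and f :: "int ^ 'd \<Rightarrow> ennreal"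
  assumes \<beta>: "0 \<le> \<beta>" "\<beta> \<le> 1" and p:
    "p = bind_pmf (bernoulli_pmf \<beta>) (\<lambda>b. if b then map_pmf (\<lambda>c. if c then v else 0) (bernoulli_pmf (1/2)) else q)"
  shows "(\<integral>\<^sup>+ x. f x \<partial>walk_pmf p n) =
    (\<integral>\<^sup>+ (m, y). \<integral>\<^sup>+ k. f (y + int k *s v) \<partial>binomial_pmf m (1/2) \<partial>count_pmf \<beta> q n)"
proof (induction n arbitrary: f)
  case 0
  then show ?case by (simp add: binomial_pmf_0)
next
  case (Suc n)
  let ?I = "\<lambda>f (m, y). \<integral>\<^sup>+ k. f (y + int k *s v) \<partial>binomial_pmf m (1/2)"
  have bin: "(\<integral>\<^sup>+ k. g k \<partial>binomial_pmf (Suc m) (1/2)) =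
      ennreal (1/2) * (\<integral>\<^sup>+ k. g (Suc k) \<partial>binomial_pmf m (1/2)) + ennreal (1/2) * (\<integral>\<^sup>+ k. g k \<partial>binomial_pmf m (1/2))"
    for g :: "nat \<Rightarrow> ennreal" and m
    by (simp add: binomial_pmf_Suc nn_integral_bind_pmf mult.commute)
  have Ibin: "?I f (Suc m, y) = ennreal (1/2) * ?I (\<lambda>x. f (v + x)) (m, y) + ennreal (1/2) * ?I f (m, y)" for m y
    by (simp add: bin add.assoc add.left_commute vector_sadd_rdistrib)
  have "(\<integral>\<^sup>+ x. f x \<partial>walk_pmf p (Suc n)) = (\<integral>\<^sup>+ x. \<integral>\<^sup>+ y. f (x + y) \<partial>walk_pmf p n \<partial>p)"
    by (simp add: nn_integral_bind_pmf)
  also have "\<dots> = ennreal \<beta> * (ennreal (1/2) * (\<integral>\<^sup>+ y. f (v + y) \<partial>walk_pmf p n) + ennreal (1/2) * (\<integral>\<^sup>+ y. f y \<partial>walk_pmf p n)) +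
      ennreal (1 - \<beta>) * (\<integral>\<^sup>+ s. \<integral>\<^sup>+ y. f (s + y) \<partial>walk_pmf p n \<partial>q)"
    using \<beta> by (subst p) (simp add: nn_integral_bind_pmf mult.commute)
  also have "\<dots> = ennreal \<beta> * (ennreal (1/2) * (\<integral>\<^sup>+ z. ?I (\<lambda>y. f (v + y)) z \<partial>count_pmf \<beta> q n) + ennreal (1/2) * (\<integral>\<^sup>+ z. ?I f z \<partial>count_pmf \<beta> q n)) +
      ennreal (1 - \<beta>) * (\<integral>\<^sup>+ s. (\<integral>\<^sup>+ z. ?I (\<lambda>y. f (s + y)) z \<partial>count_pmf \<beta> q n) \<partial>q)"
    by (simp only: Suc)
  also have "ennreal (1/2) * (\<integral>\<^sup>+ z. ?I (\<lambda>y. f (v + y)) z \<partial>count_pmf \<beta> q n) + ennreal (1/2) * (\<integral>\<^sup>+ z. ?I f z \<partial>count_pmf \<beta> q n) =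
      (\<integral>\<^sup>+ z. ?I f (Suc (fst z), snd z) \<partial>count_pmf \<beta> q n)"
    unfolding Ibin by (simp add: nn_integral_add nn_integral_cmult split_beta')
  also have "ennreal \<beta> * (\<integral>\<^sup>+ z. ?I f (Suc (fst z), snd z) \<partial>count_pmf \<beta> q n) +
      ennreal (1 - \<beta>) * (\<integral>\<^sup>+ s. (\<integral>\<^sup>+ z. ?I (\<lambda>y. f (s + y)) z \<partial>count_pmf \<beta> q n) \<partial>q) =
      (\<integral>\<^sup>+ z. ?I f z \<partial>count_pmf \<beta> q (Suc n))"
    using \<beta> by (simp add: nn_integral_bind_pmf split_beta' add.assoc mult.commute)
  finally show ?case .
qed

text \<open>Bounding the binomial weights by their maximum replaces the average over n steps by a
  sum along the half-line in direction v, at the gain of a factor of order n^(-1/2). The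
  continuation \<open>r\<close> and the function \<open>g\<close> are arbitrary so that this can be
  iterated in several directions.\<close>

lemma walk_pmf_spread:
  fixes p :: "(int ^ 'd) pmf"
  assumes p: "0 \<in> set_pmf p" "v \<in> set_pmf p" "v \<noteq> 0"
  obtains b :: real where "0 < b"
    "\<And>n r C g y. (\<And>y. (\<integral>\<^sup>+ x. (\<integral>\<^sup>+ k. g (y + x + int k *s v) \<partial>count_space UNIV) \<partial>measure_pmf r) \<le> C) \<Longrightarrow>
      (\<integral>\<^sup>+ a. \<integral>\<^sup>+ x. g (y + a + x) \<partial>measure_pmf r \<partial>walk_pmf p n) \<le> ennreal (b / sqrt (real (n + 1))) * C"
proof -
  obtain \<beta> q where \<beta>: "0 < \<beta>" "\<beta> \<le> 1" and pq:
    "p = bind_pmf (bernoulli_pmf \<beta>) (\<lambda>b. if b then map_pmf (\<lambda>c. if c then v else 0) (bernoulli_pmf (1/2)) else q)"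
    using lazy_decomposition[OF p] .
  show ?thesis
  proof (rule that[of "1 / sqrt \<beta>"])
    fix n r C g y
    assume C: "\<And>y. (\<integral>\<^sup>+ x. (\<integral>\<^sup>+ k. g (y + x + int k *s v) \<partial>count_space UNIV) \<partial>measure_pmf r) \<le> C"
    let ?f = "\<lambda>a. \<integral>\<^sup>+ x. g (y + a + x) \<partial>measure_pmf r"
    have bd: "(\<integral>\<^sup>+ k. ?f (z + int k *s v) \<partial>binomial_pmf m (1/2)) \<le> ennreal (1 / sqrt (real (m + 1))) * C" for m z
    proof -
      have "(\<integral>\<^sup>+ k. ?f (z + int k *s v) \<partial>binomial_pmf m (1/2)) =
          (\<integral>\<^sup>+ k. ennreal (pmf (binomial_pmf m (1/2)) k) * ?f (z + int k *s v) \<partial>count_space UNIV)"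
        by (rule nn_integral_measure_pmf)
      also have "\<dots> \<le> (\<integral>\<^sup>+ k. ennreal (1 / sqrt (real (m + 1))) * ?f (z + int k *s v) \<partial>count_space UNIV)"
      proof (intro nn_integral_mono mult_right_mono ennreal_leI)
        fix k
        have "pmf (binomial_pmf m (1/2)) k = real (m choose k) / 2 ^ m \<or> pmf (binomial_pmf m (1/2)) k = 0"
        proof (cases "k \<le> m")
          case True
          have eq: "(1 / 2) ^ k * (1 / 2) ^ (m - k) = (1 / 2 :: real) ^ m"
            using True by (simp only: power_add[symmetric] le_add_diff_inverse)
          have "pmf (binomial_pmf m (1/2)) k = real (m choose k) * ((1/2) ^ k * (1/2) ^ (m - k))"
            by simp
          then show ?thesis unfolding eq by (simp add: power_one_over)
        qed (simp add: binomial_eq_0)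
        then show "pmf (binomial_pmf m (1/2)) k \<le> 1 / sqrt (real (m + 1))"
        proof (elim disjE)
          assume eq: "pmf (binomial_pmf m (1/2)) k = real (m choose k) / 2 ^ m"
          show ?thesis unfolding eq by (rule binomial_half_le)
        next
          assume eq: "pmf (binomial_pmf m (1/2)) k = 0"
          show ?thesis unfolding eq by simp
        qed
      qed auto
      also have "\<dots> = ennreal (1 / sqrt (real (m + 1))) * (\<integral>\<^sup>+ k. ?f (z + int k *s v) \<partial>count_space UNIV)"
        by (rule nn_integral_cmult) simp
      also have "(\<integral>\<^sup>+ k. ?f (z + int k *s v) \<partial>count_space UNIV) =
          (\<integral>\<^sup>+ x. (\<integral>\<^sup>+ k. g (y + (z + int k *s v) + x) \<partial>count_space UNIV) \<partial>measure_pmf r)"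
        by (simp add: nn_integral_count_space_nat nn_integral_suminf)
      also have "\<dots> = (\<integral>\<^sup>+ x. (\<integral>\<^sup>+ k. g ((y + z) + x + int k *s v) \<partial>count_space UNIV) \<partial>measure_pmf r)"
        by (simp add: ac_simps)
      also have "\<dots> \<le> C" by (rule C)
      finally show ?thesis by (simp add: mult_left_mono)
    qed
    have "(\<integral>\<^sup>+ a. ?f a \<partial>walk_pmf p n) =
        (\<integral>\<^sup>+ (m, z). \<integral>\<^sup>+ k. ?f (z + int k *s v) \<partial>binomial_pmf m (1/2) \<partial>count_pmf \<beta> q n)"
      by (rule walk_pmf_count_pmf[OF _ _ pq]) (use \<beta> in auto)
    also have "\<dots> \<le> (\<integral>\<^sup>+ z. ennreal (1 / sqrt (real (fst z + 1))) * C \<partial>count_pmf \<beta> q n)"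
      by (rule nn_integral_mono, unfold split_beta, rule bd)
    also have "\<dots> = (\<integral>\<^sup>+ m. ennreal (1 / sqrt (real (m + 1))) \<partial>map_pmf fst (count_pmf \<beta> q n)) * C"
      by (simp add: nn_integral_multc)
    also have "map_pmf fst (count_pmf \<beta> q n) = binomial_pmf n \<beta>"
      by (rule map_fst_count_pmf) (use \<beta> in auto)
    also have "(\<integral>\<^sup>+ m. ennreal (1 / sqrt (real (m + 1))) \<partial>binomial_pmf n \<beta>) * C \<le> ennreal (1 / sqrt (\<beta> * real (n + 1))) * C"
      by (intro mult_right_mono binomial_pmf_inverse_sqrt_Suc \<beta>) auto
    also have "1 / sqrt (\<beta> * real (n + 1)) = 1 / sqrt \<beta> / sqrt (real (n + 1))"
      by (simp add: real_sqrt_mult)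
    finally show "(\<integral>\<^sup>+ a. ?f a \<partial>walk_pmf p n) \<le> ennreal (1 / sqrt \<beta> / sqrt (real (n + 1))) * C" .
  qed (use \<beta> in auto)
qed


text \<open>Three consecutive stretches of n steps are spread in the three directions in turn, which
  gives a bound of order n^(-3/2) uniformly in the end point.\<close>

lemma walk_pmf_summable:
  fixes p :: "(int ^ 'd) pmf"
  assumes p: "0 \<in> set_pmf p" "v1 \<in> set_pmf p" "v2 \<in> set_pmf p" "v3 \<in> set_pmf p"
    and indep: "\<And>a b c :: int. a *s v1 + b *s v2 + c *s v3 = 0 \<Longrightarrow> a = 0 \<and> b = 0 \<and> c = 0"
  shows "summable (\<lambda>n. pmf (walk_pmf p n) z)"
proof -
  have nz: "v1 \<noteq> 0" "v2 \<noteq> 0" "v3 \<noteq> 0"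
    using indep[of 1 0 0] indep[of 0 1 0] indep[of 0 0 1] by auto
  obtain b1 :: real where b1: "0 < b1"
    "\<And>n r C g y. (\<And>y. (\<integral>\<^sup>+ x. (\<integral>\<^sup>+ k. g (y + x + int k *s v1) \<partial>count_space UNIV) \<partial>measure_pmf r) \<le> C) \<Longrightarrow>
      (\<integral>\<^sup>+ a. \<integral>\<^sup>+ x. g (y + a + x) \<partial>measure_pmf r \<partial>walk_pmf p n) \<le> ennreal (b1 / sqrt (real (n + 1))) * C"
    by (rule walk_pmf_spread[OF p(1,2) nz(1)]) blast
  obtain b2 :: real where b2: "0 < b2"
    "\<And>n r C g y. (\<And>y. (\<integral>\<^sup>+ x. (\<integral>\<^sup>+ k. g (y + x + int k *s v2) \<partial>count_space UNIV) \<partial>measure_pmf r) \<le> C) \<Longrightarrow>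
      (\<integral>\<^sup>+ a. \<integral>\<^sup>+ x. g (y + a + x) \<partial>measure_pmf r \<partial>walk_pmf p n) \<le> ennreal (b2 / sqrt (real (n + 1))) * C"
    by (rule walk_pmf_spread[OF p(1,3) nz(2)]) blast
  obtain b3 :: real where b3: "0 < b3"
    "\<And>n r C g y. (\<And>y. (\<integral>\<^sup>+ x. (\<integral>\<^sup>+ k. g (y + x + int k *s v3) \<partial>count_space UNIV) \<partial>measure_pmf r) \<le> C) \<Longrightarrow>
      (\<integral>\<^sup>+ a. \<integral>\<^sup>+ x. g (y + a + x) \<partial>measure_pmf r \<partial>walk_pmf p n) \<le> ennreal (b3 / sqrt (real (n + 1))) * C"
    by (rule walk_pmf_spread[OF p(1,4) nz(3)]) blast
  define g0 :: "int ^ 'd \<Rightarrow> ennreal" where "g0 = indicator {0}"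
  define g1 where "g1 w = (\<integral>\<^sup>+ k. g0 (w + int k *s v1) \<partial>count_space UNIV)" for w
  define g2 where "g2 w = (\<integral>\<^sup>+ k. g1 (w + int k *s v2) \<partial>count_space UNIV)" for w
  \<comment> \<open>The threefold sum counts the triples that lead from w to 0; by independence
    there is at most one.\<close>
  have g3: "(\<integral>\<^sup>+ k. g2 (w + int k *s v3) \<partial>count_space UNIV) \<le> 1" for w
  proof -
    let ?w = "\<lambda>(a, b, c). w + int a *s v3 + int b *s v2 + int c *s v1"
    have inj: "t = t'" if "?w t = 0" "?w t' = 0" for t t'
    proof -
      obtain a b c a' b' c' where t: "t = (a, b, c)" "t' = (a', b', c')" by (cases t, cases t')
      have "(int c - int c') *s v1 + (int b - int b') *s v2 + (int a - int a') *s v3 = ?w t - ?w t'"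
        by (simp add: t algebra_simps vector_sub_rdistrib)
      also have "\<dots> = 0" using that by simp
      finally show ?thesis using indep t by fastforce
    qed
    have inner: "(\<integral>\<^sup>+ b. \<integral>\<^sup>+ c. g0 (w + int a *s v3 + int b *s v2 + int c *s v1) \<partial>count_space UNIV \<partial>count_space UNIV) =
        (\<integral>\<^sup>+ t. g0 (?w (a, t)) \<partial>count_space UNIV)" for a
      using nn_integral_fst_count_space[of "\<lambda>t. g0 (?w (a, t))"] by simp
    have "(\<integral>\<^sup>+ k. g2 (w + int k *s v3) \<partial>count_space UNIV) = (\<integral>\<^sup>+ t. g0 (?w t) \<partial>count_space UNIV)"
      unfolding g2_def g1_def inner
      using nn_integral_fst_count_space[of "\<lambda>t. g0 (?w t)"] by simp
    also have "\<dots> = (\<integral>\<^sup>+ t. indicator {t. ?w t = 0} t \<partial>count_space UNIV)"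
      by (intro nn_integral_cong) (auto simp: g0_def indicator_def)
    also have "\<dots> = emeasure (count_space UNIV) {t. ?w t = 0}" by simp
    also have "\<dots> \<le> 1"
    proof (cases "{t. ?w t = 0} = {}")
      case False
      then obtain t where "?w t = 0" by blast
      then have "{t. ?w t = 0} = {t}" using inj by blast
      then show ?thesis by simp
    next
      case True
      show ?thesis unfolding True by simp
    qed
    finally show ?thesis .
  qed
  define K where "K n = ennreal (b1 / sqrt (real (n + 1))) * (ennreal (b2 / sqrt (real (n + 1))) * ennreal (b3 / sqrt (real (n + 1))))" for n
  \<comment> \<open>The last stretch has no continuation, hence the point mass at 0.\<close>
  have s3: "(\<integral>\<^sup>+ x. g2 (y + x) \<partial>walk_pmf p n) \<le> ennreal (b3 / sqrt (real (n + 1)))" for y n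
    using b3(2)[where g = g2 and r = "return_pmf 0" and C = 1 and y = y and n = n] g3 by simp
  have s2: "(\<integral>\<^sup>+ x. g1 (y + x) \<partial>walk_pmf p (n + n)) \<le> ennreal (b2 / sqrt (real (n + 1))) * ennreal (b3 / sqrt (real (n + 1)))" for y n
  proof -
    have "(\<integral>\<^sup>+ a. \<integral>\<^sup>+ x. g1 (y + a + x) \<partial>walk_pmf p n \<partial>walk_pmf p n) \<le>
        ennreal (b2 / sqrt (real (n + 1))) * ennreal (b3 / sqrt (real (n + 1)))"
      by (rule b2(2), unfold g2_def[symmetric], rule s3)
    then show ?thesis
      by (simp add: walk_pmf_add nn_integral_bind_pmf add.assoc)
  qed
  have s1: "(\<integral>\<^sup>+ x. g0 (y + x) \<partial>walk_pmf p (n + (n + n))) \<le> K n" for y n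
  proof -
    have "(\<integral>\<^sup>+ a. \<integral>\<^sup>+ x. g0 (y + a + x) \<partial>walk_pmf p (n + n) \<partial>walk_pmf p n) \<le> K n"
      unfolding K_def by (rule b1(2), unfold g1_def[symmetric], rule s2)
    then show ?thesis
      by (simp add: walk_pmf_add[of p n "n + n"] nn_integral_bind_pmf add.assoc)
  qed
  \<comment> \<open>The r steps left over by division by 3 only average a bound that is uniform in
    the starting point.\<close>
  have s0: "(\<integral>\<^sup>+ x. g0 (y + x) \<partial>walk_pmf p (r + (n + (n + n)))) \<le> K n" for y n r
  proof -
    have "(\<integral>\<^sup>+ x. g0 (y + x) \<partial>walk_pmf p (r + (n + (n + n)))) =
        (\<integral>\<^sup>+ a. \<integral>\<^sup>+ x. g0 ((y + a) + x) \<partial>walk_pmf p (n + (n + n)) \<partial>walk_pmf p r)"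
      by (simp add: walk_pmf_add[of p r "n + (n + n)"] nn_integral_bind_pmf add.assoc)
    also have "\<dots> \<le> (\<integral>\<^sup>+ a. K n \<partial>walk_pmf p r)"
      by (intro nn_integral_mono s1)
    finally show ?thesis by (simp add: measure_pmf.emeasure_space_1)
  qed
  define B where "B = b1 * b2 * b3"
  have B: "0 < B" using b1(1) b2(1) b3(1) by (simp add: B_def)
  have K: "K n = ennreal (B / (sqrt (real (n + 1)) * (sqrt (real (n + 1)) * sqrt (real (n + 1)))))" for n
    using b1(1) b2(1) b3(1) by (simp add: K_def B_def ennreal_mult[symmetric])
  have bound: "pmf (walk_pmf p m) z \<le> B * (3 powr (3/2) * real (Suc m) powr (-3/2))" for m
  proof -
    define n where "n = m div 3"
    define r where "r = m mod 3"
    have m: "m = r + (n + (n + n))" "r < 3" unfolding n_def r_def by presburger+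
    have "(\<integral>\<^sup>+ x. g0 (- z + x) \<partial>walk_pmf p m) = (\<integral>\<^sup>+ x. indicator {z} x \<partial>walk_pmf p m)"
      by (intro nn_integral_cong) (auto simp: g0_def indicator_def)
    then have "ennreal (pmf (walk_pmf p m) z) = (\<integral>\<^sup>+ x. g0 (- z + x) \<partial>walk_pmf p m)"
      by (simp add: emeasure_pmf_single)
    also have "\<dots> \<le> K n" unfolding m(1) by (rule s0)
    finally have le: "pmf (walk_pmf p m) z \<le> B / (sqrt (real (n + 1)) * (sqrt (real (n + 1)) * sqrt (real (n + 1))))"
      unfolding K by (subst (asm) ennreal_le_iff) (use B in auto)
    have q: "sqrt x * (sqrt x * sqrt x) = x powr (3/2)" if "0 < x" for x :: real
    proof -
      have h: "sqrt x = x powr (1/2)" using that by (simp add: powr_half_sqrt)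
      show ?thesis unfolding h by (simp only: powr_add[symmetric]) simp
    qed
    \<comment> \<open>From m = r + 3n with r \<le> 2 follows m + 1 \<le> 3 (n + 1).\<close>
    have "(real (Suc m) / 3) powr (3/2) \<le> real (n + 1) powr (3/2)"
      using m by (intro powr_mono2) auto
    then have "B / real (n + 1) powr (3/2) \<le> B / (real (Suc m) / 3) powr (3/2)"
      using B by (intro divide_left_mono) auto
    also have "\<dots> = B * (3 powr (3/2) * real (Suc m) powr (-3/2))"
      by (simp add: powr_divide powr_minus_divide)
    finally show ?thesis using le q[of "real (n + 1)"] by simp
  qed
  have "summable (\<lambda>m. real m powr (-3/2))" by (subst summable_real_powr_iff) simp
  then have "summable (\<lambda>m. real (Suc m) powr (-3/2))" by (subst summable_Suc_iff)
  then have "summable (\<lambda>m. B * (3 powr (3/2) * real (Suc m) powr (-3/2)))"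
    by (intro summable_mult)
  then show ?thesis
    by (rule summable_comparison_test'[where N = 0]) (use bound in auto)
qed

section \<open>From the law of the walk to almost sure transience\<close>

context group_walk
begin

text \<open>The image of the walk under a homomorphism to an abelian group. With
  \<open>f = snd\<close> it is the position on the lattice.\<close>

definition hom_walk :: "('a \<Rightarrow> 'v::ab_group_add) \<Rightarrow> (nat \<Rightarrow> 'a) \<Rightarrow> nat \<Rightarrow> 'v" where
  "hom_walk f \<omega> n = (\<Sum>i<n. f (\<omega> i))"

lemma hom_walk_incs: "hom_walk f \<omega> n = sum_list (map f (incs n \<omega>))"
  by (simp add: hom_walk_def incs_def interv_sum_list_conv_sum_set_nat atLeast0LessThan o_def)

lemma discrete_rv_hom_walk: "P.discrete_rv (\<lambda>\<omega>. hom_walk f \<omega> n)"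
  using P.discrete_rv_compose[OF discrete_rv_incs, of "\<lambda>l. sum_list (map f l)" n]
  by (simp add: hom_walk_incs)

lemma hom_walk_add: "hom_walk f \<omega> (t + n) = hom_walk f \<omega> t + hom_walk f (shift_by t \<omega>) n"
  by (induction n) (simp_all add: hom_walk_def shift_by_def add.assoc add.commute)

lemma nn_integral_increment: "(\<integral>\<^sup>+ \<omega>. h (\<omega> i) \<partial>S) = (\<integral>\<^sup>+ x. h x \<partial>\<mu>)"
  unfolding P.nn_integral_discrete[OF discrete_rv_increment] prob_increment
  by (simp add: nn_integral_measure_pmf mult.commute)

lemma nn_integral_hom_walk:
  "(\<integral>\<^sup>+ \<omega>. h (hom_walk f \<omega> n) \<partial>S) = (\<integral>\<^sup>+ x. h x \<partial>walk_pmf (map_pmf f \<mu>) n)"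
proof (induction n arbitrary: h)
  case 0
  then show ?case by (simp add: hom_walk_def P.emeasure_space_1)
next
  case (Suc n)
  have m: "(\<lambda>\<omega>. h (hom_walk f \<omega> (Suc n))) \<in> borel_measurable S"
    by (rule P.borel_measurable_discrete[OF discrete_rv_hom_walk])
  have "(\<integral>\<^sup>+ \<omega>. h (hom_walk f \<omega> (Suc n)) \<partial>S) =
      (\<integral>\<^sup>+ \<omega>. \<integral>\<^sup>+ \<omega>'. h (hom_walk f (comb_seq 1 \<omega> \<omega>') (1 + n)) \<partial>S \<partial>S)"
    by (simp add: nn_integral_split[OF m, of 1])
  also have "\<dots> = (\<integral>\<^sup>+ \<omega>. \<integral>\<^sup>+ \<omega>'. h (f (\<omega> 0) + hom_walk f \<omega>' n) \<partial>S \<partial>S)"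
    unfolding hom_walk_add shift_comb_seq by (simp add: hom_walk_def comb_seq_def)
  also have "\<dots> = (\<integral>\<^sup>+ \<omega>. (\<lambda>a. \<integral>\<^sup>+ x. h (f a + x) \<partial>walk_pmf (map_pmf f \<mu>) n) (\<omega> 0) \<partial>S)"
    using Suc[of "\<lambda>x. h (f _ + x)"] by simp
  also have "\<dots> = (\<integral>\<^sup>+ a. \<integral>\<^sup>+ x. h (f a + x) \<partial>walk_pmf (map_pmf f \<mu>) n \<partial>\<mu>)"
    by (rule nn_integral_increment)
  finally show ?case by (simp add: nn_integral_bind_pmf)
qed

lemma prob_hom_walk: "P.prob {\<omega> \<in> space S. hom_walk f \<omega> n = z} = pmf (walk_pmf (map_pmf f \<mu>) n) z"
proof -
  have A: "{\<omega> \<in> space S. hom_walk f \<omega> n = z} \<in> sets S" by (rule P.cell_sets[OF discrete_rv_hom_walk])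
  have "ennreal (P.prob {\<omega> \<in> space S. hom_walk f \<omega> n = z}) =
      (\<integral>\<^sup>+ \<omega>. indicator {\<omega> \<in> space S. hom_walk f \<omega> n = z} \<omega> \<partial>S)"
    using A by (simp add: P.emeasure_eq_measure)
  also have "\<dots> = (\<integral>\<^sup>+ \<omega>. indicator {z} (hom_walk f \<omega> n) \<partial>S)"
    by (intro nn_integral_cong) (auto simp: indicator_def)
  also have "\<dots> = ennreal (pmf (walk_pmf (map_pmf f \<mu>) n) z)"
    by (simp add: nn_integral_hom_walk emeasure_pmf_single)
  finally show ?thesis by simp
qed

text \<open>The Borel-Cantelli lemma at each of the countably many sites.\<close>

lemma AE_hom_walk_transient:
  fixes f :: "'a \<Rightarrow> 'v::ab_group_add"
  assumes "countable (UNIV :: 'v set)" and "\<And>z. summable (\<lambda>n. pmf (walk_pmf (map_pmf f \<mu>) n) z)"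
  shows "AE \<omega> in S. \<forall>z. eventually (\<lambda>n. hom_walk f \<omega> n \<noteq> z) sequentially"
proof -
  have "AE \<omega> in S. eventually (\<lambda>n. hom_walk f \<omega> n \<noteq> z) sequentially" for z
  proof -
    have "AE \<omega> in S. eventually (\<lambda>n. \<omega> \<in> space S - {\<omega> \<in> space S. hom_walk f \<omega> n = z}) sequentially"
    proof (rule borel_cantelli_AE1)
      show "{\<omega> \<in> space S. hom_walk f \<omega> n = z} \<in> sets S" for n by (rule P.cell_sets[OF discrete_rv_hom_walk])
    qed (use assms(2) in \<open>auto simp: prob_hom_walk less_top[symmetric]\<close>)
    then show ?thesis by eventually_elim (auto elim: eventually_mono)
  qed
  then show ?thesis
    using AE_ball_countable[OF assms(1), of "\<lambda>\<omega> z. eventually (\<lambda>n. hom_walk f \<omega> n \<noteq> z) sequentially"] by simp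
qed

lemma hom_walk_visit_sets:
  assumes "finite (B :: 'v :: ab_group_add set)"
  shows "{\<omega> \<in> space S. \<exists>l\<ge>m. hom_walk f \<omega> l \<in> B} \<in> sets S"
proof -
  have "{\<omega> \<in> space S. \<exists>l\<ge>m. hom_walk f \<omega> l \<in> B} = (\<Union>l\<in>{m..}. \<Union>z\<in>B. {\<omega> \<in> space S. hom_walk f \<omega> l = z})"
    by auto
  also have "\<dots> \<in> sets S"
    using assms by (intro sets.countable_UN' sets.finite_UN) (auto intro: P.cell_sets[OF discrete_rv_hom_walk])
  finally show ?thesis .
qed

text \<open>The events decrease in m, and transience makes their intersection null. This is the
  quantitative form in which transience makes late revisits of blocks rare.\<close>

lemma hom_walk_escape:
  fixes f :: "'a \<Rightarrow> 'v::ab_group_add"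
  assumes tr: "AE \<omega> in S. \<forall>z. eventually (\<lambda>n. hom_walk f \<omega> n \<noteq> z) sequentially" and B: "finite B"
  shows "(\<lambda>m. P.prob {\<omega> \<in> space S. \<exists>l\<ge>m. hom_walk f \<omega> l \<in> B}) \<longlonglongrightarrow> 0"
proof -
  let ?A = "\<lambda>m. {\<omega> \<in> space S. \<exists>l\<ge>m. hom_walk f \<omega> l \<in> B}"
  have "(\<lambda>m. P.prob (?A m)) \<longlonglongrightarrow> P.prob (\<Inter>m. ?A m)"
  proof (rule P.finite_Lim_measure_decseq)
    show "range ?A \<subseteq> sets S" using hom_walk_visit_sets[OF B] by blast
    show "decseq ?A" by (auto simp: decseq_def intro: order_trans)
  qed
  moreover have "P.prob (\<Inter>m. ?A m) = 0"
  proof -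
    have "AE \<omega> in S. \<omega> \<notin> (\<Inter>m. ?A m)"
      using tr
    proof eventually_elim
      case (elim \<omega>)
      then have "eventually (\<lambda>n. \<forall>z\<in>B. hom_walk f \<omega> n \<noteq> z) sequentially"
        using B by (intro eventually_ball_finite) auto
      then show ?case by (auto simp: eventually_sequentially)
    qed
    moreover have "(\<Inter>m. ?A m) \<in> sets S"
    proof (rule sets.countable_INT'[OF countableI_type UNIV_not_empty], rule image_subsetI)
      show "?A m \<in> sets S" for m by (rule hom_walk_visit_sets[OF B])
    qed
    ultimately show ?thesis by (simp only: P.prob_eq_0)
  qed
  ultimately show ?thesis by simp
qed

end

section \<open>Random walks on lamplighter groups\<close>

lemma int_lattice_simps [simp]:
  "carrier int_lattice = UNIV" "x \<otimes>\<^bsub>int_lattice\<^esub> y = x + y" "\<one>\<^bsub>int_lattice\<^esub> = 0"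
  by (simp_all add: int_lattice_def)

lemma inv_int_lattice [simp]: "inv\<^bsub>int_lattice\<^esub> x = - x"
  by (rule group.inv_equality[OF group_int_lattice]) auto

lemma mult_wreath [simp]:
  "(\<Phi>, x) \<otimes>\<^bsub>wreath_product L int_lattice\<^esub> (\<Psi>, y) = (\<lambda>z. \<Phi> z \<otimes>\<^bsub>L\<^esub> \<Psi> (z - x), x + y)"
  by (simp add: wreath_product_def mult_config_def translate_config_def restrict_def)

lemma fst_mult_wreath: "fst (g \<otimes>\<^bsub>wreath_product L int_lattice\<^esub> h) z = fst g z \<otimes>\<^bsub>L\<^esub> fst h (z - snd g)"
  and snd_mult_wreath: "snd (g \<otimes>\<^bsub>wreath_product L int_lattice\<^esub> h) = snd g + snd h"
  by (cases g; cases h; simp)+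

lemma one_wreath: "\<one>\<^bsub>wreath_product L int_lattice\<^esub> = (\<lambda>_. \<one>\<^bsub>L\<^esub>, 0)"
  by (simp add: wreath_product_def id_config_def restrict_def)

lemma carrier_wreath:
  "(\<Phi>, x) \<in> carrier (wreath_product L int_lattice) \<longleftrightarrow>
    (\<forall>z. \<Phi> z \<in> carrier L) \<and> finite {z. \<Phi> z \<noteq> \<one>\<^bsub>L\<^esub>}"
  by (auto simp: wreath_product_def lamp_configs_def)

lemma id_config_int_lattice: "id_config L int_lattice = (\<lambda>_. \<one>\<^bsub>L\<^esub>)"
  by (simp add: id_config_def restrict_def)

lemma delta_config_int_lattice: "delta_config L int_lattice s = (\<lambda>z. if z = 0 then s else \<one>\<^bsub>L\<^esub>)"
  by (simp add: delta_config_def restrict_def)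

text \<open>A configuration is coded by the graph of its restriction to its support, a finite set of
  pairs.\<close>

lemma countable_carrier_wreath:
  assumes "countable (carrier L)"
  shows "countable (carrier (wreath_product L (int_lattice :: (int ^ 'd) monoid)))"
proof -
  let ?C = "carrier (wreath_product L (int_lattice :: (int ^ 'd) monoid))"
  let ?f = "\<lambda>(\<Phi> :: int ^ 'd \<Rightarrow> 'a, x :: int ^ 'd). ({(z, \<Phi> z) | z. \<Phi> z \<noteq> \<one>\<^bsub>L\<^esub>}, x)"
  let ?T = "{A. finite A \<and> A \<subseteq> (UNIV :: (int ^ 'd) set) \<times> carrier L} \<times> (UNIV :: (int ^ 'd) set)"
  have "countable ?T"
    using assms by (intro countable_SIGMA countable_Collect_finite_subset) auto
  moreover have "?f ` ?C \<subseteq> ?T"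
  proof
    fix t assume "t \<in> ?f ` ?C"
    then obtain \<Phi> x where t: "t = ({(z, \<Phi> z) | z. \<Phi> z \<noteq> \<one>\<^bsub>L\<^esub>}, x)" and c: "(\<Phi>, x) \<in> ?C" by auto
    have "{(z, \<Phi> z) | z. \<Phi> z \<noteq> \<one>\<^bsub>L\<^esub>} = (\<lambda>z. (z, \<Phi> z)) ` {z. \<Phi> z \<noteq> \<one>\<^bsub>L\<^esub>}" by auto
    then show "t \<in> ?T" using c by (auto simp: t carrier_wreath)
  qed
  ultimately have "countable (?f ` ?C)" by (rule countable_subset[rotated])
  moreover have "inj_on ?f ?C"
  proof (rule inj_onI)
    fix g h assume eq: "?f g = ?f h"
    obtain \<Phi> x \<Psi> y where gh: "g = (\<Phi>, x)" "h = (\<Psi>, y)" by (cases g, cases h)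
    have S: "{(z, \<Phi> z) | z. \<Phi> z \<noteq> \<one>\<^bsub>L\<^esub>} = {(z, \<Psi> z) | z. \<Psi> z \<noteq> \<one>\<^bsub>L\<^esub>}" and xy: "x = y"
      using eq by (simp_all add: gh)
    have "\<Phi> z = \<Psi> z" for z
    proof (cases "\<Phi> z = \<one>\<^bsub>L\<^esub>")
      case True
      then have "(z, \<Psi> z) \<notin> {(z, \<Phi> z) | z. \<Phi> z \<noteq> \<one>\<^bsub>L\<^esub>}" by auto
      then show ?thesis unfolding S using True by auto
    next
      case False
      then have "(z, \<Phi> z) \<in> {(z, \<Phi> z) | z. \<Phi> z \<noteq> \<one>\<^bsub>L\<^esub>}" by auto
      then show ?thesis unfolding S by auto
    qed
    then show "g = h" using xy by (auto simp: gh)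
  qed
  ultimately show ?thesis by (rule countable_image_inj_on)
qed

text \<open>Countably many lists occur, and agreement with one list is a finite conjunction of
  component events.\<close>

lemma map_list_measurable:
  assumes C: "countable C" and X: "\<And>z. X z \<in> M \<rightarrow>\<^sub>M count_space C"
  shows "(\<lambda>w. map (\<lambda>z. X z w) zs) \<in> M \<rightarrow>\<^sub>M count_space UNIV"
    "countable ((\<lambda>w. map (\<lambda>z. X z w) zs) ` space M)"
proof -
  let ?W = "\<lambda>w. map (\<lambda>z. X z w) zs"
  have XC: "X z w \<in> C" if "w \<in> space M" for z w using measurable_space[OF X that] by simp
  show c: "countable (?W ` space M)"
    by (rule countable_subset[of _ "lists C"]) (use XC C in auto)
  have s: "{w \<in> space M. ?W w = l} \<in> sets M" for l
  proof -
    have "{w \<in> space M. ?W w = l} =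
       {w \<in> space M. length zs = length l \<and> (\<forall>i. i < length zs \<longrightarrow> X (zs ! i) w = l ! i)}"
      by (auto simp: list_eq_iff_nth_eq)
    also have "\<dots> \<in> sets M"
    proof (intro sets.sets_Collect_conj sets.sets_Collect_countable_All sets.sets_Collect_imp sets.sets_Collect_const)
      fix i
      have "{w \<in> space M. X (zs ! i) w = l ! i} = X (zs ! i) -` ({l ! i} \<inter> C) \<inter> space M"
        using XC by auto
      then show "{w \<in> space M. X (zs ! i) w = l ! i} \<in> sets M"
        using measurable_sets[OF X, of "{l ! i} \<inter> C" "zs ! i"] by simp
    qed
    finally show ?thesis .
  qed
  show "?W \<in> M \<rightarrow>\<^sub>M count_space UNIV"
  proof (rule measurableI)
    fix A
    have "?W -` A \<inter> space M = (\<Union>l\<in>A \<inter> ?W ` space M. {w \<in> space M. ?W w = l})"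
      by auto
    also have "\<dots> \<in> sets M"
      by (rule sets.countable_UN'') (use c s in auto)
    finally show "?W -` A \<inter> space M \<in> sets M" .
  qed simp
qed

locale lamplighter = L: group L for L :: "('l, 'm) monoid_scheme" +
  fixes \<mu> :: "((int ^ 'd \<Rightarrow> 'l) \<times> (int ^ 'd)) pmf"
  assumes countable_L: "countable (carrier L)"
    and set_pmf_carrier: "set_pmf \<mu> \<subseteq> carrier (wreath_product L int_lattice)"
    and elementary: "set_pmf \<mu> \<subseteq> {(delta_config L int_lattice s, 0) | s. s \<in> carrier L} \<union>
      {(id_config L int_lattice, x) | x. True}"

sublocale lamplighter \<subseteq> group_walk "wreath_product L int_lattice" \<mu>
proof -
  interpret W: group "wreath_product L (int_lattice :: (int ^ 'd) monoid)"
    by (rule group_wreath_product[OF L.is_group group_int_lattice])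
  show "group_walk (wreath_product L (int_lattice :: (int ^ 'd) monoid)) \<mu>"
    by unfold_locales (use countable_carrier_wreath[OF countable_L] set_pmf_carrier in auto)
qed

context lamplighter
begin

abbreviation G :: "((int ^ 'd \<Rightarrow> 'l) \<times> (int ^ 'd)) monoid" where
  "G \<equiv> wreath_product L int_lattice"

abbreviation lim_lamps :: "(nat \<Rightarrow> (int ^ 'd \<Rightarrow> 'l) \<times> (int ^ 'd)) \<Rightarrow> int ^ 'd \<Rightarrow> 'l" where
  "lim_lamps \<equiv> limit_lamps L int_lattice"

abbreviation converges :: "(nat \<Rightarrow> (int ^ 'd \<Rightarrow> 'l) \<times> (int ^ 'd)) \<Rightarrow> bool" where
  "converges \<equiv> lamps_converge L int_lattice"

section \<open>Limiting lamps as invariant, equivariant functions of the path\<close>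

lemma converges_iff:
  "converges w \<longleftrightarrow> (\<forall>z. \<exists>l\<in>carrier L. \<forall>\<^sub>F n in sequentially. fst (w n) z = l)"
  by (simp add: lamps_converge_def)

lemma lim_lamps_eq:
  assumes "converges w" "\<forall>\<^sub>F n in sequentially. fst (w n) z = l"
  shows "lim_lamps w z = l"
proof -
  have "(THE l. \<forall>\<^sub>F n in sequentially. fst (w n) z = l) = l"
  proof (rule the_equality)
    show "\<forall>\<^sub>F n in sequentially. fst (w n) z = l" by (rule assms(2))
    fix l' assume "\<forall>\<^sub>F n in sequentially. fst (w n) z = l'"
    with assms(2) have "\<forall>\<^sub>F n::nat in sequentially. l' = l" by eventually_elim simp
    then show "l' = l" by simp
  qed
  then show ?thesis using assms(1) by (simp add: limit_lamps_def)
qed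

lemma lim_lamps_not_converges: "\<not> converges w \<Longrightarrow> lim_lamps w = (\<lambda>_. \<one>\<^bsub>L\<^esub>)"
  by (simp add: limit_lamps_def id_config_int_lattice)

lemma lim_lamps_closed: "lim_lamps w z \<in> carrier L"
proof (cases "converges w")
  case True
  then obtain l where "l \<in> carrier L" "\<forall>\<^sub>F n in sequentially. fst (w n) z = l"
    by (auto simp: converges_iff)
  then show ?thesis using lim_lamps_eq[OF True] by blast
qed (simp add: lim_lamps_not_converges)

text \<open>Removes \<open>THE\<close> and the default value together; shift invariance and
  measurability are read off from it.\<close>

lemma lim_lamps_iff:
  "lim_lamps w z = l \<longleftrightarrow> (if converges w then \<forall>\<^sub>F n in sequentially. fst (w n) z = l else l = \<one>\<^bsub>L\<^esub>)"
proof (cases "converges w")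
  case True
  then obtain l' where "\<forall>\<^sub>F n in sequentially. fst (w n) z = l'"
    by (auto simp: converges_iff)
  then show ?thesis using lim_lamps_eq[OF True] True by metis
qed (auto simp: lim_lamps_not_converges)

lemma converges_path_shift: "converges (path_shift w) \<longleftrightarrow> converges w"
  unfolding converges_iff path_shift_def
  by (simp add: eventually_sequentially_Suc[of "\<lambda>n. fst (w n) _ = _"])

lemma lim_lamps_path_shift: "lim_lamps (path_shift w) = lim_lamps w"
proof
  fix z
  show "lim_lamps (path_shift w) z = lim_lamps w z"
    unfolding lim_lamps_iff[of "path_shift w"] converges_path_shift
    using lim_lamps_iff[of w z "lim_lamps w z"]
    by (simp add: path_shift_def eventually_sequentially_Suc[of "\<lambda>n. fst (w n) _ = _"] split: if_splits)
qed

lemma carrierD: "g \<in> carrier G \<Longrightarrow> fst g z \<in> carrier L"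
  using carrier_wreath[of "fst g" "snd g" L] by simp

text \<open>Convergence is assumed because divergent paths get the default identity configuration,
  which the action does not fix. Equivariance therefore holds almost surely only.\<close>

lemma translate_lim_lamps:
  assumes w: "converges w" and g: "g \<in> carrier G"
  shows "converges (translate g w) \<and> (\<forall>z. lim_lamps (translate g w) z = fst g z \<otimes>\<^bsub>L\<^esub> lim_lamps w (z - snd g))"
proof -
  have ev: "\<forall>\<^sub>F n in sequentially. fst (translate g w n) z = fst g z \<otimes>\<^bsub>L\<^esub> lim_lamps w (z - snd g)" for z
  proof -
    have "\<forall>\<^sub>F n in sequentially. fst (w n) (z - snd g) = lim_lamps w (z - snd g)"
      using lim_lamps_iff[of w "z - snd g" "lim_lamps w (z - snd g)"] w by simp
    then show ?thesis by eventually_elim (simp add: fst_mult_wreath)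
  qed
  have c: "converges (translate g w)"
    unfolding converges_iff
  proof
    fix z
    show "\<exists>l\<in>carrier L. \<forall>\<^sub>F n in sequentially. fst (translate g w n) z = l"
      using ev[of z] carrierD[OF g, of z] lim_lamps_closed[of w "z - snd g"] by blast
  qed
  then show ?thesis using lim_lamps_eq[OF c ev] by blast
qed

lemma component_sets: "{w \<in> space (path_space G). fst (w n) z = l} \<in> sets (path_space G)"
proof -
  have m: "(\<lambda>w. w n) \<in> path_space G \<rightarrow>\<^sub>M count_space (carrier G)"
    unfolding path_space_def by measurable
  have "{w \<in> space (path_space G). fst (w n) z = l} =
      (\<lambda>w. w n) -` {g \<in> carrier G. fst g z = l} \<inter> space (path_space G)"
    using measurable_space[OF m] by auto
  also have "\<dots> \<in> sets (path_space G)" by (rule measurable_sets[OF m]) auto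
  finally show ?thesis .
qed

lemma eventually_component_sets:
  "{w \<in> space (path_space G). \<forall>\<^sub>F n in sequentially. fst (w n) z = l} \<in> sets (path_space G)"
  unfolding eventually_sequentially
  by (intro sets.sets_Collect_countable_Ex sets.sets_Collect_countable_All sets.sets_Collect_imp
      component_sets sets.sets_Collect_const)

lemma converges_sets: "{w \<in> space (path_space G). converges w} \<in> sets (path_space G)"
  unfolding converges_iff
  by (intro sets.sets_Collect_countable_All sets.sets_Collect_countable_Ex'[OF _ countable_L]
      eventually_component_sets)

lemma lim_lamps_component_measurable:
  "(\<lambda>w. lim_lamps w z) \<in> path_space G \<rightarrow>\<^sub>M count_space (carrier L)"
proof (rule measurable_count_space_eq_countable[OF countable_L, THEN iffD2], intro conjI ballI)
  show "(\<lambda>w. lim_lamps w z) \<in> space (path_space G) \<rightarrow> carrier L" using lim_lamps_closed by auto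
  fix l assume "l \<in> carrier L"
  have "(\<lambda>w. lim_lamps w z) -` {l} \<inter> space (path_space G) =
      ({w \<in> space (path_space G). converges w} \<inter> {w \<in> space (path_space G). \<forall>\<^sub>F n in sequentially. fst (w n) z = l}) \<union>
      (if l = \<one>\<^bsub>L\<^esub> then space (path_space G) - {w \<in> space (path_space G). converges w} else {})"
  proof (rule Set.set_eqI)
    fix w
    show "w \<in> (\<lambda>w. lim_lamps w z) -` {l} \<inter> space (path_space G) \<longleftrightarrow> w \<in>
      ({w \<in> space (path_space G). converges w} \<inter> {w \<in> space (path_space G). \<forall>\<^sub>F n in sequentially. fst (w n) z = l}) \<union>
      (if l = \<one>\<^bsub>L\<^esub> then space (path_space G) - {w \<in> space (path_space G). converges w} else {})"
      using lim_lamps_iff[of w z l] by (cases "converges w") auto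
  qed
  also have "\<dots> \<in> sets (path_space G)"
    using converges_sets eventually_component_sets by auto
  finally show "(\<lambda>w. lim_lamps w z) -` {l} \<inter> space (path_space G) \<in> sets (path_space G)" .
qed

text \<open>Finitely many sites, so that the values stay countable. The limiting configuration
  enters the entropy argument only through such windows.\<close>

definition lamp_window :: "(int ^ 'd) list \<Rightarrow> (nat \<Rightarrow> (int ^ 'd \<Rightarrow> 'l) \<times> (int ^ 'd)) \<Rightarrow> 'l list" where
  "lamp_window zs w = map (lim_lamps w) zs"

lemma lamp_window_measurable:
  "lamp_window zs \<in> path_space G \<rightarrow>\<^sub>M count_space UNIV" "countable (lamp_window zs ` space (path_space G))"
  using map_list_measurable[OF countable_L, of "\<lambda>z w. lim_lamps w z" "path_space G" zs, OF lim_lamps_component_measurable]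
  by (simp_all add: lamp_window_def[abs_def])

abbreviation pos :: "(nat \<Rightarrow> (int ^ 'd \<Rightarrow> 'l) \<times> (int ^ 'd)) \<Rightarrow> nat \<Rightarrow> int ^ 'd" where
  "pos \<equiv> hom_walk snd"

section \<open>Lamps along a trajectory\<close>

lemma snd_walk: "snd (walk \<omega> n) = pos \<omega> n"
  by (induction n) (auto simp: hom_walk_def one_wreath snd_mult_wreath)

lemma fst_walk_Suc: "fst (walk \<omega> (Suc n)) z = fst (walk \<omega> n) z \<otimes>\<^bsub>L\<^esub> fst (\<omega> n) (z - pos \<omega> n)"
  by (simp add: fst_mult_wreath snd_walk)

text \<open>Points of \<open>space S\<close> may have increments of probability zero; pathwise
  statements about lamps are made on this set of full measure.\<close>

definition admissible :: "(nat \<Rightarrow> (int ^ 'd \<Rightarrow> 'l) \<times> (int ^ 'd)) \<Rightarrow> bool" where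
  "admissible \<omega> \<longleftrightarrow> (\<forall>i. \<omega> i \<in> set_pmf \<mu>)"

lemma AE_admissible: "AE \<omega> in S. admissible \<omega>"
proof -
  have "AE \<omega> in S. \<omega> i \<in> set_pmf \<mu>" for i
  proof -
    have "AE \<omega> in S. 0 < P.cell_prob (\<lambda>\<omega>. \<omega> i) \<omega>" by (rule P.AE_cell_prob_pos[OF discrete_rv_increment])
    then show ?thesis
      by eventually_elim (simp add: P.cell_prob_def prob_increment pmf_positive_iff)
  qed
  then show ?thesis unfolding admissible_def by (simp add: AE_all_countable)
qed

lemma admissible_walk_closed: "admissible \<omega> \<Longrightarrow> walk \<omega> n \<in> carrier G"
  using set_pmf_carrier by (induction n) (auto simp: admissible_def)

text \<open>A lamp step touches the lamp at the origin only and a pure move touches none. Hence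
  along the walk a lamp can change only while its site is occupied.\<close>

lemma fst_increment: "admissible \<omega> \<Longrightarrow> w \<noteq> 0 \<Longrightarrow> fst (\<omega> n) w = \<one>\<^bsub>L\<^esub>"
proof -
  assume "admissible \<omega>" "w \<noteq> 0"
  then have "\<omega> n \<in> {(delta_config L int_lattice s, 0) | s. s \<in> carrier L} \<union> {(id_config L int_lattice, x) | x. True}"
    using elementary by (auto simp: admissible_def)
  then show ?thesis using \<open>w \<noteq> 0\<close> by (auto simp: delta_config_int_lattice id_config_int_lattice)
qed

lemma lamp_step_unvisited:
  "admissible \<omega> \<Longrightarrow> pos \<omega> n \<noteq> z \<Longrightarrow> fst (walk \<omega> (Suc n)) z = fst (walk \<omega> n) z"
  using carrierD[OF admissible_walk_closed]
  by (simp add: fst_walk_Suc fst_increment del: walk_path.simps)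

lemma lamp_unvisited:
  assumes \<omega>: "admissible \<omega>" and nv: "\<And>l. N \<le> l \<Longrightarrow> pos \<omega> l \<noteq> z"
  shows "N \<le> n \<Longrightarrow> fst (walk \<omega> n) z = fst (walk \<omega> N) z"
  by (induction n rule: dec_induct) (use lamp_step_unvisited[OF \<omega> nv] in \<open>auto simp del: walk_path.simps\<close>)

lemma converges_walk:
  assumes \<omega>: "admissible \<omega>" and tr: "\<forall>z. eventually (\<lambda>n. pos \<omega> n \<noteq> z) sequentially"
  shows "converges (walk \<omega>)"
  unfolding converges_iff
proof
  fix z
  obtain N where N: "\<And>l. N \<le> l \<Longrightarrow> pos \<omega> l \<noteq> z" using tr unfolding eventually_sequentially by blast
  have "\<forall>\<^sub>F n in sequentially. fst (walk \<omega> n) z = fst (walk \<omega> N) z"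
    unfolding eventually_sequentially using lamp_unvisited[OF \<omega> N] by blast
  then show "\<exists>l\<in>carrier L. \<forall>\<^sub>F n in sequentially. fst (walk \<omega> n) z = l"
    using carrierD[OF admissible_walk_closed[OF \<omega>]] by blast
qed

lemma lim_lamps_unvisited:
  assumes \<omega>: "admissible \<omega>" "converges (walk \<omega>)" and nv: "\<And>l. N \<le> l \<Longrightarrow> pos \<omega> l \<noteq> z"
  shows "lim_lamps (walk \<omega>) z = fst (walk \<omega> N) z"
proof (rule lim_lamps_eq[OF \<omega>(2)])
  show "\<forall>\<^sub>F n in sequentially. fst (walk \<omega> n) z = fst (walk \<omega> N) z"
    unfolding eventually_sequentially using lamp_unvisited[OF \<omega>(1) nv] by blast
qed

section \<open>Sup-norm balls of the lattice\<close>

definition cube :: "nat \<Rightarrow> (int ^ 'd) set" where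
  "cube r = {x. \<forall>i. \<bar>x $ i\<bar> \<le> int r}"

lemma cube_subset_PiE: "(\<lambda>x i. x $ i) ` cube r \<subseteq> (UNIV :: 'd set) \<rightarrow>\<^sub>E {- int r..int r}"
  by (auto simp: cube_def abs_le_iff) (smt (verit))

lemma finite_cube: "finite (cube r)" and card_cube_le: "card (cube r) \<le> (2 * r + 1) ^ CARD('d)"
proof -
  have fin: "finite ((UNIV :: 'd set) \<rightarrow>\<^sub>E {- int r..int r})" by (intro finite_PiE) auto
  have inj: "inj_on (\<lambda>x i. x $ i) (cube r)" by (rule inj_onI) (simp add: vec_eq_iff fun_eq_iff)
  show "finite (cube r)" using finite_imageD[OF finite_subset[OF cube_subset_PiE fin] inj] .
  have "card (cube r) = card ((\<lambda>x i. x $ i) ` cube r)" by (rule card_image[OF inj, symmetric])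
  also have "\<dots> \<le> card ((UNIV :: 'd set) \<rightarrow>\<^sub>E {- int r..int r})" by (rule card_mono[OF fin cube_subset_PiE])
  also have "\<dots> = (2 * r + 1) ^ CARD('d)" by (simp add: card_PiE nat_add_distrib nat_mult_distrib)
  finally show "card (cube r) \<le> (2 * r + 1) ^ CARD('d)" .
qed

lemma cube_mono: "r \<le> s \<Longrightarrow> x \<in> cube r \<Longrightarrow> x \<in> cube s"
  unfolding cube_def by (auto intro: order_trans)

lemma cube_add: "x \<in> cube r \<Longrightarrow> y \<in> cube s \<Longrightarrow> x + y \<in> cube (r + s)"
  unfolding cube_def by (simp add: vector_add_component) (meson abs_triangle_ineq add_mono order_trans)

lemma zero_in_cube: "0 \<in> cube r"
  by (simp add: cube_def)

end

section \<open>Entropy of the position given the limiting lamps\<close>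

context lamplighter
begin

lemma projection_cube:
  assumes "finite (snd ` set_pmf \<mu>)"
  obtains R where "\<And>x. x \<in> snd ` set_pmf \<mu> \<Longrightarrow> x \<in> cube R"
proof (rule that)
  fix x assume x: "x \<in> snd ` set_pmf \<mu>"
  have "nat \<bar>x $ i\<bar> \<le> (\<Sum>x\<in>snd ` set_pmf \<mu>. \<Sum>i\<in>UNIV. nat \<bar>x $ i\<bar>)" for i
  proof -
    have "nat \<bar>x $ i\<bar> \<le> (\<Sum>i\<in>UNIV. nat \<bar>x $ i\<bar>)" by (rule member_le_sum) auto
    also have "\<dots> \<le> (\<Sum>x\<in>snd ` set_pmf \<mu>. \<Sum>i\<in>UNIV. nat \<bar>x $ i\<bar>)"
      by (rule member_le_sum[of x "snd ` set_pmf \<mu>" "\<lambda>x. \<Sum>i\<in>UNIV. nat \<bar>x $ i\<bar>"])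
        (use x assms in auto)
    finally show ?thesis .
  qed
  then show "x \<in> cube (\<Sum>x\<in>snd ` set_pmf \<mu>. \<Sum>i\<in>UNIV. nat \<bar>x $ i\<bar>)"
    unfolding cube_def by (auto simp: nat_le_iff)
qed

lemma admissible_shift: "admissible \<omega> \<Longrightarrow> admissible (shift_by t \<omega>)"
  by (simp add: admissible_def shift_by_def)

lemma pos_cube:
  assumes R: "\<And>x. x \<in> snd ` set_pmf \<mu> \<Longrightarrow> x \<in> cube R" and \<omega>: "admissible \<omega>"
  shows "pos \<omega> n \<in> cube (R * n)"
proof (induction n)
  case 0
  then show ?case by (simp add: hom_walk_def zero_in_cube)
next
  case (Suc n)
  have "pos \<omega> (Suc n) = pos \<omega> n + snd (\<omega> n)" by (simp add: hom_walk_def)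
  moreover have "snd (\<omega> n) \<in> cube R" using R \<omega> by (simp add: admissible_def)
  ultimately show ?case using cube_add[OF Suc] by (simp add: add.commute)
qed

text \<open>\<open>block_data\<close> is what has to be revealed, besides the limiting lamps, to recover the position
  of the walk at time \<open>n * K\<close>: the displacement over each block of \<open>K\<close> steps, and all increments of
  those blocks whose neighbourhood is visited again after time \<open>n * K\<close>.\<close>

definition late_visit :: "nat \<Rightarrow> nat \<Rightarrow> (nat \<Rightarrow> (int ^ 'd \<Rightarrow> 'l) \<times> (int ^ 'd)) set" where
  "late_visit r m = {\<omega> \<in> space S. \<exists>l\<ge>m. pos \<omega> l \<in> cube r}"

text \<open>Stated for the walk restarted at the beginning of block i: by stationarity its
  probability depends only on the time left, (n - i) K.\<close>

definition block_revisited :: "nat \<Rightarrow> nat \<Rightarrow> nat \<Rightarrow> nat \<Rightarrow> (nat \<Rightarrow> (int ^ 'd \<Rightarrow> 'l) \<times> (int ^ 'd)) set" where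
  "block_revisited r K n i = {\<omega> \<in> space S. shift_by (i * K) \<omega> \<in> late_visit r ((n - i) * K)}"

text \<open>Cut off to \<open>cube r\<close> so that the range is finite everywhere; on admissible
  trajectories nothing is cut off when r = R K.\<close>

definition block_shift :: "nat \<Rightarrow> nat \<Rightarrow> nat \<Rightarrow> (nat \<Rightarrow> (int ^ 'd \<Rightarrow> 'l) \<times> (int ^ 'd)) \<Rightarrow> int ^ 'd" where
  "block_shift r K i \<omega> = (let x = pos (shift_by (i * K) \<omega>) K in if x \<in> cube r then x else 0)"

text \<open>\<open>None\<close> carries information as well: it certifies that the neighbourhood of
  the block is not entered from time n K on.\<close>

definition block_incs :: "nat \<Rightarrow> nat \<Rightarrow> nat \<Rightarrow> nat \<Rightarrow> (nat \<Rightarrow> (int ^ 'd \<Rightarrow> 'l) \<times> (int ^ 'd)) \<Rightarrow>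
    ((int ^ 'd \<Rightarrow> 'l) \<times> (int ^ 'd)) list option" where
  "block_incs r K n i \<omega> =
    (if \<omega> \<in> block_revisited r K n i then Some (incs K (shift_by (i * K) \<omega>)) else None)"

definition block_data where
  "block_data r K n \<omega> = map (\<lambda>i. (block_shift r K i \<omega>, block_incs r K n i \<omega>)) [0..<n]"

lemma late_visit_sets: "late_visit r m \<in> sets S"
  unfolding late_visit_def by (rule hom_walk_visit_sets[OF finite_cube])

lemma block_revisited_sets: "block_revisited r K n i \<in> sets S"
proof -
  have "block_revisited r K n i = shift_by (i * K) -` late_visit r ((n - i) * K) \<inter> space S"
    by (auto simp: block_revisited_def)
  then show ?thesis using measurable_sets[OF measurable_shift late_visit_sets] by simp
qed

lemma not_block_revisited:
  assumes "\<omega> \<in> space S" "\<omega> \<notin> block_revisited r K n i" "i < n" "z - pos \<omega> (i * K) \<in> cube r" "n * K \<le> l"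
  shows "pos \<omega> l \<noteq> z"
proof
  assume z: "pos \<omega> l = z"
  have iK: "i * K \<le> l" using assms(3,5) by (meson le_trans less_imp_le mult_le_mono1)
  have "pos \<omega> l = pos \<omega> (i * K) + pos (shift_by (i * K) \<omega>) (l - i * K)"
    using hom_walk_add[of snd \<omega> "i * K" "l - i * K"] iK by simp
  then have "pos (shift_by (i * K) \<omega>) (l - i * K) \<in> cube r" using assms(4) z by simp
  moreover have "(n - i) * K \<le> l - i * K" using assms(5) by (simp add: diff_mult_distrib)
  ultimately have "\<omega> \<in> block_revisited r K n i"
    using assms(1) shift_space[OF assms(1)] by (auto simp: block_revisited_def late_visit_def)
  then show False using assms(2) by simp
qed

text \<open>Two trajectories with equal data are compared. The displacements give the positions at
  multiples of K. If a block near a site is not revealed, no later visit occurs and the lamp is the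
  limiting one. Otherwise all blocks near the site are revealed, and its lamp is followed step by
  step.\<close>

lemma walk_determined:
  assumes R: "\<And>x. x \<in> snd ` set_pmf \<mu> \<Longrightarrow> x \<in> cube R" and K: "0 < K"
    and \<omega>: "\<omega> \<in> space S" "admissible \<omega>" "converges (walk \<omega>)"
    and \<omega>': "\<omega>' \<in> space S" "admissible \<omega>'" "converges (walk \<omega>')"
    and data: "block_data (R * K) K n \<omega> = block_data (R * K) K n \<omega>'"
    and zs: "set zs = cube (R * (n * K) + R * K)"
    and win: "lamp_window zs (walk \<omega>) = lamp_window zs (walk \<omega>')"
  shows "walk \<omega> (n * K) = walk \<omega>' (n * K)"
proof -
  have sh: "block_shift (R * K) K i \<omega> = block_shift (R * K) K i \<omega>'"
    and inc: "block_incs (R * K) K n i \<omega> = block_incs (R * K) K n i \<omega>'" if "i < n" for i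
    using data that by (auto simp: block_data_def)
  have bs: "block_shift (R * K) K i \<omega> = pos (shift_by (i * K) \<omega>) K" if "admissible \<omega>" for \<omega> i
    using pos_cube[OF R admissible_shift[OF that], of "i * K" K] by (simp add: block_shift_def)
  have pos_eq: "pos \<omega> (i * K) = pos \<omega>' (i * K)" if "i \<le> n" for i
    using that
  proof (induction i)
    case 0
    then show ?case by (simp add: hom_walk_def)
  next
    case (Suc i)
    have "pos (shift_by (i * K) \<omega>) K = pos (shift_by (i * K) \<omega>') K"
      using sh[of i] Suc.prems bs[OF \<omega>(2)] bs[OF \<omega>'(2)] by simp
    then show ?case
      using Suc hom_walk_add[of snd \<omega> "i * K" K] hom_walk_add[of snd \<omega>' "i * K" K] by (simp add: add.commute)
  qed
  have lamps: "fst (walk \<omega> (n * K)) z = fst (walk \<omega>' (n * K)) z" for z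
  proof (cases "\<exists>i<n. z - pos \<omega> (i * K) \<in> cube (R * K) \<and> block_incs (R * K) K n i \<omega> = None")
    case True
    then obtain i where i: "i < n" "z - pos \<omega> (i * K) \<in> cube (R * K)" "block_incs (R * K) K n i \<omega> = None"
      by blast
    have i': "z - pos \<omega>' (i * K) \<in> cube (R * K)" "block_incs (R * K) K n i \<omega>' = None"
      using i pos_eq[of i] inc[of i] by auto
    have nr: "\<omega> \<notin> block_revisited (R * K) K n i" "\<omega>' \<notin> block_revisited (R * K) K n i"
      using i(3) i'(2) by (auto simp: block_incs_def split: if_splits)
    have 1: "lim_lamps (walk \<omega>) z = fst (walk \<omega> (n * K)) z"
      by (rule lim_lamps_unvisited[OF \<omega>(2,3)]) (rule not_block_revisited[OF \<omega>(1) nr(1) i(1,2)])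
    have 2: "lim_lamps (walk \<omega>') z = fst (walk \<omega>' (n * K)) z"
      by (rule lim_lamps_unvisited[OF \<omega>'(2,3)]) (rule not_block_revisited[OF \<omega>'(1) nr(2) i(1) i'(1)])
    \<comment> \<open>The start of the block is within R n K of the origin and z within R K of the
      start, which is how the size of the window arises.\<close>
    have "pos \<omega> (i * K) \<in> cube (R * (i * K))" by (rule pos_cube[OF R \<omega>(2)])
    then have "pos \<omega> (i * K) \<in> cube (R * (n * K))" by (rule cube_mono[rotated]) (use i(1) in simp)
    from cube_add[OF this i(2)] have "z \<in> set zs" by (simp add: zs)
    then have "lim_lamps (walk \<omega>) z = lim_lamps (walk \<omega>') z"
      using win by (simp add: lamp_window_def)
    then show ?thesis using 1 2 by simp
  next
    case False
    have "fst (walk \<omega> j) z = fst (walk \<omega>' j) z" if "j \<le> n * K" for j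
      using that
    proof (induction j)
      case (Suc j)
      define i r where "i = j div K" and "r = j mod K"
      have j: "j = i * K + r" "r < K" using K by (simp_all add: i_def r_def)
      have i: "i < n" using Suc.prems K by (simp add: i_def less_mult_imp_div_less)
      have IH: "fst (walk \<omega> j) z = fst (walk \<omega>' j) z" using Suc by simp
      have pj: "pos \<omega> j = pos \<omega> (i * K) + pos (shift_by (i * K) \<omega>) r" for \<omega>
        unfolding j(1) by (rule hom_walk_add)
      have rK: "R * r \<le> R * K" using j(2) by simp
      show ?case
      proof (cases "z - pos \<omega> (i * K) \<in> cube (R * K)")
        \<comment> \<open>Within a block the walk moves at most R K from the start of the block, so
          neither trajectory is at z.\<close>
        case far: False
        have "pos \<omega> j \<noteq> z"
          using far pj[of \<omega>] cube_mono[OF rK pos_cube[OF R admissible_shift[OF \<omega>(2)]]] by auto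
        moreover have "pos \<omega>' j \<noteq> z"
          using far pj[of \<omega>'] pos_eq[of i] i cube_mono[OF rK pos_cube[OF R admissible_shift[OF \<omega>'(2)]]] by auto
        ultimately show ?thesis
          using lamp_step_unvisited[OF \<omega>(2)] lamp_step_unvisited[OF \<omega>'(2)] IH by (simp del: walk_path.simps)
      next
        case True
        then have "block_incs (R * K) K n i \<omega> \<noteq> None" using False i by auto
        then have eq: "incs K (shift_by (i * K) \<omega>) = incs K (shift_by (i * K) \<omega>')"
          using inc[OF i] by (auto simp: block_incs_def split: if_splits)
        have nth: "shift_by (i * K) \<omega> s = shift_by (i * K) \<omega>' s" if "s < K" for s
          using arg_cong[OF eq, of "\<lambda>l. l ! s"] that by (simp add: incs_def)
        have "\<omega> j = \<omega>' j"
          using nth[OF j(2)] by (simp add: shift_by_def j(1) add.commute)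
        moreover have "pos (shift_by (i * K) \<omega>) r = pos (shift_by (i * K) \<omega>') r"
          unfolding hom_walk_def using nth j(2) by (intro sum.cong) auto
        then have "pos \<omega> j = pos \<omega>' j" using pj pos_eq[of i] i by simp
        ultimately show ?thesis using IH by (simp add: fst_walk_Suc del: walk_path.simps)
      qed
    qed (simp add: one_wreath)
    then show ?thesis by simp
  qed
  show ?thesis
    using lamps snd_walk[of \<omega> "n * K"] snd_walk[of \<omega>' "n * K"] pos_eq[of n] by (intro prod_eqI) auto
qed

section \<open>Entropy of the block data\<close>

lemma discrete_rv_block_shift: "P.discrete_rv (block_shift r K i)"
proof -
  have "P.discrete_rv (\<lambda>\<omega>. pos (shift_by (i * K) \<omega>) K)"
    by (rule discrete_rv_shift[OF discrete_rv_hom_walk])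
  from P.discrete_rv_compose[OF this, of "\<lambda>x. if x \<in> cube r then x else 0"]
  show ?thesis unfolding block_shift_def Let_def .
qed

lemma discrete_rv_block_incs: "P.discrete_rv (block_incs r K n i)"
  using P.discrete_rv_restrict[OF discrete_rv_shift[OF discrete_rv_incs, of K "i * K"] block_revisited_sets[of r K n i]]
  unfolding block_incs_def .

lemma discrete_rv_block_data: "P.discrete_rv (block_data r K n)"
  unfolding block_data_def
  by (rule P.discrete_rv_map) (rule P.discrete_rv_Pair[OF discrete_rv_block_shift discrete_rv_block_incs])

lemma ent_block_shift_le: "P.ent (block_shift r K i) \<le> ennreal (real CARD('d) * ln (2 * real r + 1))"
proof -
  have "P.ent (block_shift r K i) \<le> ennreal (ln (card (cube r)))"
    by (rule P.ent_le_ln_card[OF discrete_rv_block_shift finite_cube])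
      (auto simp: block_shift_def Let_def zero_in_cube)
  also have "\<dots> \<le> ennreal (ln ((2 * real r + 1) ^ CARD('d)))"
  proof (intro ennreal_leI)
    have c: "0 < card (cube r)" using finite_cube zero_in_cube by (auto simp: card_gt_0_iff)
    have "real (card (cube r)) \<le> (2 * real r + 1) ^ CARD('d)"
      using of_nat_mono[OF card_cube_le[of r], where 'a = real] by (simp add: add.commute)
    then show "ln (real (card (cube r))) \<le> ln ((2 * real r + 1) ^ CARD('d))"
      using c by (intro ln_mono) auto
  qed
  also have "ln ((2 * real r + 1) ^ CARD('d)) = real CARD('d) * ln (2 * real r + 1)"
    by (rule ln_realpow)
  finally show ?thesis .
qed

lemma ent_shifted_incs_le: "P.ent (\<lambda>\<omega>. incs K (shift_by t \<omega>)) \<le> of_nat K * entropy_pmf \<mu>"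
proof -
  have "(\<lambda>\<omega>. incs K (shift_by t \<omega>)) = (\<lambda>\<omega>. map (\<lambda>i. \<omega> (i + t)) [0..<K])"
    by (simp add: incs_def fun_eq_iff shift_by_def)
  then show ?thesis
    using P.ent_map_le[of "[0..<K]" "\<lambda>i \<omega>. \<omega> (i + t)", OF discrete_rv_increment]
    by (simp add: ent_increment sum_list_triv)
qed

text \<open>A crude bound, for the blocks near time n K where a revisit is likely; ln 2 is the cost
  of telling whether the block is revealed.\<close>

lemma ent_block_incs_le: "P.ent (block_incs r K n i) \<le> ennreal (ln 2) + of_nat K * entropy_pmf \<mu>"
proof -
  let ?E = "\<lambda>\<omega>. \<omega> \<in> block_revisited r K n i" and ?I = "\<lambda>\<omega>. incs K (shift_by (i * K) \<omega>)"
  have E: "P.discrete_rv ?E" by (rule P.discrete_rv_event[OF block_revisited_sets])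
  have I: "P.discrete_rv ?I" by (rule discrete_rv_shift[OF discrete_rv_incs])
  have "P.ent (block_incs r K n i) \<le> P.ent (\<lambda>\<omega>. (?E \<omega>, ?I \<omega>))"
  proof (rule P.ent_mono[OF discrete_rv_block_incs P.discrete_rv_Pair[OF E I] P.determinesI])
    fix \<omega> \<omega>' assume "(?E \<omega>, ?I \<omega>) = (?E \<omega>', ?I \<omega>')"
    then show "block_incs r K n i \<omega> = block_incs r K n i \<omega>'" unfolding block_incs_def by simp
  qed
  also have "\<dots> \<le> P.ent ?E + P.ent ?I" by (rule P.ent_Pair_le[OF E I])
  also have "P.ent ?E \<le> ennreal (ln (card (UNIV :: bool set)))" by (rule P.ent_le_ln_card[OF E]) auto
  finally show ?thesis using ent_shifted_incs_le[of K "i * K"] by (simp add: add_mono order_trans)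
qed

lemma prob_shifted_incs: "P.prob {\<omega> \<in> space S. incs K (shift_by t \<omega>) = x} = P.prob {\<omega> \<in> space S. incs K \<omega> = x}"
proof -
  have "{\<omega> \<in> space S. incs K (shift_by t \<omega>) = x} = {\<omega> \<in> space S. shift_by t \<omega> \<in> {\<omega> \<in> space S. incs K \<omega> = x}}"
    using shift_space by auto
  then show ?thesis by (simp only: prob_shift[OF P.cell_sets[OF discrete_rv_incs]])
qed

text \<open>If at least m0 blocks of time are left, a revisit has probability below \<delta> and the
  revealed increments cost at most \<epsilon>/2. At most m0 further blocks remain, with a cost that
  does not depend on n.\<close>

lemma sum_ent_block_incs:
  assumes fin: "entropy_pmf \<mu> < \<infinity>" and K: "0 < K" and \<epsilon>: "0 < \<epsilon>"
    and tr: "AE \<omega> in S. \<forall>z. eventually (\<lambda>n. pos \<omega> n \<noteq> z) sequentially"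
  shows "\<exists>n>0. (\<Sum>i<n. P.ent (block_incs r K n i)) \<le> ennreal (\<epsilon> * real n)"
proof -
  have finK: "P.ent (incs K) < \<infinity>"
    by (rule le_less_trans[OF ent_incs_le]) (use fin in \<open>simp add: ennreal_mult_less_top of_nat_less_top\<close>)
  obtain \<delta> where \<delta>: "0 < \<delta>"
    "\<And>X E. P.discrete_rv X \<Longrightarrow>
      (\<And>x. P.prob {\<omega> \<in> space S. X \<omega> = x} = P.prob {\<omega> \<in> space S. incs K \<omega> = x}) \<Longrightarrow>
      E \<in> sets S \<Longrightarrow> P.prob E \<le> \<delta> \<Longrightarrow>
      P.ent (\<lambda>\<omega>. if \<omega> \<in> E then Some (X \<omega>) else None) \<le> ennreal (\<epsilon> / 2)"
    by (rule P.ent_restrict_small[OF discrete_rv_incs finK half_gt_zero[OF \<epsilon>]]) blast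
  have "(\<lambda>m. P.prob (late_visit r m)) \<longlonglongrightarrow> 0"
    unfolding late_visit_def by (rule hom_walk_escape[OF tr finite_cube])
  then have "eventually (\<lambda>m. P.prob (late_visit r m) < \<delta>) sequentially"
    using \<delta>(1) by (rule order_tendstoD)
  then obtain m0 where m0: "\<And>m. m0 \<le> m \<Longrightarrow> P.prob (late_visit r m) < \<delta>"
    unfolding eventually_sequentially by blast
  define C where "C = ennreal (ln 2) + of_nat K * entropy_pmf \<mu>"
  have "C < \<infinity>" using fin by (simp add: C_def ennreal_mult_less_top of_nat_less_top)
  then obtain c where c: "0 \<le> c" "C = ennreal c" by (cases C) auto
  have V: "P.ent (block_incs r K n i) \<le> ennreal (\<epsilon> / 2) + (if n - i < m0 then ennreal c else 0)" for n i
  proof (cases "n - i < m0")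
    case True
    have "P.ent (block_incs r K n i) \<le> C" unfolding C_def by (rule ent_block_incs_le)
    then show ?thesis using True c by (simp add: add_increasing)
  next
    case False
    have "m0 \<le> (n - i) * K" using False K mult_le_mono[of m0 "n - i" 1 K] by simp
    then have "P.prob (block_revisited r K n i) \<le> \<delta>"
      unfolding block_revisited_def prob_shift[OF late_visit_sets] using m0 by (simp add: less_imp_le)
    then have "P.ent (block_incs r K n i) \<le> ennreal (\<epsilon> / 2)"
      unfolding block_incs_def
      by (intro \<delta>(2) block_revisited_sets prob_shifted_incs discrete_rv_shift[OF discrete_rv_incs])
    then show ?thesis using False by simp
  qed
  \<comment> \<open>Makes m0 c at most \<epsilon> n / 2; the added 1 ensures n > 0.\<close>
  obtain n :: nat where n: "2 * real m0 * c / \<epsilon> + 1 < real n" using reals_Archimedean2 by blast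
  have "0 \<le> 2 * real m0 * c / \<epsilon>" using c \<epsilon> by simp
  then have n0: "0 < n" using n by simp
  have "(\<Sum>i<n. P.ent (block_incs r K n i)) \<le> (\<Sum>i<n. ennreal (\<epsilon> / 2) + (if n - i < m0 then ennreal c else 0))"
    by (intro sum_mono V)
  also have "\<dots> = of_nat n * ennreal (\<epsilon> / 2) + of_nat (card {i. i < n \<and> n - i < m0}) * ennreal c"
    by (simp add: sum.distrib sum.If_cases Int_def lessThan_def)
  also have "\<dots> \<le> of_nat n * ennreal (\<epsilon> / 2) + of_nat m0 * ennreal c"
  proof -
    have "card {i. i < n \<and> n - i < m0} \<le> card {..<m0}"
      by (rule card_inj_on_le[of "\<lambda>i. n - i"]) (auto simp: inj_on_def)
    then show ?thesis by (intro add_left_mono mult_right_mono) (auto simp: of_nat_le_iff)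
  qed
  also have "\<dots> = ennreal (real n * (\<epsilon> / 2) + real m0 * c)"
  proof -
    have "ennreal (real n * (\<epsilon> / 2) + real m0 * c) = ennreal (real n * (\<epsilon> / 2)) + ennreal (real m0 * c)"
      using \<epsilon> c by (intro ennreal_plus) auto
    also have "\<dots> = ennreal (real n) * ennreal (\<epsilon> / 2) + ennreal (real m0) * ennreal c"
      using \<epsilon> c by (subst (1 2) ennreal_mult) auto
    finally show ?thesis by (simp only: ennreal_of_nat_eq_real_of_nat)
  qed
  also have "\<dots> \<le> ennreal (\<epsilon> * real n)"
  proof (rule ennreal_leI)
    have "2 * real m0 * c / \<epsilon> < real n" using n by simp
    then have "2 * real m0 * c < \<epsilon> * real n" using \<epsilon> by (simp add: field_simps)
    then show "real n * (\<epsilon> / 2) + real m0 * c \<le> \<epsilon> * real n" by (simp add: field_simps)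
  qed
  finally show ?thesis using n0 by blast
qed

text \<open>K = q k is fixed before the number n of blocks. In units of k the time n K is n q, so
  each block has a budget of \<epsilon> q, half of it for the displacement.\<close>

lemma walk_cond_ent_small:
  assumes R: "\<And>x. x \<in> snd ` set_pmf \<mu> \<Longrightarrow> x \<in> cube R"
    and tr: "AE \<omega> in S. \<forall>z. eventually (\<lambda>n. pos \<omega> n \<noteq> z) sequentially"
    and fin: "entropy_pmf \<mu> < \<infinity>" and k: "0 < k" and \<epsilon>: "0 < \<epsilon>"
  shows "\<exists>n>0. \<exists>zs. P.cond_ent (\<lambda>\<omega>. walk \<omega> (n * k)) (\<lambda>\<omega>. lamp_window zs (walk \<omega>)) \<le> ennreal (\<epsilon> * real n)"
proof -
  define d where "d = real CARD('d)"
  \<comment> \<open>With r = R q k it gives 2 r + 1 \<le> a q + 1; the added 1 keeps a positive when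
    R = 0.\<close>
  define a where "a = 2 * real R * real k + 1"
  have a: "0 < a" by (simp add: a_def add_nonneg_pos)
  have "(\<lambda>q::nat. d * ln (a * real q + 1) / real q) \<longlonglongrightarrow> 0" using a by real_asymp
  then have "eventually (\<lambda>q::nat. d * ln (a * real q + 1) / real q < \<epsilon> / 2) sequentially"
    using \<epsilon> by (intro order_tendstoD(2)) auto
  then have "eventually (\<lambda>q::nat. d * ln (a * real q + 1) / real q < \<epsilon> / 2 \<and> 0 < q) sequentially"
    using eventually_gt_at_top[of 0] by eventually_elim auto
  then obtain q :: nat where q: "d * ln (a * real q + 1) / real q < \<epsilon> / 2" "0 < q"
    by (auto simp: eventually_sequentially)
  define K where "K = q * k"
  have K: "0 < K" using q k by (simp add: K_def)
  define r where "r = R * K"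
  obtain n where n: "0 < n" "(\<Sum>i<n. P.ent (block_incs r K n i)) \<le> ennreal (\<epsilon> / 2 * real n)"
    using sum_ent_block_incs[OF fin K half_gt_zero[OF \<epsilon>] tr] by blast
  obtain zs where zs: "set zs = cube (R * (n * K) + R * K)" using finite_list[OF finite_cube] by blast
  let ?F = "\<lambda>\<omega>. lamp_window zs (walk \<omega>)"
  have F: "P.discrete_rv ?F"
    by (rule discrete_rv_path_function'[OF lamp_window_measurable])
  have shift_le: "P.ent (block_shift r K i) \<le> ennreal (\<epsilon> / 2 * real q)" for i
  proof -
    have "d * ln (2 * real r + 1) \<le> d * ln (a * real q + 1)"
      unfolding r_def K_def a_def d_def
      by (intro mult_left_mono ln_mono) (auto simp: algebra_simps add_pos_nonneg)
    also have "\<dots> \<le> \<epsilon> / 2 * real q" using q by (simp add: pos_divide_less_eq less_imp_le)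
    finally have "ennreal (d * ln (2 * real r + 1)) \<le> ennreal (\<epsilon> / 2 * real q)" by (rule ennreal_leI)
    with ent_block_shift_le[of r K i] show ?thesis unfolding d_def by (rule order_trans)
  qed
  have det: "P.determines (\<lambda>\<omega>. (block_data r K n \<omega>, ?F \<omega>)) (\<lambda>\<omega>. walk \<omega> (n * K))"
    unfolding P.determines_def
  proof (intro exI[of _ "\<lambda>\<omega>. admissible \<omega> \<and> converges (walk \<omega>)"] conjI ballI impI)
    show "AE \<omega> in S. admissible \<omega> \<and> converges (walk \<omega>)"
      using AE_admissible tr by eventually_elim (auto intro: converges_walk)
    fix \<omega> \<omega>'
    assume "\<omega> \<in> space S" "\<omega>' \<in> space S" "admissible \<omega> \<and> converges (walk \<omega>)"
      "admissible \<omega>' \<and> converges (walk \<omega>')"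
      "(block_data r K n \<omega>, ?F \<omega>) = (block_data r K n \<omega>', ?F \<omega>')"
    then show "walk \<omega> (n * K) = walk \<omega>' (n * K)"
      by (intro walk_determined[OF R K _ _ _ _ _ _ _ zs]) (auto simp: r_def)
  qed
  have "P.cond_ent (\<lambda>\<omega>. walk \<omega> (n * K)) ?F \<le> P.cond_ent (block_data r K n) ?F"
    by (rule P.cond_ent_mono[OF discrete_rv_walk discrete_rv_block_data F det])
  also have "\<dots> \<le> P.ent (block_data r K n)" by (rule P.cond_ent_le_ent[OF discrete_rv_block_data F])
  also have "\<dots> \<le> (\<Sum>i\<leftarrow>[0..<n]. P.ent (\<lambda>\<omega>. (block_shift r K i \<omega>, block_incs r K n i \<omega>)))"
    unfolding block_data_def
    by (rule P.ent_map_le) (rule P.discrete_rv_Pair[OF discrete_rv_block_shift discrete_rv_block_incs])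
  also have "\<dots> = (\<Sum>i<n. P.ent (\<lambda>\<omega>. (block_shift r K i \<omega>, block_incs r K n i \<omega>)))"
    by (simp add: interv_sum_list_conv_sum_set_nat atLeast0LessThan)
  also have "\<dots> \<le> (\<Sum>i<n. ennreal (\<epsilon> / 2 * real q) + P.ent (block_incs r K n i))"
    by (intro sum_mono order_trans[OF P.ent_Pair_le[OF discrete_rv_block_shift discrete_rv_block_incs]]
        add_right_mono shift_le)
  also have "\<dots> = of_nat n * ennreal (\<epsilon> / 2 * real q) + (\<Sum>i<n. P.ent (block_incs r K n i))"
    by (simp add: sum.distrib)
  also have "\<dots> \<le> ennreal (real n * (\<epsilon> / 2 * real q)) + ennreal (\<epsilon> / 2 * real n)"
  proof (rule add_mono[OF _ n(2)])
    have "ennreal (real n * (\<epsilon> / 2 * real q)) = ennreal (real n) * ennreal (\<epsilon> / 2 * real q)"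
      using \<epsilon> by (intro ennreal_mult) auto
    then show "of_nat n * ennreal (\<epsilon> / 2 * real q) \<le> ennreal (real n * (\<epsilon> / 2 * real q))"
      by (simp only: ennreal_of_nat_eq_real_of_nat)
  qed
  also have "\<dots> = ennreal (real n * (\<epsilon> / 2 * real q) + \<epsilon> / 2 * real n)"
    using \<epsilon> by (intro ennreal_plus[symmetric]) auto
  \<comment> \<open>The revealed increments cost \<epsilon>/2 per block, which fits the other half
    of the budget because q \<ge> 1.\<close>
  also have "\<dots> \<le> ennreal (\<epsilon> * real (n * q))"
  proof (rule ennreal_leI)
    have "\<epsilon> / 2 * real n * 1 \<le> \<epsilon> / 2 * real n * real q"
      using q \<epsilon> by (intro mult_left_mono) auto
    then show "real n * (\<epsilon> / 2 * real q) + \<epsilon> / 2 * real n \<le> \<epsilon> * real (n * q)"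
      by (simp add: field_simps)
  qed
  finally have "P.cond_ent (\<lambda>\<omega>. walk \<omega> (n * q * k)) ?F \<le> ennreal (\<epsilon> * real (n * q))"
    by (simp add: K_def mult.assoc)
  then show ?thesis using n q by (intro exI[of _ "n * q"]) auto
qed

end

section \<open>The Poisson boundary\<close>

context lamplighter
begin

section \<open>Transience of the base walk from generation\<close>

definition real_vec :: "int ^ 'd \<Rightarrow> real ^ 'd" where
  "real_vec x = (\<chi> i. real_of_int (x $ i))"

lemma real_vec_simps:
  "real_vec (x + y) = real_vec x + real_vec y" "real_vec (- x) = - real_vec x" "real_vec 0 = 0"
  "real_vec (a *s x) = real_of_int a *\<^sub>R real_vec x"
  by (simp_all add: real_vec_def vec_eq_iff)

lemma inv_wreath: "g \<in> carrier G \<Longrightarrow> snd (inv\<^bsub>G\<^esub> g) = - snd g"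
proof -
  assume g: "g \<in> carrier G"
  have "snd (inv\<^bsub>G\<^esub> g \<otimes>\<^bsub>G\<^esub> g) = 0" using g by (simp add: one_wreath)
  then show ?thesis by (simp add: snd_mult_wreath eq_neg_iff_add_eq_0)
qed

text \<open>Without projection 0 every increment is a pure move, and pure moves generate only
  elements with trivial lamps. This supplies the step 0 for the spreading argument.\<close>

lemma zero_in_projection:
  assumes gen: "generate G (set_pmf \<mu>) = carrier G" and L: "carrier L \<noteq> {\<one>\<^bsub>L\<^esub>}"
  shows "0 \<in> snd ` set_pmf \<mu>"
proof (rule ccontr)
  assume nz: "0 \<notin> snd ` set_pmf \<mu>"
  have id: "fst g = (\<lambda>_. \<one>\<^bsub>L\<^esub>)" if g: "g \<in> set_pmf \<mu>" for g
  proof -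
    have "snd g \<noteq> 0" using nz g by force
    then show ?thesis using elementary g by (auto simp: id_config_int_lattice)
  qed
  have "fst g = (\<lambda>_. \<one>\<^bsub>L\<^esub>)" if "g \<in> generate G (set_pmf \<mu>)" for g
    using that
  proof (induction rule: generate.induct)
    case (inv h)
    have h: "h \<in> carrier G" using inv set_pmf_carrier by blast
    have "inv\<^bsub>G\<^esub> h = ((\<lambda>_. \<one>\<^bsub>L\<^esub>), - snd h)"
      by (rule inv_equality[OF _ h]) (use id[OF inv] in \<open>auto simp: one_wreath carrier_wreath prod_eq_iff fst_mult_wreath snd_mult_wreath fun_eq_iff\<close>)
    then show ?case by simp
  next
    case (eng h1 h2)
    then show ?case by (simp add: fun_eq_iff fst_mult_wreath)
  qed (auto simp: one_wreath id)
  then have all: "fst g = (\<lambda>_. \<one>\<^bsub>L\<^esub>)" if "g \<in> carrier G" for g using that gen by blast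
  obtain s where s: "s \<in> carrier L" "s \<noteq> \<one>\<^bsub>L\<^esub>" using L L.one_closed by blast
  have "(\<lambda>z. if z = 0 then s else \<one>\<^bsub>L\<^esub>, 0) \<in> carrier G"
    using s by (auto simp: carrier_wreath)
  from fun_cong[OF all[OF this], of 0] show False using s by simp
qed

text \<open>The real span of the steps contains the projection of the generated group, hence the
  standard basis. Three members of a basis chosen among the steps are independent over the reals,
  and so over the integers.\<close>

lemma independent_steps:
  assumes gen: "generate G (set_pmf \<mu>) = carrier G" and d: "CARD('d) \<ge> 3"
  obtains v1 v2 v3 where "v1 \<in> snd ` set_pmf \<mu>" "v2 \<in> snd ` set_pmf \<mu>" "v3 \<in> snd ` set_pmf \<mu>"
    "\<And>a b c :: int. a *s v1 + b *s v2 + c *s v3 = 0 \<Longrightarrow> a = 0 \<and> b = 0 \<and> c = 0"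
proof -
  let ?D = "snd ` set_pmf \<mu>"
  have "real_vec (snd g) \<in> span (real_vec ` ?D)" if "g \<in> generate G (set_pmf \<mu>)" for g
    using that
  proof (induction rule: generate.induct)
    case (inv h)
    then have eq: "snd (inv\<^bsub>G\<^esub> h) = - snd h" using set_pmf_carrier by (intro inv_wreath) blast
    show ?case unfolding eq real_vec_simps using inv by (intro span_neg span_base) auto
  next
    case (eng h1 h2)
    then show ?case by (auto simp: snd_mult_wreath real_vec_simps intro: span_add)
  qed (auto simp: one_wreath real_vec_simps span_zero intro: span_base)
  then have sp: "real_vec x \<in> span (real_vec ` ?D)" for x
  proof -
    have "((\<lambda>_. \<one>\<^bsub>L\<^esub>), x) \<in> carrier G" by (simp add: carrier_wreath)
    with gen \<open>\<And>g. g \<in> generate G (set_pmf \<mu>) \<Longrightarrow> real_vec (snd g) \<in> span (real_vec ` ?D)\<close>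
    show ?thesis by (metis snd_conv)
  qed
  have "axis i 1 \<in> span (real_vec ` ?D)" for i
  proof -
    have "real_vec (axis i 1) = axis i 1" by (simp add: real_vec_def vec_eq_iff axis_def)
    then show ?thesis using sp[of "axis i 1"] by simp
  qed
  then have "(Basis :: (real ^ 'd) set) \<subseteq> span (real_vec ` ?D)" by (auto simp: Basis_vec_def)
  then have full: "span (real_vec ` ?D) = UNIV"
    by (metis span_Basis span_minimal subspace_span top.extremum_uniqueI)
  obtain B where B: "B \<subseteq> real_vec ` ?D" "independent B" "real_vec ` ?D \<subseteq> span B" "card B = dim (real_vec ` ?D)"
    using basis_exists[of "real_vec ` ?D"] by blast
  have "dim (real_vec ` ?D) = CARD('d)"
    using dim_span[of "real_vec ` ?D"] by (simp add: full dim_UNIV)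
  then have "3 \<le> card B" using B(4) d by simp
  then obtain T where T: "T \<subseteq> B" "card T = 3" by (meson obtain_subset_with_card_n)
  then obtain x y z where xyz: "T = {x, y, z}" "x \<noteq> y" "x \<noteq> z" "y \<noteq> z" by (auto simp: card_3_iff)
  have ind: "independent {x, y, z}" using B(2) T(1) xyz(1) independent_mono by blast
  have "\<exists>v. v \<in> ?D \<and> w = real_vec v" if "w \<in> T" for w using B(1) T(1) that by blast
  then obtain v1 v2 v3 where v: "v1 \<in> ?D" "x = real_vec v1" "v2 \<in> ?D" "y = real_vec v2" "v3 \<in> ?D" "z = real_vec v3"
    unfolding xyz(1) by (metis insertCI)
  show ?thesis
  proof (rule that[OF v(1,3,5)])
    fix a b c :: int assume eq: "a *s v1 + b *s v2 + c *s v3 = 0"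
    define u where "u w = (if w = x then real_of_int a else if w = y then real_of_int b else real_of_int c)" for w
    have "(\<Sum>w\<in>{x, y, z}. u w *\<^sub>R w) = real_vec (a *s v1 + b *s v2 + c *s v3)"
      using xyz by (simp add: u_def real_vec_simps v(2,4,6)[symmetric])
    also have "\<dots> = 0" unfolding eq by (simp add: real_vec_simps)
    finally have sum0: "(\<Sum>w\<in>{x, y, z}. u w *\<^sub>R w) = 0" .
    have "\<forall>w\<in>{x, y, z}. u w = 0"
    proof (rule ccontr)
      assume "\<not> (\<forall>w\<in>{x, y, z}. u w = 0)"
      then have "dependent {x, y, z}" using sum0 by (subst dependent_finite) auto
      then show False using ind by simp
    qed
    then show "a = 0 \<and> b = 0 \<and> c = 0" using xyz by (auto simp: u_def)
  qed
qed

lemma AE_pos_transient: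
  assumes "generate G (set_pmf \<mu>) = carrier G" "carrier L \<noteq> {\<one>\<^bsub>L\<^esub>}" "CARD('d) \<ge> 3"
  shows "AE \<omega> in S. \<forall>z. eventually (\<lambda>n. pos \<omega> n \<noteq> z) sequentially"
proof (rule AE_hom_walk_transient)
  show "countable (UNIV :: (int ^ 'd) set)" by simp
  fix z
  obtain v1 v2 v3 where v: "v1 \<in> snd ` set_pmf \<mu>" "v2 \<in> snd ` set_pmf \<mu>" "v3 \<in> snd ` set_pmf \<mu>"
    "\<And>a b c :: int. a *s v1 + b *s v2 + c *s v3 = 0 \<Longrightarrow> a = 0 \<and> b = 0 \<and> c = 0"
    by (rule independent_steps[OF assms(1,3)]) blast
  show "summable (\<lambda>n. pmf (walk_pmf (map_pmf snd \<mu>) n) z)"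
    by (rule walk_pmf_summable[of _ v1 v2 v3]) (use zero_in_projection[OF assms(1,2)] v in auto)
qed

end

text \<open>Approximations with errors 2^(-n) agree eventually with \<open>X\<close> at almost every
  point, by the Borel-Cantelli lemma. So their limit superior, a preimage itself, differs from
  \<open>X\<close> by a null set.\<close>

lemma completed_field_approx:
  assumes M: "prob_space M" and b: "b \<in> M \<rightarrow>\<^sub>M N" and X: "X \<in> sets M"
    and approx: "\<And>\<epsilon>::real. 0 < \<epsilon> \<Longrightarrow>
      \<exists>A\<in>sets N. measure M ((X - (b -` A \<inter> space M)) \<union> ((b -` A \<inter> space M) - X)) \<le> \<epsilon>"
  shows "X \<in> completed_field M {b -` A \<inter> space M | A. A \<in> sets N}"
proof -
  interpret prob_space M by fact
  let ?B = "{b -` A \<inter> space M | A. A \<in> sets N}"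
  let ?null = "{Z. \<exists>N'\<in>null_sets M. Z \<subseteq> N'}"
  obtain A where A: "\<And>n. A n \<in> sets N"
    "\<And>n. measure M ((X - (b -` A n \<inter> space M)) \<union> ((b -` A n \<inter> space M) - X)) \<le> (1 / 2) ^ n"
  proof -
    have "\<forall>n. \<exists>A\<in>sets N. measure M ((X - (b -` A \<inter> space M)) \<union> ((b -` A \<inter> space M) - X)) \<le> (1 / 2) ^ n"
      by (intro allI approx) simp
    then show ?thesis using that by metis
  qed
  define B where "B n = b -` A n \<inter> space M" for n
  have B: "B n \<in> sets M" "B n \<in> ?B" for n
    using measurable_sets[OF b A(1)] A(1) by (auto simp: B_def)
  define Y where "Y = (\<Inter>m. \<Union>n\<in>{m..}. B n)"
  have Ys: "Y \<in> sets M" unfolding Y_def using B(1) by auto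
  have Xsp: "X \<subseteq> space M" using sets.sets_into_space[OF X] .
  have "AE x in M. eventually (\<lambda>n. x \<in> space M - ((X - B n) \<union> (B n - X))) sequentially"
  proof (rule borel_cantelli_AE1)
    show "(X - B n) \<union> (B n - X) \<in> sets M" for n using X B(1) by auto
    show "summable (\<lambda>n. measure M ((X - B n) \<union> (B n - X)))"
      by (rule summable_comparison_test'[OF summable_geometric[of "1/2 :: real"], of 0])
        (use A(2) in \<open>auto simp: B_def\<close>)
  qed (simp add: emeasure_eq_measure)
  then have "AE x in M. x \<in> X \<longleftrightarrow> x \<in> Y"
  proof eventually_elim
    case (elim x)
    then obtain m where m: "\<And>n. m \<le> n \<Longrightarrow> x \<in> X \<longleftrightarrow> x \<in> B n"
      unfolding eventually_sequentially by blast
    show ?case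
    proof
      assume "x \<in> X"
      then have "x \<in> B (max m k)" for k using m[of "max m k"] by simp
      then show "x \<in> Y" unfolding Y_def by (auto intro: max.cobounded2)
    next
      assume "x \<in> Y"
      then obtain n where "m \<le> n" "x \<in> B n" unfolding Y_def by auto
      then show "x \<in> X" using m by blast
    qed
  qed
  then have "AE x in M. x \<notin> (X - Y) \<union> (Y - X)" by eventually_elim auto
  then have null: "(X - Y) \<union> (Y - X) \<in> null_sets M"
    by (subst AE_iff_null_sets) (use X Ys in auto)
  have sub: "?B \<union> ?null \<subseteq> Pow (space M)"
    using sets.sets_into_space[of _ M] by (auto simp: null_sets_def)
  interpret C: sigma_algebra "space M" "completed_field M ?B"
    unfolding completed_field_def by (rule sigma_algebra_sigma_sets[OF sub])
  have "B n \<in> completed_field M ?B" for n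
    unfolding completed_field_def using B(2) by (intro sigma_sets.Basic) auto
  then have Y: "Y \<in> completed_field M ?B"
    unfolding Y_def by (intro C.countable_INT C.countable_UN') auto
  have XY: "X - Y \<in> completed_field M ?B" and YX: "Y - X \<in> completed_field M ?B"
    unfolding completed_field_def using null by (intro sigma_sets.Basic; blast)+
  have "(Y - (Y - X)) \<union> (X - Y) \<in> completed_field M ?B"
    by (rule C.Un[OF C.Diff[OF Y YX] XY])
  moreover have "(Y - (Y - X)) \<union> (X - Y) = X" by blast
  ultimately show ?thesis by (simp only:)
qed

context lamplighter
begin

section \<open>The configuration space and the action\<close>

abbreviation config_space :: "(int ^ 'd \<Rightarrow> 'l) measure" where
  "config_space \<equiv> lamp_space L int_lattice"

abbreviation act :: "(int ^ 'd \<Rightarrow> 'l) \<times> (int ^ 'd) \<Rightarrow> (int ^ 'd \<Rightarrow> 'l) \<Rightarrow> int ^ 'd \<Rightarrow> 'l" where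
  "act \<equiv> lamp_action L int_lattice"

lemma space_config: "\<phi> \<in> space config_space \<longleftrightarrow> (\<forall>z. \<phi> z \<in> carrier L)"
  by (auto simp: lamp_space_def space_PiM)

lemma lamp_configs_eq: "lamp_configs L (int_lattice :: (int ^ 'd) monoid) = space config_space"
  by (simp add: lamp_space_def space_PiM lamp_configs_def)

lemma lim_lamps_measurable: "lim_lamps \<in> path_space G \<rightarrow>\<^sub>M config_space"
proof -
  have "(\<lambda>w z. lim_lamps w z) \<in> path_space G \<rightarrow>\<^sub>M (\<Pi>\<^sub>M z\<in>(UNIV :: (int ^ 'd) set). count_space (carrier L))"
    by (rule measurable_PiM_single') (use lim_lamps_component_measurable lim_lamps_closed in \<open>auto simp: PiE_iff\<close>)
  then show ?thesis by (simp add: lamp_space_def)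
qed

lemma config_component_measurable: "(\<lambda>\<phi>. \<phi> z) \<in> config_space \<rightarrow>\<^sub>M count_space (carrier L)"
  unfolding lamp_space_def by simp

lemma act_eq: "\<phi> \<in> space config_space \<Longrightarrow> act g \<phi> = (\<lambda>z. fst g z \<otimes>\<^bsub>L\<^esub> \<phi> (z - snd g))"
  by (cases g) (simp add: lamp_action_def lamp_configs_eq mult_config_def translate_config_def restrict_def)

lemma act_closed: "g \<in> carrier G \<Longrightarrow> \<phi> \<in> space config_space \<Longrightarrow> act g \<phi> \<in> space config_space"
  by (simp add: act_eq space_config carrierD)

lemma act_mult:
  assumes "g \<in> carrier G" "h \<in> carrier G" "\<phi> \<in> space config_space"
  shows "act (g \<otimes>\<^bsub>G\<^esub> h) \<phi> = act g (act h \<phi>)"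
proof
  fix z
  have "\<phi> w \<in> carrier L" for w using assms(3) by (simp add: space_config)
  then show "act (g \<otimes>\<^bsub>G\<^esub> h) \<phi> z = act g (act h \<phi>) z"
    using assms act_closed[OF assms(2,3)]
    by (simp add: act_eq fst_mult_wreath snd_mult_wreath L.m_assoc carrierD algebra_simps)
qed

lemma act_one: "\<phi> \<in> space config_space \<Longrightarrow> act \<one>\<^bsub>G\<^esub> \<phi> = \<phi>"
  by (simp add: act_eq one_wreath space_config)

lemma act_Bij: "g \<in> carrier G \<Longrightarrow> act g \<in> Bij (space config_space)"
proof -
  assume g: "g \<in> carrier G"
  have "bij_betw (act g) (space config_space) (space config_space)"
  proof (rule bij_betw_byWitness[where f' = "act (inv\<^bsub>G\<^esub> g)"])
    show "\<forall>\<phi>\<in>space config_space. act (inv\<^bsub>G\<^esub> g) (act g \<phi>) = \<phi>"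
      "\<forall>\<phi>\<in>space config_space. act g (act (inv\<^bsub>G\<^esub> g) \<phi>) = \<phi>"
      using g by (simp_all add: act_mult[symmetric] act_one)
    show "act g ` space config_space \<subseteq> space config_space"
      using act_closed[OF g] by (rule image_subsetI)
    show "act (inv\<^bsub>G\<^esub> g) ` space config_space \<subseteq> space config_space"
      using act_closed[OF inv_closed[OF g]] by (rule image_subsetI)
  qed
  moreover have "act g \<in> extensional (space config_space)"
    by (cases g) (simp add: lamp_action_def lamp_configs_eq)
  ultimately show ?thesis by (simp add: Bij_def)
qed

lemma group_action_act: "group_action G (space config_space) act"
proof -
  have "act \<in> hom G (BijGroup (space config_space))"
  proof (rule homI)
    show "act g \<in> carrier (BijGroup (space config_space))" if "g \<in> carrier G" for g
      using act_Bij[OF that] by (simp add: BijGroup_def)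
    fix g h assume gh: "g \<in> carrier G" "h \<in> carrier G"
    have "act (g \<otimes>\<^bsub>G\<^esub> h) = compose (space config_space) (act g) (act h)"
    proof (rule extensionalityI)
      show "act (g \<otimes>\<^bsub>G\<^esub> h) \<in> extensional (space config_space)"
        using act_Bij[of "g \<otimes>\<^bsub>G\<^esub> h"] gh by (simp add: Bij_def)
      show "compose (space config_space) (act g) (act h) \<in> extensional (space config_space)" by simp
    qed (simp add: act_mult gh compose_eq)
    then show "act (g \<otimes>\<^bsub>G\<^esub> h) = act g \<otimes>\<^bsub>BijGroup (space config_space)\<^esub> act h"
      using gh by (simp add: BijGroup_def act_Bij)
  qed
  then show ?thesis
    unfolding group_action_def group_hom_def group_hom_axioms_def
    by (simp add: group_BijGroup is_group)
qed

lemma act_measurable: "g \<in> carrier G \<Longrightarrow> act g \<in> config_space \<rightarrow>\<^sub>M config_space"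
proof -
  assume g: "g \<in> carrier G"
  have "(\<lambda>\<phi> z. fst g z \<otimes>\<^bsub>L\<^esub> \<phi> (z - snd g)) \<in>
      config_space \<rightarrow>\<^sub>M (\<Pi>\<^sub>M z\<in>(UNIV :: (int ^ 'd) set). count_space (carrier L))"
  proof (rule measurable_PiM_single')
    fix z
    have "(\<lambda>l. fst g z \<otimes>\<^bsub>L\<^esub> l) \<in> count_space (carrier L) \<rightarrow>\<^sub>M count_space (carrier L)"
      using carrierD[OF g] by simp
    then show "(\<lambda>\<phi>. fst g z \<otimes>\<^bsub>L\<^esub> \<phi> (z - snd g)) \<in> config_space \<rightarrow>\<^sub>M count_space (carrier L)"
      by (rule measurable_compose[OF config_component_measurable])
  qed (use carrierD[OF g] space_config in \<open>auto simp: PiE_iff\<close>)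
  then have "(\<lambda>\<phi> z. fst g z \<otimes>\<^bsub>L\<^esub> \<phi> (z - snd g)) \<in> config_space \<rightarrow>\<^sub>M config_space"
    by (simp add: lamp_space_def)
  then show ?thesis by (subst measurable_cong[OF act_eq])
qed

text \<open>Single lamp values at single sites generate: any condition on one lamp is a countable
  union of them, and there are countably many sites and values.\<close>

lemma countably_generated_config: "countably_generated config_space"
proof -
  let ?X = "space config_space"
  let ?C = "{{\<phi> \<in> ?X. \<phi> z = l} | z l. l \<in> carrier L}"
  have C: "?C = (\<lambda>(z, l). {\<phi> \<in> ?X. \<phi> z = l}) ` (UNIV \<times> carrier L)" by auto
  have cC: "countable ?C" unfolding C using countable_L by (intro countable_image countable_SIGMA) auto
  have sub: "?C \<subseteq> Pow ?X" by auto
  interpret sigma_algebra ?X "sigma_sets ?X ?C" by (rule sigma_algebra_sigma_sets[OF sub])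
  have PiE: "?X = (\<Pi>\<^sub>E z\<in>(UNIV :: (int ^ 'd) set). space (count_space (carrier L)))"
    by (simp add: lamp_space_def space_PiM)
  have gen: "sets config_space = sigma_sets ?X {{\<phi> \<in> ?X. \<phi> z \<in> A} | z A. z \<in> UNIV \<and> A \<in> sets (count_space (carrier L))}"
    unfolding PiE unfolding lamp_space_def int_lattice_simps by (rule sets_PiM_single)
  have "sets config_space = sigma_sets ?X ?C"
  proof (rule antisym)
    show "sets config_space \<subseteq> sigma_sets ?X ?C"
      unfolding gen
    proof (rule sigma_sets_mono, rule subsetI)
      fix a assume "a \<in> {{\<phi> \<in> ?X. \<phi> z \<in> A} | z A. z \<in> UNIV \<and> A \<in> sets (count_space (carrier L))}"
      then obtain z A where a: "a = {\<phi> \<in> ?X. \<phi> z \<in> A}" "A \<subseteq> carrier L" by auto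
      have "a = (\<Union>l\<in>A. {\<phi> \<in> ?X. \<phi> z = l})" using a by auto
      also have "\<dots> \<in> sigma_sets ?X ?C"
        using a(2) countable_subset[OF a(2) countable_L]
        by (intro countable_UN') (auto intro!: sigma_sets.Basic)
      finally show "a \<in> sigma_sets ?X ?C" .
    qed
    show "sigma_sets ?X ?C \<subseteq> sets config_space"
    proof (rule sets.sigma_sets_subset, rule subsetI)
      fix a assume "a \<in> ?C"
      then obtain z l where a: "a = {\<phi> \<in> ?X. \<phi> z = l}" "l \<in> carrier L" by auto
      have "a = (\<lambda>\<phi>. \<phi> z) -` {l} \<inter> ?X" using a by auto
      then show "a \<in> sets config_space"
        using measurable_sets[OF config_component_measurable, of "{l}" z] a(2) by simp
    qed
  qed
  then show ?thesis unfolding countably_generated_def using cC sub by blast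
qed

lemma separates_points_config: "separates_points config_space"
  unfolding separates_points_def
proof (intro ballI impI)
  fix \<phi> \<psi> assume \<phi>: "\<phi> \<in> space config_space" and "\<psi> \<in> space config_space" "\<phi> \<noteq> \<psi>"
  then obtain z where z: "\<phi> z \<noteq> \<psi> z" by auto
  let ?A = "(\<lambda>\<phi>. \<phi> z) -` {\<phi> z} \<inter> space config_space"
  have "?A \<in> sets config_space"
    using \<phi> by (intro measurable_sets[OF config_component_measurable]) (simp add: space_config)
  then show "\<exists>A\<in>sets config_space. \<phi> \<in> A \<and> \<psi> \<notin> A" using \<phi> z by (intro bexI[of _ ?A]) auto
qed

section \<open>Verification of the boundary property\<close>

lemma lim_lamps_preimage_invariant:
  assumes "A \<in> sets config_space"
  shows "lim_lamps -` A \<inter> space (path_space G) \<in> invariant_events G"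
  unfolding invariant_events_def
proof (intro CollectI conjI)
  show "lim_lamps -` A \<inter> space (path_space G) \<in> sets (path_space G)"
    by (rule measurable_sets[OF lim_lamps_measurable assms])
  show "path_shift -` (lim_lamps -` A \<inter> space (path_space G)) \<inter> space (path_space G) =
      lim_lamps -` A \<inter> space (path_space G)"
    using path_shift_space by (auto simp: lim_lamps_path_shift)
qed

lemma space_walk_law: "space (walk_law G \<mu>) = space (path_space G)"
  and sets_walk_law: "sets (walk_law G \<mu>) = sets (path_space G)"
  by (simp_all add: walk_law_def)

lemma prob_space_walk_law: "prob_space (walk_law G \<mu>)"
  unfolding walk_law_def by (rule P.prob_space_distr[OF walk_measurable])

theorem limit_lamps_poisson_boundary:
  assumes gen: "generate G (set_pmf \<mu>) = carrier G" and L: "carrier L \<noteq> {\<one>\<^bsub>L\<^esub>}" and d: "CARD('d) \<ge> 3"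
    and fin: "entropy_pmf \<mu> < \<infinity>" and proj: "finite (snd ` set_pmf \<mu>)"
  shows "AE w in walk_law G \<mu>. converges w"
    and "poisson_boundary G \<mu> (limit_law L int_lattice \<mu>) act lim_lamps"
proof -
  let ?W = "walk_law G \<mu>" and ?N = "limit_law L (int_lattice :: (int ^ 'd) monoid) \<mu>"
  have tr: "AE \<omega> in S. \<forall>z. eventually (\<lambda>n. pos \<omega> n \<noteq> z) sequentially"
    by (rule AE_pos_transient[OF gen L d])
  have convS: "AE \<omega> in S. converges (walk \<omega>)"
    using AE_admissible tr by eventually_elim (rule converges_walk)
  then show conv: "AE w in ?W. converges w"
    unfolding walk_law_def by (subst AE_distr_iff[OF walk_measurable converges_sets])
  have lm: "lim_lamps \<in> ?W \<rightarrow>\<^sub>M config_space"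
    using lim_lamps_measurable by (simp add: walk_law_def)
  have spN: "space ?N = space config_space" and setsN: "sets ?N = sets config_space"
    by (simp_all add: limit_law_def)
  have mN: "f \<in> M' \<rightarrow>\<^sub>M ?N \<longleftrightarrow> f \<in> M' \<rightarrow>\<^sub>M config_space" for f and M' :: "'x measure"
    by (intro arg_cong[of _ _ "\<lambda>A. f \<in> A"] measurable_cong_sets setsN refl)

  have approx: "\<exists>A\<in>sets config_space. measure ?W ((X - (lim_lamps -` A \<inter> space ?W)) \<union> ((lim_lamps -` A \<inter> space ?W) - X)) \<le> \<epsilon>"
    if X: "X \<in> invariant_events G" and \<epsilon>: "0 < \<epsilon>" for X and \<epsilon> :: real
  proof -
    obtain R where R: "\<And>x. x \<in> snd ` set_pmf \<mu> \<Longrightarrow> x \<in> cube R"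
      by (rule projection_cube[OF proj]) blast
    have "\<exists>zs D. measure ?W {w \<in> space (path_space G). w \<in> X \<longleftrightarrow> lamp_window zs w \<notin> D} \<le> \<epsilon>"
    proof (rule entropy_criterion[OF fin lamp_window_measurable _ _ _ X \<epsilon>])
      show "lamp_window zs (path_shift w) = lamp_window zs w" for zs w
        by (simp add: lamp_window_def lim_lamps_path_shift)
      show "\<exists>n>0. \<exists>zs. P.cond_ent (\<lambda>\<omega>. walk \<omega> (n * k)) (\<lambda>\<omega>. lamp_window zs (walk \<omega>)) \<le> ennreal (\<epsilon> * real n)"
        if "0 < k" "0 < \<epsilon>" for k and \<epsilon> :: real
        by (rule walk_cond_ent_small[OF R tr fin that])
      fix zs g assume g: "g \<in> carrier G"
      \<comment> \<open>After translation by g, the lamp at z is read off from the lamp at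
        \<open>z - snd g\<close> of the original path.\<close>
      let ?ys = "map (\<lambda>z. z - snd g) zs"
      have "AE \<omega> in S. lamp_window zs (translate g (walk \<omega>)) =
          map2 (\<lambda>z l. fst g z \<otimes>\<^bsub>L\<^esub> l) zs (lamp_window ?ys (walk \<omega>))"
        using convS
      proof eventually_elim
        case (elim \<omega>)
        then show ?case
          using translate_lim_lamps[OF elim g] by (auto simp: lamp_window_def list_eq_iff_nth_eq)
      qed
      then show "\<exists>ys. P.determines (\<lambda>\<omega>. lamp_window ys (walk \<omega>)) (\<lambda>\<omega>. lamp_window zs (translate g (walk \<omega>)))"
        by (intro exI[of _ ?ys]) (rule P.determines_AE_I)
    qed
    then obtain zs D where zs: "measure ?W {w \<in> space (path_space G). w \<in> X \<longleftrightarrow> lamp_window zs w \<notin> D} \<le> \<epsilon>"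
      by blast
    \<comment> \<open>The set of configurations whose window lies in D; the error event of the
      criterion is the symmetric difference of X and its preimage.\<close>
    define A where "A = (\<lambda>\<phi>. map (\<lambda>z. \<phi> z) zs) -` D \<inter> space config_space"
    have A: "A \<in> sets config_space"
      unfolding A_def by (rule measurable_sets[OF map_list_measurable(1)[OF countable_L config_component_measurable]]) simp
    have Xsp: "X \<subseteq> space (path_space G)"
      using X sets.sets_into_space by (auto simp: invariant_events_def)
    have "(X - (lim_lamps -` A \<inter> space ?W)) \<union> ((lim_lamps -` A \<inter> space ?W) - X) =
        {w \<in> space (path_space G). w \<in> X \<longleftrightarrow> lamp_window zs w \<notin> D}"
      using Xsp lim_lamps_closed by (auto simp: A_def space_walk_law space_config lamp_window_def)
    then show ?thesis using zs A by (intro bexI[of _ A]) simp_all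
  qed

  \<comment> \<open>One inclusion is shift invariance of the limiting lamps. The other combines the
    approximation above with passage to a limit modulo null sets.\<close>
  have eqnull: "eq_mod_null ?W {lim_lamps -` A \<inter> space ?W | A. A \<in> sets ?N} (invariant_events G)"
    unfolding eq_mod_null_def
  proof (rule antisym)
    have "{lim_lamps -` A \<inter> space ?W | A. A \<in> sets ?N} \<subseteq> invariant_events G"
      using lim_lamps_preimage_invariant by (auto simp: setsN space_walk_law)
    then show "completed_field ?W {lim_lamps -` A \<inter> space ?W | A. A \<in> sets ?N} \<subseteq> completed_field ?W (invariant_events G)"
      unfolding completed_field_def by (intro sigma_sets_mono') blast
    have "X \<in> completed_field ?W {lim_lamps -` A \<inter> space ?W | A. A \<in> sets ?N}" if "X \<in> invariant_events G" for X
      unfolding setsN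
      by (rule completed_field_approx[OF prob_space_walk_law lm _ approx[OF that]])
        (use that in \<open>simp add: invariant_events_def sets_walk_law\<close>)
    then show "completed_field ?W (invariant_events G) \<subseteq> completed_field ?W {lim_lamps -` A \<inter> space ?W | A. A \<in> sets ?N}"
      unfolding completed_field_def by (intro sigma_sets_mono) (auto intro: sigma_sets.Basic)
  qed

  have inv_meas: "lim_lamps \<in> invariant_field G \<rightarrow>\<^sub>M ?N"
  proof (rule measurableI)
    have spI: "space (invariant_field G) = space (path_space G)"
      unfolding invariant_field_def by (rule space_measure_of) (auto simp: invariant_events_def dest: sets.sets_into_space)
    show "lim_lamps w \<in> space ?N" for w using lim_lamps_closed by (simp add: spN space_config)
    show "lim_lamps -` A \<inter> space (invariant_field G) \<in> sets (invariant_field G)" if "A \<in> sets ?N" for A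
      using lim_lamps_preimage_invariant that by (simp add: setsN sets_invariant_field spI)
  qed

  have equivar: "AE w in ?W. lim_lamps (\<lambda>n. g \<otimes>\<^bsub>G\<^esub> w n) = act g (lim_lamps w)" if g: "g \<in> carrier G" for g
    using conv
  proof eventually_elim
    case (elim w)
    then show ?case
      using translate_lim_lamps[OF elim g] lim_lamps_closed by (simp add: act_eq space_config fun_eq_iff)
  qed

  have gen': "countably_generated ?N" "separates_points ?N"
    using countably_generated_config separates_points_config
    by (simp_all add: countably_generated_def separates_points_def spN setsN)

  show "poisson_boundary G \<mu> ?N act lim_lamps"
    unfolding poisson_boundary_def
  proof (intro conjI ballI)
    show "prob_space ?N"
      unfolding limit_law_def by (rule prob_space.prob_space_distr[OF prob_space_walk_law lm])
    show "group_action G (space ?N) act" unfolding spN by (rule group_action_act)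
    show "act g \<in> ?N \<rightarrow>\<^sub>M ?N" if "g \<in> carrier G" for g
      using act_measurable[OF that] by (simp add: measurable_cong_sets[OF setsN setsN])
    show "distr ?W ?N lim_lamps = ?N"
      unfolding limit_law_def by (rule distr_cong) simp_all
  qed (use gen' inv_meas equivar eqnull in auto)
qed

end

theorem theorem3p1:
  fixes L :: "('l, 'm) monoid_scheme"
    and \<mu> :: "((int ^ 'd \<Rightarrow> 'l) \<times> (int ^ 'd)) pmf"
  assumes "group L" and "countable (carrier L)" and "carrier L \<noteq> {\<one>\<^bsub>L\<^esub>}"
    and "CARD('d) \<ge> 3"
    and "set_pmf \<mu> \<subseteq> carrier (wreath_product L int_lattice)"
    and "entropy_pmf \<mu> < \<infinity>"
    and "generate (wreath_product L int_lattice) (set_pmf \<mu>) = carrier (wreath_product L int_lattice)"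
    and "set_pmf \<mu> \<subseteq>
      {(delta_config L int_lattice s, 0) | s. s \<in> carrier L} \<union>
      {(id_config L int_lattice, x) | x. True}"
    and "finite (set_pmf (map_pmf snd \<mu>))"
    and "measure_pmf.expectation (map_pmf snd \<mu>) (\<lambda>x. (\<chi> i. real_of_int (x $ i)) :: real ^ 'd) = 0"
  shows "(AE \<omega> in walk_law (wreath_product L int_lattice) \<mu>. lamps_converge L int_lattice \<omega>) \<and>
    poisson_boundary (wreath_product L int_lattice) \<mu> (limit_law L int_lattice \<mu>)
      (lamp_action L int_lattice) (limit_lamps L int_lattice)"
proof -
  interpret L: group L by fact
  interpret lamplighter L \<mu>
    by unfold_locales (use assms in auto)
  have "finite (snd ` set_pmf \<mu>)" using assms(9) by simp
  from limit_lamps_poisson_boundary[OF assms(7,3,4,6) this] show ?thesis by blast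
qed

end
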